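(* Let $\mathcal{C}^b$ be the set of bounded compatible pairs, and let $\mathcal{T}^b$ be the set of pairs $(P,Q)$ of tableaux of the same partition shape such that $P$ is a decreasing tableau, $Q$ is a reverse set-valued tableau, and $K_+(P)\ge K_-(L(Q))$. Then the Hecke insertion map $\mathrm{Insert}$ restricts to a bijection $\mathcal{C}^b\to\mathcal{T}^b$.
   Context: Compatible pairs. A pair of words $(a,i)$ is compatible if $a,i$ are words of positive integers of the same length, $i$ is weakly decreasing, and $i_j=i_{j+1}$ implies $a_j<a_{j+1}$. It is bounded if $i_j\le a_j$ for all $j$. Tableaux (English notation, partition shape). A decreasing tableau has positive integer entries strictly decreasing along rows (left to right) and down columns. A reverse semistandard Young tableau (RSSYT) is weakly decreasing along rows and strictly decreasing down columns. A reverse set-valued tableau (RSVT) fills each box $s$ with a nonempty finite set $T(s)\subset\mathbb{Z}_{>0}$ such that $\min T(s)\ge\max T(t)$ if $t$ is immediately right of $s$, and $\min T(s)>\max T(t)$ if $t$ is immediately below $s$. $L(T)$ is the RSSYT obtained by replacing each set $T(s)$ by its maximum. Hecke (column) insertion of a positive integer $x$ into a decreasing tableau $T$ of partition shape gives a triple $(P,c,\alpha)$: a decreasing tableau $P$, a box $c$ of $P$, and $\alpha\in\{0,1\}$. Insert $x$ into column 1; if a number is output, insert it into the next column, and so on until there is no output. To insert $x$ into a column: (Case 1) If $x$ is less than or equal to all entries of the column (in particular if it is empty), there is no output. If appending $x$ at the bottom of the column yields a decreasing tableau (of partition shape), do so, let $c$ be the new box and $\alpha=1$; otherwise leave the column unchanged,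 let $c$ be the rightmost box in the row containing the bottom entry of this column and $\alpha=0$. (Case 2) Otherwise let $y$ be the largest entry of the column with $y<x$; output $y$, and replace $y$ by $x$ if the result is a decreasing tableau, else leave the column unchanged. The map $\mathrm{Insert}$ is defined on all compatible pairs: $\mathrm{Insert}$ of the empty pair is the pair of empty tableaux. If $a=a'x$, $i=i'y$ with $x,y$ letters and $(P',Q')=\mathrm{Insert}(a',i')$, Hecke insert $x$ into $P'$ to get $(P,c,\alpha)$; $Q$ is obtained from $Q'$ by adjoining a new box at position $c$ containing $\{y\}$ if $\alpha=1$, and by adding $y$ to the set in box $c$ if $\alpha=0$. Then $\mathrm{Insert}(a,i)=(P,Q)$. (It is known that $\mathrm{Insert}$ is a bijection from all compatible pairs to all pairs $(P,Q)$ of the same partition shape with $P$ decreasing and $Q$ an RSVT.) Right key of a decreasing tableau. For $S\subseteq\mathbb{Z}_{>0}$ and $m\in\mathbb{Z}_{>0}$, let $m'$ be the smallest element of $S$ with $m'\ge m$; set $S\star m=(S\setminus\{m'\})\cup\{m\}$ if $m'$ exists and $S\star m=S\cup\{m\}$ otherwise. For a word, $S\star w_1\cdots w_n=(\cdots(S\star w_1)\star\cdots)\star w_n$. $\mathrm{word}(T)$ reads the columns of $T$ from left to right, each from bottom to top. $K_+(P)$ is the key tableau whose $j$-th column is the set $\emptyset\star\mathrm{word}(P_{\ge j})$, where $P_{\ge j}$ is $P$ with its first $j-1$ columns removed. Left key of an RSSYT. Columns are identified with sets. If $C_1C_2$ are adjacent columns of an RSSYT and $C_2=\{a_1<\dots<a_m\}$,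 let $b_1$ be the smallest element of $C_1$ with $b_1\ge a_1$, and recursively $b_j$ the smallest element of $C_1$ with $b_j\ge a_j$ and $b_j>b_{j-1}$; put $C_1\triangleleft C_2=\{b_1<\dots<b_m\}$, and $C_1\triangleleft\cdots\triangleleft C_k=C_1\triangleleft(C_2\triangleleft\cdots\triangleleft C_k)$. For an RSSYT with columns $C_1,C_2,\dots$, $K_-(T)$ is the key tableau whose $k$-th column is $C_1\triangleleft\cdots\triangleleft C_k$. A key tableau is a tableau whose columns, as sets, are each contained in the previous one. For key tableaux of the same shape, $\ge$ is entrywise comparison (comparing the $r$-th smallest elements of corresponding columns). *)

theory Defs
  imports Main
begin

text \<open>
  Positive integers are natural numbers with an explicit positivity condition.
  A filling is the list of its columns from left to right, each column listed from top to bottom.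
  A box is a pair of a row index and a column index, both counted from 0, so the entry of the
  box \<open>(r, c)\<close> of \<open>T\<close> is \<open>T ! c ! r\<close>.
\<close>

subsection \<open>Compatible pairs\<close>

definition compatible_pair :: "nat list \<times> nat list \<Rightarrow> bool" where
  "compatible_pair = (\<lambda>(a, i).
     length a = length i \<and> (\<forall>x \<in> set a. 0 < x) \<and> (\<forall>y \<in> set i. 0 < y) \<and>
     sorted_wrt (\<ge>) i \<and>
     (\<forall>j. Suc j < length i \<longrightarrow> i ! j = i ! Suc j \<longrightarrow> a ! j < a ! Suc j))"

definition bounded_pair :: "nat list \<times> nat list \<Rightarrow> bool" where
  "bounded_pair = (\<lambda>(a, i). \<forall>j < length a. i ! j \<le> a ! j)"


subsection \<open>Tableaux\<close>

definition boxes :: "'a list list \<Rightarrow> (nat \<times> nat) set" where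
  "boxes T = {(r, c). c < length T \<and> r < length (T ! c)}"

text \<open>The shape is recorded by the column lengths, that is, by the conjugate partition.\<close>

definition shape :: "'a list list \<Rightarrow> nat list" where
  "shape T = map length T"

definition partition_shape :: "'a list list \<Rightarrow> bool" where
  "partition_shape T \<longleftrightarrow> sorted_wrt (\<ge>) (shape T) \<and> (\<forall>n \<in> set (shape T). 0 < n)"

definition decreasing_tableau :: "nat list list \<Rightarrow> bool" where
  "decreasing_tableau T \<longleftrightarrow> partition_shape T \<and>
     (\<forall>(r, c) \<in> boxes T. 0 < T ! c ! r) \<and>
     (\<forall>r c. (r, Suc c) \<in> boxes T \<longrightarrow> T ! Suc c ! r < T ! c ! r) \<and>
     (\<forall>r c. (Suc r, c) \<in> boxes T \<longrightarrow> T ! c ! Suc r < T ! c ! r)"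

definition rsvt :: "nat set list list \<Rightarrow> bool" where
  "rsvt T \<longleftrightarrow> partition_shape T \<and>
     (\<forall>(r, c) \<in> boxes T. finite (T ! c ! r) \<and> T ! c ! r \<noteq> {} \<and> (\<forall>n \<in> T ! c ! r. 0 < n)) \<and>
     (\<forall>r c. (r, Suc c) \<in> boxes T \<longrightarrow> Max (T ! Suc c ! r) \<le> Min (T ! c ! r)) \<and>
     (\<forall>r c. (Suc r, c) \<in> boxes T \<longrightarrow> Max (T ! c ! Suc r) < Min (T ! c ! r))"

definition max_tableau :: "nat set list list \<Rightarrow> nat list list" where
  "max_tableau T = map (map Max) T"


subsection \<open>Hecke column insertion\<close>

text \<open>The column of index \<open>length T\<close> is the empty column to the right of \<open>T\<close>.\<close>

definition column :: "'a list list \<Rightarrow> nat \<Rightarrow> 'a list" where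
  "column T k = (if k < length T then T ! k else [])"

definition set_column :: "'a list list \<Rightarrow> nat \<Rightarrow> 'a list \<Rightarrow> 'a list list" where
  "set_column T k C = (if k < length T then T[k := C] else T @ [C])"

definition append_entry :: "'a list list \<Rightarrow> nat \<Rightarrow> 'a \<Rightarrow> 'a list list" where
  "append_entry T k x = set_column T k (column T k @ [x])"

definition replace_entry :: "'a list list \<Rightarrow> nat \<Rightarrow> 'a \<Rightarrow> 'a \<Rightarrow> 'a list list" where
  "replace_entry T k y x = set_column T k (map (\<lambda>z. if z = y then x else z) (column T k))"

definition rightmost_box :: "'a list list \<Rightarrow> nat \<Rightarrow> nat \<times> nat" where
  "rightmost_box T r = (r, Max {c. (r, c) \<in> boxes T})"

text \<open>
  \<open>hecke_from k x T\<close> inserts \<open>x\<close> into the column of index \<open>k\<close> and passes any output on to the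
  next column.  The branch with \<open>\<alpha> = 0\<close> speaks of the bottom entry of the column; starting from
  column 0 of a decreasing tableau it is never reached with an empty column, since appending to
  an empty column then succeeds.
\<close>

function hecke_from ::
  "nat \<Rightarrow> nat \<Rightarrow> nat list list \<Rightarrow> nat list list \<times> (nat \<times> nat) \<times> nat" where
  "hecke_from k x T =
    (let C = column T k in
     if \<forall>z \<in> set C. x \<le> z then
       (if decreasing_tableau (append_entry T k x)
        then (append_entry T k x, (length C, k), 1)
        else (T, rightmost_box T (length C - 1), 0))
     else
       (let y = Max {z \<in> set C. z < x}; T' = replace_entry T k y x in
        hecke_from (Suc k) y (if decreasing_tableau T' then T' else T)))"
  by pat_completeness auto
termination
  by (relation "measure (\<lambda>(k, x, T). length T - k)")
    (auto simp: column_def replace_entry_def set_column_def split: if_splits)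

declare hecke_from.simps [simp del]

definition hecke_insert :: "nat \<Rightarrow> nat list list \<Rightarrow> nat list list \<times> (nat \<times> nat) \<times> nat" where
  "hecke_insert x T = hecke_from 0 x T"

definition add_to_box :: "'a set list list \<Rightarrow> nat \<times> nat \<Rightarrow> 'a \<Rightarrow> 'a set list list" where
  "add_to_box Q = (\<lambda>(r, c) y. Q[c := (Q ! c)[r := insert y (Q ! c ! r)]])"

text \<open>
  A newly created box lies at the bottom of its column, so adjoining it to \<open>Q\<close>, which has the
  same shape as \<open>P\<close> before the insertion, amounts to appending to the column.
\<close>

definition insert_step ::
  "nat list list \<times> nat set list list \<Rightarrow> nat \<times> nat \<Rightarrow> nat list list \<times> nat set list list" where
  "insert_step = (\<lambda>(P', Q') (x, y).
     let (P, (r, c), \<alpha>) = hecke_insert x P'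
     in (P, if \<alpha> = 1 then append_entry Q' c {y} else add_to_box Q' (r, c) y))"

definition Insert :: "nat list \<times> nat list \<Rightarrow> nat list list \<times> nat set list list" where
  "Insert = (\<lambda>(a, i). foldl insert_step ([], []) (zip a i))"

lemma Insert_Nil: "Insert ([], []) = ([], [])"
  by (simp add: Insert_def)

lemma Insert_snoc:
  assumes "length a = length i"
  shows "Insert (a @ [x], i @ [y]) = insert_step (Insert (a, i)) (x, y)"
  using assms by (simp add: Insert_def)


subsection \<open>Right and left keys\<close>

definition star :: "nat set \<Rightarrow> nat \<Rightarrow> nat set" where
  "star S m = (if \<exists>s \<in> S. m \<le> s then insert m (S - {LEAST s. s \<in> S \<and> m \<le> s}) else insert m S)"

definition star_word :: "nat set \<Rightarrow> nat list \<Rightarrow> nat set" where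
  "star_word S w = foldl star S w"

definition column_word :: "nat list list \<Rightarrow> nat list" where
  "column_word T = concat (map rev T)"

definition column_of_set :: "nat set \<Rightarrow> nat list" where
  "column_of_set S = rev (sorted_list_of_set S)"

definition right_key :: "nat list list \<Rightarrow> nat list list" where
  "right_key P = map (\<lambda>j. column_of_set (star_word {} (column_word (drop j P)))) [0..<length P]"

text \<open>
  The list argument is \<open>a\<^sub>1 < \<dots> < a\<^sub>m\<close>.  After choosing \<open>b\<^sub>j\<close> only the elements
  of \<open>C\<close> above \<open>b\<^sub>j\<close> remain available.  All the minima exist for the columns of an RSSYT.
\<close>

primrec greedy_match :: "nat set \<Rightarrow> nat list \<Rightarrow> nat list" where
  "greedy_match C [] = []"
| "greedy_match C (a # as) =
    (let b = (LEAST b. b \<in> C \<and> a \<le> b) in b # greedy_match {c \<in> C. b < c} as)"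

definition left_tri :: "nat set \<Rightarrow> nat set \<Rightarrow> nat set" where
  "left_tri C D = set (greedy_match C (sorted_list_of_set D))"

fun left_tri_list :: "nat set list \<Rightarrow> nat set" where
  "left_tri_list [] = {}"
| "left_tri_list [C] = C"
| "left_tri_list (C # D # Cs) = left_tri C (left_tri_list (D # Cs))"

definition left_key :: "nat list list \<Rightarrow> nat list list" where
  "left_key T =
    map (\<lambda>k. column_of_set (left_tri_list (map set (take (Suc k) T)))) [0..<length T]"

definition key_ge :: "nat list list \<Rightarrow> nat list list \<Rightarrow> bool" where
  "key_ge K K' \<longleftrightarrow> shape K = shape K' \<and> (\<forall>(r, c) \<in> boxes K. K' ! c ! r \<le> K ! c ! r)"


subsection \<open>The two sets in bijection\<close>

definition bounded_compatible_pairs :: "(nat list \<times> nat list) set" where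
  "bounded_compatible_pairs = {p. compatible_pair p \<and> bounded_pair p}"

definition bounded_tableau_pairs :: "(nat list list \<times> nat set list list) set" where
  "bounded_tableau_pairs = {(P, Q). shape P = shape Q \<and> decreasing_tableau P \<and> rsvt Q \<and>
     key_ge (right_key P) (left_key (max_tableau Q))}"

end

theory Submission
  imports Defs
begin

text \<open>
  Hecke insertion can be rearranged so that each step depends only on a column and its right
  neighbour. It is then reversed column by column, and comparing the entries passed on by two
  consecutive insertions of \<open>u\<close> and \<open>x\<close> shows that the second one ends strictly to the right of the
  first one iff \<open>u < x\<close>. Hence in any pair \<open>(P, Q)\<close> the letter recorded last is the rightmost
  occurrence of the least entry of \<open>Q\<close>, and the whole insertion can be undone.

  For the bound, insert \<open>x\<close> and record \<open>y\<close>. Since \<open>star_word\<close> is invariant under K-Knuth moves,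
  every column of the right key can only grow, and comparison of sizes shows that the keys change
  only if a new box arises, say in column \<open>k\<close>, and then only in column \<open>k\<close>. The right key gains
  there an element \<open>e\<close>, the least one of its new column \<open>k\<close> outside column \<open>k + 1\<close>; the left key
  gains \<open>f\<close>, the least element of its column \<open>k - 1\<close> outside the old column \<open>k\<close>, or \<open>y\<close> in the first
  column. Counting the entries up to a threshold \<open>t\<close> and using column \<open>k - 1\<close> when \<open>t < f\<close> and
  column \<open>k + 1\<close> when \<open>t < e\<close>, one finds that the key inequality holds after the step iff it held
  before and \<open>y \<le> x\<close>.
\<close>

section \<open>The star action\<close>

text \<open>When a replacement fails in Hecke insertion, the column and its output do not tell which
  letter arrived: it may equal the entry above the output or the left neighbour of the output. This
  ambiguity is why the passed values are redefined before anything is reversed. Bijectivity is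
  obtained for all compatible pairs; the bound enters only as an equivalence for one step. In that
  equivalence \<open>y \<le> x\<close> is forced by the first columns: after the step the right key
  has there an element that is at most \<open>x\<close>, while no entry of \<open>Q\<close> is below
  \<open>y\<close>. The remaining danger is a threshold at which only one of the two counts changes.
  If \<open>e \<le> t < f\<close>, the right key column \<open>k - 1\<close> contains the enlarged
  column \<open>k\<close>, and on the left key side columns \<open>k - 1\<close> and
  \<open>k\<close> agree up to \<open>t\<close>. If the step is undone and
  \<open>f \<le> t < e\<close>, the right key column \<open>k\<close> agrees up to \<open>t\<close>
  with column \<open>k + 1\<close>, and the left key columns are nested.\<close>

lemma star_none: "\<forall>s\<in>S. s < m \<Longrightarrow> star S m = insert m S"
  unfolding star_def by (meson leD)

lemma star_least:
  assumes "s \<in> S" "m \<le> s" "\<And>u. u \<in> S \<Longrightarrow> m \<le> u \<Longrightarrow> s \<le> u"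
  shows "star S m = insert m (S - {s})"
proof -
  have "(LEAST u. u \<in> S \<and> m \<le> u) = s"
    by (rule Least_equality) (use assms in auto)
  thus ?thesis using assms unfolding star_def by auto
qed

lemma star_cases:
  obtains (none) "\<forall>s\<in>S. s < m" "star S m = insert m S"
  | (some) s where "s \<in> S" "m \<le> s" "\<And>u. u \<in> S \<Longrightarrow> m \<le> u \<Longrightarrow> s \<le> u"
      "star S m = insert m (S - {s})"
proof (cases "\<exists>s\<in>S. m \<le> s")
  case True
  define s where "s = (LEAST u. u \<in> S \<and> m \<le> u)"
  obtain t where "t \<in> S \<and> m \<le> t" using True by blast
  then have s: "s \<in> S \<and> m \<le> s" unfolding s_def by (rule LeastI)
  have le: "s \<le> u" if "u \<in> S" "m \<le> u" for u
    unfolding s_def using that by (simp add: Least_le)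
  show ?thesis using s le by (intro some[of s] star_least) auto
next
  case False
  then have "\<forall>s\<in>S. s < m" by auto
  then show ?thesis using none star_none by blast
qed

lemma star_same: "m \<in> S \<Longrightarrow> star S m = S"
  by (subst star_least[of m]) auto

lemma mem_star [simp]: "m \<in> star S m"
  by (cases rule: star_cases[where S=S and m=m]) auto

lemma star_keeps: "s \<in> S \<Longrightarrow> s < m \<Longrightarrow> s \<in> star S m"
  by (cases rule: star_cases[where S=S and m=m]) auto

lemma finite_star [simp]: "finite S \<Longrightarrow> finite (star S m)"
  by (cases rule: star_cases[where S=S and m=m]) auto

lemma star_below:
  assumes "\<exists>s\<in>S. s \<le> x"
  shows "\<exists>s\<in>star S m. s \<le> x"
proof -
  obtain s where "s \<in> S" "s \<le> x" using assms by blast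
  then show ?thesis
    by (cases rule: star_cases[where S=S and m=m]) (auto intro: order_trans)
qed

text \<open>The element \<open>s\<close> separates the two letters: \<open>a\<close> displaces
  something below \<open>c\<close>, and \<open>c\<close> displaces something at or above itself, so
  neither letter sees the other.\<close>

lemma star_comm:
  assumes "s \<in> S" "a \<le> s" "s < c"
  shows "star (star S a) c = star (star S c) a"
proof -
  obtain u where u: "u \<in> S" "a \<le> u" "\<And>v. v \<in> S \<Longrightarrow> a \<le> v \<Longrightarrow> u \<le> v"
    "star S a = insert a (S - {u})"
    using assms by (cases rule: star_cases[where S=S and m=a]) auto
  have "u < c" using assms u by fastforce
  have *: "star T a = insert a (T - {u})" if "T = insert c S \<or> (\<exists>v. T = insert c (S - {v}) \<and> c \<le> v)" for T
    by (rule star_least) (use that u \<open>u < c\<close> in auto)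
  show ?thesis
  proof (cases rule: star_cases[where S=S and m=c])
    case none
    have "star (insert a (S - {u})) c = insert c (insert a (S - {u}))"
      by (rule star_none) (use none u \<open>u < c\<close> in auto)
    with none u(4) *[of "insert c S"] \<open>u < c\<close> show ?thesis by auto
  next
    case (some v)
    have "star (insert a (S - {u})) c = insert c (insert a (S - {u}) - {v})"
      by (rule star_least) (use some u \<open>u < c\<close> in auto)
    moreover have "star (insert c (S - {v})) a = insert a (insert c (S - {v}) - {u})"
      by (rule *) (use some in auto)
    moreover have "u \<noteq> v" "u \<noteq> c" using \<open>u < c\<close> some by auto
    ultimately show ?thesis unfolding some(4) u(4)
      using \<open>u < c\<close> \<open>a \<le> u\<close> some(2) by auto
  qed
qed

text \<open>With no element from \<open>a\<close> up to \<open>c\<close>, both letters compete for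
  the same slot: the \<open>c\<close> just inserted is the least element that is at least
  \<open>a\<close> and is displaced at once. For \<open>a < c\<close> this is exactly the case left
  open by \<open>star_comm\<close>.\<close>

lemma star_absorb:
  assumes "a \<le> c" "\<And>s. s \<in> S \<Longrightarrow> a \<le> s \<Longrightarrow> c \<le> s"
  shows "star (star S c) a = star S a"
proof (cases rule: star_cases[where S=S and m=c])
  case none
  have below: "\<forall>s\<in>S. s < a"
  proof
    fix s assume "s \<in> S"
    then show "s < a" using none assms(2)[of s] by (meson leD not_le)
  qed
  have "star (insert c S) a = insert a (insert c S - {c})"
    by (rule star_least) (use assms(1) below in auto)
  moreover have "c \<notin> S" using none by auto
  ultimately show ?thesis using none star_none[OF below] by simp
next
  case (some v)
  have 1: "star S a = insert a (S - {v})"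
    by (rule star_least) (use assms some in auto)
  have "star (insert c (S - {v})) a = insert a (insert c (S - {v}) - {c})"
    by (rule star_least) (use assms some in auto)
  moreover have "insert c (S - {v}) - {c} = S - {v}"
    using some(3)[of c] some(2) by auto
  ultimately show ?thesis using some(4) 1 by simp
qed

section \<open>Increasing words acting on a set\<close>

lemma star_word_simps [simp]:
  "star_word S [] = S" "star_word S (m # w) = star_word (star S m) w"
  "star_word S (v @ w) = star_word (star_word S v) w"
  by (simp_all add: star_word_def)

lemma finite_star_word [simp]: "finite S \<Longrightarrow> finite (star_word S w)"
  by (induction w arbitrary: S) auto

lemma star_word_below: "\<exists>s\<in>S. s \<le> x \<Longrightarrow> \<exists>s\<in>star_word S w. s \<le> x"
  by (induction w arbitrary: S) (simp_all add: star_below)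

lemma star_word_keeps: "s \<in> S \<Longrightarrow> \<forall>m\<in>set w. s < m \<Longrightarrow> s \<in> star_word S w"
  by (induction w arbitrary: S) (auto intro: star_keeps)

lemma star_word_increasing_superset: "sorted_wrt (<) w \<Longrightarrow> set w \<subseteq> star_word S w"
  by (induction w arbitrary: S) (auto intro: star_word_keeps)

lemma star_word_increasing_above:
  "sorted_wrt (<) w \<Longrightarrow> \<forall>s\<in>S. \<forall>m\<in>set w. s < m \<Longrightarrow> star_word S w = S \<union> set w"
  by (induction w arbitrary: S) (auto simp: star_none)

text \<open>The letter \<open>x\<close> is pushed towards its own occurrence in \<open>w\<close>.
  Each smaller letter on the way commutes with it or absorbs it, and next to its twin it merely acts
  twice, which is the same as once.\<close>

lemma star_word_absorb_member:
  assumes "sorted_wrt (<) w" "x \<in> set w"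
  shows "star_word (star S x) w = star_word S w"
  using assms
proof (induction w arbitrary: S)
  case (Cons d w)
  show ?case
  proof (cases "x = d")
    case True
    then show ?thesis by (simp add: star_same)
  next
    case False
    then have "d < x" "x \<in> set w" using Cons.prems by auto
    show ?thesis
    proof (cases "\<exists>s\<in>S. d \<le> s \<and> s < x")
      case True
      then obtain s where "s \<in> S" "d \<le> s" "s < x" by blast
    then have "star (star S x) d = star (star S d) x" by (rule star_comm[symmetric])
      then show ?thesis using Cons \<open>x \<in> set w\<close> by simp
    next
      case False
      then have "star (star S x) d = star S d"
        by (intro star_absorb) (use \<open>d < x\<close> in auto)
      then show ?thesis by simp
    qed
  qed
qed simp

text \<open>The element \<open>x\<close> is smaller than all letters of \<open>w\<close>, hence
  never displaced by them, and stays between \<open>y\<close> and each letter; so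
  \<open>star_comm\<close> applies at every step.\<close>

lemma star_word_shift_right:
  "x \<in> S \<Longrightarrow> y \<le> x \<Longrightarrow> sorted_wrt (<) w \<Longrightarrow> \<forall>m\<in>set w. x < m \<Longrightarrow>
    star_word (star S y) w = star (star_word S w) y"
proof (induction w arbitrary: S)
  case (Cons d w)
  then have "star (star S y) d = star (star S d) y"
    by (intro star_comm[of x]) auto
  then show ?case using Cons by (simp add: star_keeps)
qed simp

text \<open>If the first letter \<open>d\<close> absorbs \<open>x\<close> instead of commuting with
  it, no element lies in between. Then the next letter would absorb an \<open>x\<close> as well, so
  one can be put back in front of it for free. The final \<open>y\<close> guarantees that there is a
  next letter.\<close>

lemma star_word_shift_left:
  "sorted_wrt (<) (v @ [y]) \<Longrightarrow> y < x \<Longrightarrow>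
    star_word (star S x) (v @ [y]) = star (star (star_word S v) x) y"
proof (induction v arbitrary: S)
  case (Cons d v)
  have dx: "d < x" using Cons.prems by auto
  show ?case
  proof (cases "\<exists>s\<in>S. d \<le> s \<and> s < x")
    case True
    then obtain s where "s \<in> S" "d \<le> s" "s < x" by blast
    then have "star (star S x) d = star (star S d) x" by (rule star_comm[symmetric])
    then show ?thesis using Cons by simp
  next
    case False
    have 1: "star (star S x) d = star S d"
      by (intro star_absorb) (use dx False in auto)
    obtain e u where eu: "v @ [y] = e # u" by (cases v) auto
    have "set (e # u) = insert y (set v)" unfolding eu[symmetric] by simp
    then have "e = y \<or> e \<in> set v" by auto
    then have e: "d < e" "e \<le> x"
      using Cons.prems by (auto simp: sorted_wrt_append)
    have "star (star (star S d) x) e = star (star S d) e"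
    proof (rule star_absorb)
      fix s assume "s \<in> star S d" "e \<le> s"
      moreover have "star S d \<subseteq> insert d S"
        by (cases rule: star_cases[where S=S and m=d]) auto
      ultimately have "s \<in> S" "d \<le> s" using \<open>d < e\<close> by auto
      then show "x \<le> s" using False by (meson not_le)
    qed (rule e)
    then have "star_word (star S d) (v @ [y]) = star_word (star (star S d) x) (v @ [y])"
      unfolding eu by simp
    also have "\<dots> = star (star (star_word (star S d) v) x) y"
      using Cons by simp
    finally show ?thesis using 1 by simp
  qed
qed simp

text \<open>One column of an insertion in terms of reading words: \<open>v @ y # w\<close> is a
  column read upwards, and the ejected \<open>y\<close> reappears behind the column in which
  \<open>x\<close> has taken its place. Here \<open>x\<close> is first moved up to \<open>y\<close>,
  and then \<open>y\<close> is moved out to the right.\<close>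

lemma star_word_bump:
  assumes "sorted_wrt (<) (v @ y # w)" "y < x" "\<forall>m\<in>set w. x < m"
  shows "star_word (star S x) (v @ y # w) = star (star_word S (v @ x # w)) y"
proof -
  have "star_word (star S x) (v @ y # w) = star_word (star_word (star S x) (v @ [y])) w"
    by simp
  also have "\<dots> = star_word (star (star (star_word S v) x) y) w"
    using assms by (subst star_word_shift_left) (auto simp: sorted_wrt_append)
  also have "\<dots> = star (star_word (star (star_word S v) x) w) y"
    using assms by (intro star_word_shift_right[of x]) (auto simp: sorted_wrt_append)
  finally show ?thesis by simp
qed

text \<open>Follows a single surplus element through one letter. If \<open>m\<close> displaces
  \<open>e\<close> itself, the surplus becomes the element that \<open>m\<close> displaces from
  \<open>M\<close>, or vanishes if there is none. The subset \<open>S\<close> is carried along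
  because only the elements of \<open>M\<close> outside it are known to exceed \<open>e\<close>; for
  the right key it becomes the next key column.\<close>

lemma star_insert:
  assumes "S \<subseteq> M" "e \<notin> M" "\<forall>g\<in>M - S. e < g"
  shows "star (insert e M) m = star M m \<or>
    (\<exists>e'\<ge>e. e' \<notin> star M m \<and> star (insert e M) m = insert e' (star M m) \<and>
       (\<forall>g\<in>star M m - star S m. e' < g))"
proof (cases rule: star_cases[where S="insert e M" and m=m])
  case none
  then have below: "\<forall>s\<in>M. s < m" "\<forall>s\<in>S. s < m" using assms(1) by auto
  note star_none[OF below(1)] star_none[OF below(2)]
  then show ?thesis using none assms by (intro disjI2 exI[of _ e]) auto
next
  case (some n)
  show ?thesis
  proof (cases "n = e")
    case True
    then have N: "star (insert e M) m = insert m M" using some assms by auto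
    show ?thesis
    proof (cases rule: star_cases[where S=M and m=m])
      case none
      then show ?thesis using N by simp
    next
      case (some m')
      have "m \<notin> M"
        using \<open>n = e\<close> \<open>e \<notin> M\<close> \<open>\<And>u. u \<in> insert e M \<Longrightarrow> m \<le> u \<Longrightarrow> n \<le> u\<close> \<open>m \<le> n\<close>
        by (metis insertI2 le_antisym order_refl)
      moreover have "e \<le> m'" using \<open>\<And>u. u \<in> insert e M \<Longrightarrow> m \<le> u \<Longrightarrow> n \<le> u\<close> some \<open>n = e\<close> by auto
      moreover have "\<forall>g\<in>star M m - star S m. m' < g"
      proof
        fix g assume g: "g \<in> star M m - star S m"
        then have g1: "g \<in> M" "g \<noteq> m'" "g \<noteq> m" using some by auto
        have "m \<le> g"
        proof (cases "g \<in> S")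
          case True
          show ?thesis
          proof (cases rule: star_cases[where S=S and m=m])
            case none
            then show ?thesis using g True by simp
          next
            case (some s)
            then show ?thesis using g True by simp
          qed
        next
          case False
          then have "e < g" using assms g1 by auto
          then show ?thesis using \<open>m \<le> n\<close> \<open>n = e\<close> by simp
        qed
        then show "m' < g" using some(3) g1 by force
      qed
      ultimately show ?thesis using N some by (intro disjI2 exI[of _ m']) auto
    qed
  next
    case False
    have "e \<noteq> m" using some False by (metis insertI1 le_antisym order_refl)
    have M: "star M m = insert m (M - {n})"
      by (rule star_least) (use some False in auto)
    have "\<forall>g\<in>star M m - star S m. e < g"
    proof
      fix g assume g: "g \<in> star M m - star S m"
      then have g1: "g \<in> M" "g \<noteq> n" "g \<noteq> m" using M by auto
      show "e < g"
      proof (cases "g \<in> S")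
        case True
        have "m \<le> g \<and> (\<forall>u\<in>S. m \<le> u \<longrightarrow> g \<le> u)"
        proof (cases rule: star_cases[where S=S and m=m])
          case none
          then show ?thesis using g True by simp
        next
          case (some s)
          then have "g = s" using g True by simp
          then show ?thesis using some by simp
        qed
        moreover have "n \<le> g" using some(3)[of g] calculation g1 by simp
        ultimately have "n < g" "n \<notin> S" using g1(2) some(2) by fastforce+
        moreover have "e < n" using calculation False some(1) assms by simp
        ultimately show ?thesis by simp
      next
        case False
        then show ?thesis using assms g1 by auto
      qed
    qed
    then show ?thesis using M some False \<open>e \<noteq> m\<close> assms by (intro disjI2 exI[of _ e]) auto
  qed
qed

lemma star_mono: "S \<subseteq> T \<Longrightarrow> star S m \<subseteq> star T m"
proof -
  assume "S \<subseteq> T"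
  show ?thesis
  proof (cases rule: star_cases[where S=T and m=m])
    case none
    then have "star S m = insert m S" using \<open>S \<subseteq> T\<close> by (intro star_none) auto
    then show ?thesis using none \<open>S \<subseteq> T\<close> by auto
  next
    case (some t)
    show ?thesis
    proof (cases "t \<in> S")
      case True
      then have "star S m = insert m (S - {t})"
        using some \<open>S \<subseteq> T\<close> by (intro star_least) auto
      then show ?thesis using some \<open>S \<subseteq> T\<close> by auto
    next
      case False
      moreover have "star S m \<subseteq> insert m S"
        by (cases rule: star_cases[where S=S and m=m]) auto
      ultimately show ?thesis using some(4) \<open>S \<subseteq> T\<close> by auto
    qed
  qed
qed

lemma star_word_mono: "S \<subseteq> T \<Longrightarrow> star_word S w \<subseteq> star_word T w"
  by (induction w arbitrary: S T) (auto dest: star_mono)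

lemma star_word_insert:
  assumes "S \<subseteq> M" "e \<notin> M" "\<forall>g\<in>M - S. e < g"
  shows "star_word (insert e M) w = star_word M w \<or>
    (\<exists>e'\<ge>e. e' \<notin> star_word M w \<and> star_word (insert e M) w = insert e' (star_word M w) \<and>
       (\<forall>g\<in>star_word M w - star_word S w. e' < g))"
  using assms
proof (induction w arbitrary: S M e)
  case Nil
  then show ?case by auto
next
  case (Cons m w)
  from star_insert[OF Cons.prems] consider "star (insert e M) m = star M m" |
    e' where "e' \<ge> e" "e' \<notin> star M m" "star (insert e M) m = insert e' (star M m)"
      "\<forall>g\<in>star M m - star S m. e' < g" by blast
  then show ?case
  proof cases
    case 2
    with Cons.IH[OF star_mono[OF Cons.prems(1)] 2(2,4)] show ?thesis
      by (auto intro: order_trans)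
  qed simp
qed

text \<open>This is the Hall condition for matching every \<open>d \<in> D\<close> with its own \<open>s \<in> S\<close>, \<open>d \<le> s\<close>.\<close>

definition dominates :: "nat set \<Rightarrow> nat set \<Rightarrow> bool" where
  "dominates S D \<longleftrightarrow> (\<forall>t. card {d \<in> D. t \<le> d} \<le> card {s \<in> S. t \<le> s})"

lemma dominates_mono:
  assumes "dominates S D" "D' \<subseteq> D" "S \<subseteq> S'" "finite D" "finite S'"
  shows "dominates S' D'"
  unfolding dominates_def
proof
  fix t
  have "card {d \<in> D'. t \<le> d} \<le> card {d \<in> D. t \<le> d}"
    by (rule card_mono) (use assms in auto)
  also have "\<dots> \<le> card {s \<in> S. t \<le> s}" using assms by (simp add: dominates_def)
  also have "\<dots> \<le> card {s \<in> S'. t \<le> s}"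
    by (rule card_mono) (use assms in auto)
  finally show "card {d \<in> D'. t \<le> d} \<le> card {s \<in> S'. t \<le> s}" .
qed

lemma dominates_nth:
  assumes "distinct B" "distinct C" "\<And>r. r < length C \<Longrightarrow> r < length B \<and> C ! r \<le> B ! r"
  shows "dominates (set B) (set C)"
  unfolding dominates_def
proof
  fix t
  have count: "card {d \<in> set X. t \<le> d} = card {r. r < length X \<and> t \<le> X ! r}"
    if "distinct X" for X :: "nat list"
  proof -
    have "{d \<in> set X. t \<le> d} = (!) X ` {r. r < length X \<and> t \<le> X ! r}"
      by (auto simp: in_set_conv_nth)
    moreover have "inj_on ((!) X) {r. r < length X \<and> t \<le> X ! r}"
      using that by (auto simp: inj_on_def nth_eq_iff_index_eq)
    ultimately show ?thesis by (simp add: card_image)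
  qed
  show "card {d \<in> set C. t \<le> d} \<le> card {s \<in> set B. t \<le> s}"
    unfolding count[OF assms(1)] count[OF assms(2)]
    by (rule card_mono) (use assms(3) in \<open>auto intro: order_trans\<close>)
qed

lemma dominates_not_all_below:
  assumes "dominates S D" "d \<in> D" "finite D"
  obtains s where "s \<in> S" "d \<le> s"
proof -
  have "0 < card {u \<in> D. d \<le> u}" using assms by (auto simp: card_gt_0_iff)
  then have "0 < card {s \<in> S. d \<le> s}"
    using assms(1) unfolding dominates_def by (metis le_zero_eq not_gr_zero)
  then have "{s \<in> S. d \<le> s} \<noteq> {}" by (metis card.empty less_irrefl)
  then show ?thesis using that by auto
qed

text \<open>For \<open>t \<le> s\<close> the removal costs one on the right, which is made up at the
  threshold \<open>d\<close>: there all of \<open>insert d D\<close> is counted, and every element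
  of \<open>S\<close> that counts is at least \<open>s\<close>. For \<open>t > s\<close> neither
  \<open>s\<close> nor \<open>d\<close> is counted.\<close>

lemma dominates_greedy:
  assumes "dominates S (insert d D)" "finite S" "finite D" "\<forall>u\<in>D. d < u"
    "s \<in> S" "d \<le> s" "\<And>u. u \<in> S \<Longrightarrow> d \<le> u \<Longrightarrow> s \<le> u"
  shows "dominates (S - {s}) D"
  unfolding dominates_def
proof
  fix t
  have le: "card {u \<in> insert d D. t' \<le> u} \<le> card {u \<in> S. t' \<le> u}" for t'
    using assms(1) unfolding dominates_def by simp
  show "card {u \<in> D. t \<le> u} \<le> card {u \<in> S - {s}. t \<le> u}"
  proof (cases "t \<le> s")
    case True
    have "{u \<in> S - {s}. t \<le> u} = {u \<in> S. t \<le> u} - {s}" by auto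
    then have 1: "card {u \<in> S - {s}. t \<le> u} = card {u \<in> S. t \<le> u} - 1"
      using True assms by simp
    have "{u \<in> insert d D. d \<le> u} = insert d D" using assms by auto
    moreover have "d \<notin> D" using assms by auto
    ultimately have "Suc (card D) \<le> card {u \<in> S. d \<le> u}" using le[of d] assms by simp
    also have "\<dots> \<le> card {u \<in> S. t \<le> u}"
      by (rule card_mono) (use assms True in fastforce)+
    finally have "card D \<le> card {u \<in> S - {s}. t \<le> u}" using 1 by simp
    moreover have "card {u \<in> D. t \<le> u} \<le> card D"
      by (rule card_mono) (use assms in auto)
    ultimately show ?thesis by simp
  next
    case False
    then have "{u \<in> S - {s}. t \<le> u} = {u \<in> S. t \<le> u}"
      "{u \<in> insert d D. t \<le> u} = {u \<in> D. t \<le> u}" using assms by auto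
    then show ?thesis using le[of t] by simp
  qed
qed

text \<open>Every letter finds an element to displace, since taking away greedy matches preserves
  the Hall condition; so no letter is merely added.\<close>

lemma card_star_word_dominated:
  "finite S \<Longrightarrow> sorted_wrt (<) w \<Longrightarrow> dominates S (set w) \<Longrightarrow> card (star_word S w) = card S"
proof (induction w arbitrary: S)
  case (Cons d w)
  obtain t where "t \<in> S" "d \<le> t"
    using dominates_not_all_below[OF Cons.prems(3), of d] by auto
  then show ?case
  proof (cases rule: star_cases[where S=S and m=d])
    case (some s)
    have "dominates (S - {s}) (set w)"
      by (rule dominates_greedy[of _ d]) (use Cons.prems some in auto)
    then have "dominates (star S d) (set w)"
      by (rule dominates_mono) (use some Cons.prems in auto)
    then have "card (star_word (star S d) w) = card (star S d)"
      using Cons by simp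
    moreover have "card (star S d) = card S"
    proof (cases "d = s")
      case False
      then have "d \<notin> S" using some by (metis le_antisym order_refl)
      moreover have "card S > 0" using Cons.prems some(1) card_gt_0_iff by blast
      ultimately show ?thesis using some Cons.prems by (simp add: card_Diff_singleton)
    qed (use some in \<open>simp add: insert_absorb\<close>)
    ultimately show ?thesis by simp
  qed force
qed simp

section \<open>Columns and a local form of column insertion\<close>

text \<open>Since entries are positive, reading \<open>0\<close> outside a column lets one inequality between entries
  cover the shape conditions as well.\<close>

definition ent :: "nat list \<Rightarrow> nat \<Rightarrow> nat" where
  "ent C r = (if r < length C then C ! r else 0)"

definition dcol :: "nat list \<Rightarrow> bool" where
  "dcol C \<longleftrightarrow> (\<forall>r < length C. ent C (Suc r) < ent C r)"

definition adj :: "nat list \<Rightarrow> nat list \<Rightarrow> bool" where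
  "adj B C \<longleftrightarrow> (\<forall>r < length C. ent C r < ent B r)"

fun dtab :: "nat list list \<Rightarrow> bool" where
  "dtab [] = True"
| "dtab (C # T) = (C \<noteq> [] \<and> dcol C \<and> adj C (column T 0) \<and> dtab T)"

lemma column_simps [simp]:
  "column [] k = []" "column (C # T) 0 = C" "column (C # T) (Suc k) = column T k"
  by (simp_all add: column_def)

lemma dtab_column [simp]: "dtab T \<Longrightarrow> dcol (column T k)"
proof (induction T arbitrary: k)
  case (Cons C T)
  then show ?case by (cases k) auto
qed (simp add: dcol_def)

lemma column_0_empty: "dtab T \<Longrightarrow> column T 0 = [] \<longleftrightarrow> T = []"
  by (cases T) auto

lemma ent_0_iff: "dcol C \<Longrightarrow> ent C r = 0 \<longleftrightarrow> length C \<le> r"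
  by (metis ent_def dcol_def not_less gr_implies_not0)

lemma ent_pos_iff: "dcol C \<Longrightarrow> 0 < ent C r \<longleftrightarrow> r < length C"
  using ent_0_iff[of C r] by linarith

lemma ent_strict: "dcol C \<Longrightarrow> r < s \<Longrightarrow> 0 < ent C r \<Longrightarrow> ent C s < ent C r"
proof (induction s)
  case (Suc s)
  have 1: "ent C (Suc s) \<le> ent C s"
  proof (cases "s < length C")
    case True
    then show ?thesis using Suc.prems(1) by (simp add: dcol_def less_imp_le)
  qed (simp add: ent_def)
  show ?case
  proof (cases "r = s")
    case True
    then show ?thesis using Suc.prems by (simp add: dcol_def ent_pos_iff)
  qed (use Suc 1 in simp)
qed simp

lemma ent_anti: "dcol C \<Longrightarrow> r \<le> s \<Longrightarrow> ent C s \<le> ent C r"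
  using ent_strict[of C r s] ent_0_iff[of C r] ent_0_iff[of C s]
  by (cases "r = s"; cases "ent C r = 0") auto

lemma adj_less: "dcol C \<Longrightarrow> adj B C \<Longrightarrow> 0 < ent C r \<Longrightarrow> ent C r < ent B r"
  by (simp add: adj_def ent_pos_iff)

lemma adj_le: "adj B C \<Longrightarrow> ent C r \<le> ent B r"
  by (cases "r < length C") (auto simp: adj_def ent_def)

lemma adj_length: "adj B C \<Longrightarrow> length C \<le> length B"
  unfolding adj_def by (metis ent_def leI less_irrefl not_less_zero)

lemma adj_Nil [simp]: "adj B []"
  by (simp add: adj_def)

lemma ent_mem: "0 < ent C r \<Longrightarrow> ent C r \<in> set C"
  by (auto simp: ent_def split: if_splits)

lemma mem_pos: "dcol C \<Longrightarrow> z \<in> set C \<Longrightarrow> 0 < z"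
  by (metis ent_def ent_pos_iff in_set_conv_nth)

lemma dcol_sorted: "dcol C \<Longrightarrow> sorted_wrt (>) C"
  unfolding sorted_wrt_iff_nth_less
  by (metis ent_def ent_pos_iff ent_strict order.strict_trans)

lemma dcol_iff: "dcol C \<longleftrightarrow> sorted_wrt (>) C \<and> 0 \<notin> set C"
proof
  assume "sorted_wrt (>) C \<and> 0 \<notin> set C"
  then show "dcol C"
    by (auto simp: dcol_def ent_def sorted_wrt_iff_nth_less in_set_conv_nth)
qed (use dcol_sorted mem_pos in fastforce)

text \<open>In a decreasing column this is the number of entries larger than \<open>x\<close>. If
  \<open>x\<close> is an entry it is its own row, whereas Hecke insertion would go on with the row
  below.\<close>

definition pos :: "nat list \<Rightarrow> nat \<Rightarrow> nat" where
  "pos C x = (LEAST i. ent C i \<le> x)"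

lemma ent_pos: "ent C (pos C x) \<le> x"
  unfolding pos_def by (rule LeastI[of _ "length C"]) (simp add: ent_def)

lemma pos_le_length: "pos C x \<le> length C"
  unfolding pos_def by (rule Least_le) (simp add: ent_def)

lemma less_pos: "r < pos C x \<Longrightarrow> x < ent C r"
  unfolding pos_def using not_less_Least by (metis not_less)

lemma pos_le: "ent C i \<le> x \<Longrightarrow> pos C x \<le> i"
  unfolding pos_def by (rule Least_le)

lemma pos_leD: "dcol C \<Longrightarrow> pos C x \<le> r \<Longrightarrow> ent C r \<le> x"
  using ent_anti ent_pos order_trans by meson

lemma pos_eqI: "ent C i \<le> x \<Longrightarrow> (\<And>r. r < i \<Longrightarrow> x < ent C r) \<Longrightarrow> pos C x = i"
  by (metis less_pos ent_pos pos_le not_less nat_less_le)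

lemma pos_ent: "dcol C \<Longrightarrow> i < length C \<Longrightarrow> pos C (ent C i) = i"
  by (rule pos_eqI) (metis ent_strict ent_pos_iff order.strict_trans order_refl)+

section \<open>Settling a letter in a column\<close>

definition put :: "nat list \<Rightarrow> nat \<Rightarrow> nat \<Rightarrow> nat list" where
  "put C i x = (if i < length C then C[i := x] else C @ [x])"

lemma ent_put: "i \<le> length C \<Longrightarrow> ent (put C i x) r = (if r = i then x else ent C r)"
  by (auto simp: put_def ent_def nth_append nth_list_update)

lemma length_put: "i \<le> length C \<Longrightarrow> length (put C i x) = max (length C) (Suc i)"
  by (auto simp: put_def)

lemma list_eq_entI: "dcol B \<Longrightarrow> dcol C \<Longrightarrow> (\<And>r. ent B r = ent C r) \<Longrightarrow> B = C"
  by (metis ent_0_iff ent_def le_refl linorder_neqE_nat not_less nth_equalityI)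

definition settle :: "nat list \<Rightarrow> nat \<Rightarrow> nat list" where
  "settle C x = put C (pos C x) x"

lemma ent_settle: "ent (settle C x) r = (if r = pos C x then x else ent C r)"
  by (simp add: settle_def ent_put pos_le_length)

lemma length_settle: "length (settle C x) = max (length C) (Suc (pos C x))"
  by (simp add: settle_def length_put pos_le_length)

lemma settle_Nil [simp]: "settle [] x = [x]"
  using pos_le_length[of "[]" x] by (simp add: settle_def put_def)

lemma dcol_settle:
  assumes "dcol C" "0 < x"
  shows "dcol (settle C x)"
  unfolding dcol_def
proof (intro allI impI)
  fix r assume "r < length (settle C x)"
  then have r: "r < length C \<or> r = pos C x"
    using pos_le_length[of C x] by (auto simp: length_settle)
  consider "r = pos C x" | "Suc r = pos C x" | "r \<noteq> pos C x" "Suc r \<noteq> pos C x" by blast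
  then show "ent (settle C x) (Suc r) < ent (settle C x) r"
  proof cases
    case 1
    then show ?thesis
    proof (cases "r < length C")
      case True
      then have "ent C (Suc r) < ent C r" using assms by (simp add: dcol_def)
      then show ?thesis using ent_pos[of C x] 1 by (simp add: ent_settle)
    next
      case False
      then have "ent C (Suc r) = 0" by (simp add: ent_def)
      then show ?thesis using 1 assms by (simp add: ent_settle)
    qed
  next
    case 2
    then show ?thesis using less_pos[of r C x] by (simp add: ent_settle)
  next
    case 3
    then show ?thesis using r assms by (simp add: ent_settle dcol_def)
  qed
qed

lemma settle_ge: "ent C r \<le> ent (settle C x) r"
  using ent_pos[of C x] by (simp add: ent_settle)

lemma settle_nonempty [simp]: "settle C x \<noteq> []"
  by (auto simp: settle_def put_def)

lemma adj_settle_left: "adj C D \<Longrightarrow> adj (settle C x) D"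
  using settle_ge by (fastforce simp: adj_def intro: less_le_trans)

lemma settle_member: "dcol C \<Longrightarrow> 0 < x \<Longrightarrow> ent C (pos C x) = x \<Longrightarrow> settle C x = C"
  by (rule list_eq_entI) (auto simp: dcol_settle ent_settle)

text \<open>When \<open>x\<close> is already an entry of \<open>C\<close>, Hecke insertion would pass on the entry below it. Taking
  the maximum with the right neighbour of \<open>x\<close> makes the insertion reversible one column at a time,
  with no reference to the column on the left. The value \<open>0\<close> means that nothing is passed on.\<close>

definition bump :: "nat list \<Rightarrow> nat list \<Rightarrow> nat \<Rightarrow> nat" where
  "bump C D x = (if ent C (pos C x) = x then max (ent C (Suc (pos C x))) (ent D (pos C x))
     else ent C (pos C x))"

lemma bump_less:
  assumes "dcol C" "dcol D" "adj C D" "0 < x"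
  shows "bump C D x < x"
proof (cases "ent C (pos C x) = x")
  case True
  then have "ent C (Suc (pos C x)) < x" "ent D (pos C x) < x"
    using assms ent_strict[of C "pos C x" "Suc (pos C x)"] adj_less[of D C "pos C x"]
    by (cases "ent D (pos C x) = 0"; simp)+
  then show ?thesis using True by (simp add: bump_def)
next
  case False
  then show ?thesis using ent_pos[of C x] by (simp add: bump_def)
qed

text \<open>These are the entries below and to the right of \<open>x\<close> once it has settled.
  The bounds make the path of the insertion move weakly upwards, show that it ends in a corner when
  nothing is passed on, and locate the row of \<open>x\<close> in the reverse step.\<close>

lemma settled_le_bump:
  assumes "dcol C" "dcol D" "adj C D" "0 < x"
  shows "ent C (Suc (pos C x)) \<le> bump C D x" "ent D (pos C x) \<le> bump C D x"
  using assms adj_le[of C D "pos C x"] ent_anti[of C "pos C x" "Suc (pos C x)"]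
  by (auto simp: bump_def)

text \<open>Settling never lowers an entry, so the right neighbour cannot object and only the column
  \<open>B\<close> on the left can. An \<open>x\<close> that is already present changes
  nothing.\<close>

definition adm :: "nat list \<Rightarrow> nat list \<Rightarrow> nat \<Rightarrow> bool" where
  "adm B C x \<longleftrightarrow> ent C (pos C x) = x \<or> x < ent B (pos C x)"

lemma adj_settle:
  assumes "adj B C" "adm B C x" "dcol C" "0 < x"
  shows "adj B (settle C x)"
proof (cases "ent C (pos C x) = x")
  case True
  then show ?thesis using assms by (simp add: settle_member)
next
  case False
  then have "x < ent B (pos C x)" using assms by (simp add: adm_def)
  then show ?thesis using assms(1) pos_le_length[of C x]
    by (auto simp: adj_def ent_settle length_settle)
qed

lemma pos_bump_le:
  assumes "dcol C" "dcol D" "adj C D" "0 < x"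
  shows "pos D (bump C D x) \<le> pos C x"
  by (rule pos_le) (use settled_le_bump[OF assms] in simp)

text \<open>Since the path moves weakly up, the left neighbour of the passed value is either
  \<open>x\<close> itself or a higher entry of \<open>C\<close>, which exceeds \<open>x\<close>; the
  passed value is smaller than \<open>x\<close>.\<close>

lemma adm_bump:
  assumes "dcol C" "dcol D" "adj C D" "0 < x" "0 < bump C D x"
  shows "adm (settle C x) D (bump C D x)"
proof (cases "ent D (pos D (bump C D x)) = bump C D x")
  case False
  let ?y = "bump C D x" and ?i = "pos C x" and ?j = "pos D (bump C D x)"
  have "?j \<le> ?i" by (rule pos_bump_le) fact+
  have "?y < ent (settle C x) ?j"
  proof (cases "?j = ?i")
    case True
    then show ?thesis using bump_less[OF assms(1-4)] by (simp add: ent_settle)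
  next
    case False
    then have "?j < ?i" using \<open>?j \<le> ?i\<close> by simp
    then have "x < ent C ?j" by (rule less_pos)
    then show ?thesis using bump_less[OF assms(1-4)] False by (simp add: ent_settle)
  qed
  then show ?thesis by (simp add: adm_def)
qed (simp add: adm_def)

text \<open>When nothing is passed on, \<open>x\<close> has either lengthened the column or was in
  it before, and this decides \<open>\<alpha>\<close>.\<close>

fun ins :: "nat \<Rightarrow> nat list list \<Rightarrow> nat list list \<times> (nat \<times> nat) \<times> nat" where
  "ins x [] = ([[x]], (0, 0), 1)"
| "ins x (C # T) =
    (let y = bump C (column T 0) x in
     if y = 0 then (settle C x # T, (pos C x, 0), if ent C (pos C x) = x then 0 else 1)
     else (case ins y T of (T', (r, c), \<alpha>) \<Rightarrow> (settle C x # T', (r, Suc c), \<alpha>)))"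

lemma ins_Cons_cases:
  assumes "ins x (C # T) = (T', (r, c), \<alpha>)"
  obtains (stop) "bump C (column T 0) x = 0" "T' = settle C x # T" "r = pos C x" "c = 0"
      "\<alpha> = (if ent C (pos C x) = x then 0 else 1)"
  | (bump) T'' c' where "0 < bump C (column T 0) x"
      "ins (bump C (column T 0) x) T = (T'', (r, c'), \<alpha>)" "T' = settle C x # T''" "c = Suc c'"
  using assms by (auto simp: Let_def split: if_splits prod.splits)

lemma ins_column_0: "ins x T = (T', rc, \<alpha>) \<Longrightarrow> column T' 0 = settle (column T 0) x"
  by (cases T) (auto simp: Let_def split: if_splits prod.splits)

lemma dtab_ins:
  "dtab T \<Longrightarrow> 0 < x \<Longrightarrow> ins x T = (T', (r, c), \<alpha>) \<Longrightarrow> dtab T'"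
proof (induction T arbitrary: x T' r c \<alpha>)
  case Nil
  then show ?case by (auto simp: dcol_def ent_def)
next
  case (Cons C T)
  let ?y = "bump C (column T 0) x"
  have C: "C \<noteq> []" "dcol C" "adj C (column T 0)" "dtab T" using Cons.prems by auto
  from Cons.prems(3) show ?case
  proof (cases rule: ins_Cons_cases)
    case stop
    then show ?thesis using C Cons.prems by (simp add: dcol_settle adj_settle_left)
  next
    case (bump T'' c')
    have "adj (settle C x) (settle (column T 0) ?y)"
      using C bump Cons.prems by (simp add: adj_settle adj_settle_left adm_bump)
    then show ?thesis using bump C Cons.prems Cons.IH[OF C(4) bump(1,2)]
      by (simp add: dcol_settle ins_column_0[OF bump(2)])
  qed
qed

text \<open>If nothing is passed on, the places below and to the right of \<open>x\<close> are
  empty, so the last box is a corner. If a positive value is passed on, the row of \<open>x\<close>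
  was occupied already, so no earlier column grows.\<close>

lemma ins_corner:
  "dtab T \<Longrightarrow> 0 < x \<Longrightarrow> ins x T = (T', (r, c), \<alpha>) \<Longrightarrow>
    c < length T' \<and> Suc r = length (T' ! c) \<and> length (column T' (Suc c)) \<le> r \<and>
    (\<alpha> = 0 \<and> shape T' = shape T \<or>
     \<alpha> = 1 \<and> r = length (column T c) \<and> (c < length T \<and> shape T' = (shape T)[c := Suc r] \<or>
       c = length T \<and> r = 0 \<and> shape T' = shape T @ [1]))"
proof (induction T arbitrary: x T' r c \<alpha>)
  case (Cons C T)
  let ?y = "bump C (column T 0) x"
  have C: "C \<noteq> []" "dcol C" "adj C (column T 0)" "dtab T" using Cons.prems by auto
  from Cons.prems(3) show ?case
  proof (cases rule: ins_Cons_cases)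
    case stop
    have D: "length (column T 0) \<le> pos C x"
      using settled_le_bump(2)[of C "column T 0" x] C Cons.prems stop by (simp add: ent_0_iff)
    show ?thesis
    proof (cases "ent C (pos C x) = x")
      case True
      then have "pos C x < length C" using Cons.prems C by (metis ent_pos_iff)
      moreover have "length C \<le> Suc (pos C x)"
        using settled_le_bump(1)[of C "column T 0" x] C Cons.prems stop by (simp add: ent_0_iff)
      ultimately have "length C = Suc (pos C x)" by simp
      then show ?thesis using stop True D C Cons.prems
        by (simp add: settle_member shape_def)
    next
      case False
      then have "pos C x = length C"
        using stop C pos_le_length[of C x] by (simp add: bump_def ent_0_iff)
      then show ?thesis using stop False D
        by (simp add: settle_def put_def shape_def)
    qed
  next
    case (bump T'' c')
    have "0 < ent C (pos C x)"
    proof (rule ccontr)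
      assume "\<not> ?thesis"
      then show False using bump Cons.prems(2) by (simp add: bump_def split: if_splits)
    qed
    then have "length (settle C x) = length C"
      using C by (simp add: ent_pos_iff length_settle)
    with Cons.IH[OF C(4) bump(1,2)] bump show ?thesis
      by (auto simp: shape_def)
  qed
qed (auto simp: shape_def)

section \<open>Reverse insertion and consecutive insertions\<close>

text \<open>Here \<open>D\<close> is the right neighbour as it was before the insertion, so that \<open>C\<close> and \<open>D\<close> belong to
  different stages; the columns are restored from right to left.\<close>

definition unsettle :: "nat list \<Rightarrow> nat list \<Rightarrow> nat \<Rightarrow> nat list" where
  "unsettle C D y = (let i = pos C y - 1 in
     if ent C (Suc i) = y \<or> y \<le> ent D i then C else put C i y)"

definition unbump :: "nat list \<Rightarrow> nat \<Rightarrow> nat" where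
  "unbump C y = ent C (pos C y - 1)"

lemma unsettle_settle:
  assumes "dcol C" "dcol D" "adj C D" "0 < x" "0 < bump C D x"
  shows "unsettle (settle C x) D (bump C D x) = C" "unbump (settle C x) (bump C D x) = x"
proof -
  let ?y = "bump C D x" and ?i = "pos C x" and ?C = "settle C x"
  have yx: "?y < x" by (rule bump_less) fact+
  have pos: "pos ?C ?y = Suc ?i"
  proof (rule pos_eqI)
    show "ent ?C (Suc ?i) \<le> ?y"
      using settled_le_bump(1)[OF assms(1-4)] by (simp add: ent_settle)
    fix r assume "r < Suc ?i"
    then show "?y < ent ?C r"
      using yx less_pos[of r C x] by (auto simp: ent_settle less_Suc_eq)
  qed
  then show "unbump ?C ?y = x" by (simp add: unbump_def ent_settle)
  show "unsettle ?C D ?y = C"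
  proof (cases "ent C ?i = x")
    case True
    then have "ent C (Suc ?i) = ?y \<or> ?y \<le> ent D ?i" by (auto simp: bump_def)
    then show ?thesis using True pos assms
      by (simp add: unsettle_def settle_member)
  next
    case False
    then have y: "?y = ent C ?i" by (simp add: bump_def)
    then have "?i < length C" using assms by (simp add: ent_pos_iff)
    moreover have "ent C (Suc ?i) < ?y" "ent D ?i < ?y"
      using y assms ent_strict[of C ?i "Suc ?i"] adj_less[of D C ?i]
      by (cases "ent D ?i = 0"; simp)+
    moreover have "put ?C ?i ?y = C"
      using y \<open>?i < length C\<close> by (simp add: settle_def put_def ent_def list_update_same_conv)
    ultimately show ?thesis using pos by (simp add: unsettle_def ent_settle)
  qed
qed

text \<open>The test in \<open>unsettle\<close> decides whether \<open>y\<close> was the maximum in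
  \<open>bump\<close> for an \<open>x\<close> already present, or an entry that \<open>x\<close> has
  replaced. The last assumption keeps the right neighbour from exceeding \<open>y\<close>, so the
  maximum is exactly \<open>y\<close>.\<close>

lemma settle_unsettle:
  assumes "dcol C" "dcol D" "adj C D" "0 < y" "0 < pos C y" "ent D (pos C y - 1) \<le> y"
  defines "B \<equiv> unsettle C D y" and "x \<equiv> unbump C y"
  shows "dcol B" "adj B D" "B \<noteq> []" "settle B x = C" "bump B D x = y" "y < x" "ent B r \<le> ent C r"
proof -
  define i where "i = pos C y - 1"
  have posC: "pos C y = Suc i" using assms(5) by (simp add: i_def)
  have x: "x = ent C i" by (simp add: x_def unbump_def i_def)
  have yx: "y < x" using less_pos[of i C y] posC x by simp
  have i: "i < length C" using yx assms(1) x ent_pos_iff[of C i] by simp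
  have next_le: "ent C (Suc i) \<le> y" using ent_pos[of C y] posC by simp
  have Di: "ent D i \<le> y" using assms(6) by (simp add: i_def)
  have all: "dcol B \<and> adj B D \<and> B \<noteq> [] \<and> settle B x = C \<and> bump B D x = y \<and> (\<forall>r. ent B r \<le> ent C r)"
  proof (cases "ent C (Suc i) = y \<or> y \<le> ent D i")
    case True
    then have B: "B = C" by (simp add: B_def unsettle_def posC)
    have "pos C x = i" using pos_ent[OF assms(1) i] x by simp
    moreover from this have "settle C x = C"
      using assms(1) yx x by (intro settle_member) auto
    moreover have "max (ent C (Suc i)) (ent D i) = y"
      using True next_le Di by auto
    ultimately show ?thesis using B assms(1,3) x i by (auto simp: bump_def)
  next
    case False
    then have B: "B = put C i y" by (simp add: B_def unsettle_def posC)
    have entB: "ent B r = (if r = i then y else ent C r)" for r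
      using i by (simp add: B ent_put)
    have lenB: "length B = length C" using i by (simp add: B length_put)
    have dB: "dcol B" unfolding dcol_def
    proof (intro allI impI)
      fix r assume "r < length B"
      then have "ent C (Suc r) < ent C r" using assms(1) lenB by (simp add: dcol_def)
      then show "ent B (Suc r) < ent B r"
        using False next_le yx x by (auto simp: entB)
    qed
    have posB: "pos B x = i"
    proof (rule pos_eqI)
      fix r assume "r < i"
      then show "x < ent B r" using x entB ent_strict[of C r i] assms(1) i
        by (simp add: ent_pos_iff)
    qed (use entB yx in simp)
    have "settle B x = C"
    proof (rule list_eq_entI)
      show "dcol (settle B x)" using dB yx by (simp add: dcol_settle)
      show "ent (settle B x) r = ent C r" for r
        by (cases "r = i") (simp_all add: ent_settle posB entB x[symmetric])
    qed (fact assms(1))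
    moreover have "adj B D"
      using assms(3) False by (auto simp: adj_def entB)
    moreover have "bump B D x = y" using yx by (simp add: bump_def posB entB)
    moreover have "B \<noteq> []" using lenB i by auto
    ultimately show ?thesis using dB yx x by (auto simp: entB)
  qed
  then show "dcol B" "adj B D" "B \<noteq> []" "settle B x = C" "bump B D x = y" "ent B r \<le> ent C r" by auto
  show "y < x" by fact
qed

text \<open>The letter that settled last is the bottom entry of column \<open>c\<close> in either
  case; \<open>\<alpha>\<close> only tells whether its box existed before.\<close>

fun unins :: "nat list list \<Rightarrow> nat \<Rightarrow> nat \<Rightarrow> nat list list \<times> nat" where
  "unins [] c \<alpha> = ([], 0)"
| "unins (C # T) 0 \<alpha> =
    (if \<alpha> = 0 then C # T else if butlast C = [] then T else butlast C # T, last C)"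
| "unins (C # T) (Suc c) \<alpha> =
    (case unins T c \<alpha> of (T', y) \<Rightarrow> (unsettle C (column T' 0) y # T', unbump C y))"

lemma unins_ins:
  "dtab T \<Longrightarrow> 0 < x \<Longrightarrow> ins x T = (T', (r, c), \<alpha>) \<Longrightarrow> unins T' c \<alpha> = (T, x)"
proof (induction T arbitrary: x T' r c \<alpha>)
  case (Cons C T)
  let ?y = "bump C (column T 0) x"
  have C: "C \<noteq> []" "dcol C" "adj C (column T 0)" "dtab T" using Cons.prems by auto
  from Cons.prems(3) show ?case
  proof (cases rule: ins_Cons_cases)
    case stop
    have *: "Suc (pos C x) = length (settle C x)"
      using ins_corner[OF Cons.prems] stop by simp
    then have "ent (settle C x) (pos C x) = last (settle C x)"
      by (simp add: ent_def last_conv_nth flip: *)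
    then have last: "last (settle C x) = x" by (simp add: ent_settle)
    show ?thesis
    proof (cases "ent C (pos C x) = x")
      case True
      then have "settle C x = C" using C Cons.prems by (simp add: settle_member)
      then show ?thesis using stop last True by simp
    next
      case False
      then have "pos C x = length C"
        using stop C pos_le_length[of C x] by (simp add: bump_def ent_0_iff)
      then show ?thesis using stop last False C by (simp add: settle_def put_def)
    qed
  next
    case (bump T'' c')
    have "unins T'' c' \<alpha> = (T, ?y)" using Cons.IH[OF C(4) bump(1,2)] .
    then show ?thesis using bump C Cons.prems by (simp add: unsettle_settle)
  qed
qed auto

lemma dcol_butlast: "dcol C \<Longrightarrow> dcol (butlast C)"
  by (auto simp: dcol_iff sorted_wrt_iff_nth_less nth_butlast dest: in_set_butlastD)

text \<open>The last two conclusions strengthen the induction. As \<open>y\<close> is an entry of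
  the column to the right, it lies below its left neighbour, so \<open>C\<close> has an entry larger
  than \<open>y\<close> to eject. As restoring a column never raises an entry, the restored right
  column still fits next to \<open>C\<close> and meets the bound required by
  \<open>settle_unsettle\<close>.\<close>

lemma ins_unins:
  "dtab T' \<Longrightarrow> c < length T' \<Longrightarrow> length (column T' (Suc c)) < length (T' ! c) \<Longrightarrow> \<alpha> = 0 \<or> \<alpha> = 1 \<Longrightarrow>
   \<exists>T x q. unins T' c \<alpha> = (T, x) \<and> dtab T \<and> 0 < x \<and> ins x T = (T', (length (T' ! c) - 1, c), \<alpha>) \<and>
     x = ent (column T' 0) q \<and> (\<forall>r. ent (column T 0) r \<le> ent (column T' 0) r)"
proof (induction T' arbitrary: c)
  case (Cons C T')
  have C: "C \<noteq> []" "dcol C" "adj C (column T' 0)" "dtab T'" using Cons.prems by auto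
  show ?case
  proof (cases c)
    case 0
    define i where "i = length C - 1"
    have i: "Suc i = length C" using C(1) by (simp add: i_def)
    have last: "last C = ent C i" using i C(1) by (simp add: ent_def last_conv_nth i_def)
    have x: "0 < last C" using C last i by (simp add: ent_pos_iff)
    have D: "ent (column T' 0) i = 0" "dcol (column T' 0)"
      using Cons.prems i C 0 by (simp_all add: ent_0_iff)
    show ?thesis
    proof (cases "\<alpha> = 0")
      case True
      have "pos C (last C) = i" using pos_ent[OF C(2), of i] i last by simp
      moreover have "settle C (last C) = C"
        using calculation C x last by (simp add: settle_member)
      moreover have "ent C (Suc i) = 0" using i by (simp add: ent_def)
      ultimately have "ins (last C) (C # T') = (C # T', (i, 0), \<alpha>)"
        using last D True by (simp add: bump_def)
      then show ?thesis using True 0 x last C i_def by auto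
    next
      case False
      let ?B = "butlast C"
      have ent: "ent ?B r = (if r = i then 0 else ent C r)" for r
        using i by (auto simp: ent_def nth_butlast)
      have pos: "pos ?B (last C) = i"
      proof (rule pos_eqI)
        fix r assume "r < i"
        then show "last C < ent ?B r" using last ent ent_strict[of C r i] C i
          by (simp add: ent_pos_iff)
      qed (simp add: ent)
      have settle: "settle ?B (last C) = C"
        using pos i C(1) by (simp add: settle_def put_def i_def)
      show ?thesis
      proof (cases "?B = []")
        case True
        then have "i = 0" using i by (metis diff_Suc_1 length_butlast list.size(3))
        then have "T' = []" using D C by (metis column_0_empty ent_0_iff le_zero_eq length_0_conv)
        moreover obtain z where "C = [z]" using True settle by (metis settle_Nil)
        ultimately show ?thesis using False 0 x Cons.prems(4)
          by (intro exI[of _ "[]"] exI[of _ z] exI[of _ 0]) (auto simp: ent_def)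
      next
        case B: False
        have "dtab (?B # T')"
          using C B D dcol_butlast by (auto simp: adj_def ent ent_0_iff)
        moreover have "ins (last C) (?B # T') = (C # T', (i, 0), \<alpha>)"
          using False Cons.prems(4) x pos settle by (simp add: bump_def ent)
        ultimately show ?thesis using False B 0 x last i_def
          by (intro exI[of _ "?B # T'"] exI[of _ "last C"] exI[of _ i]) (auto simp: ent)
      qed
    qed
  next
    case (Suc c')
    have "\<exists>T x q. unins T' c' \<alpha> = (T, x) \<and> dtab T \<and> 0 < x \<and>
      ins x T = (T', (length (T' ! c') - 1, c'), \<alpha>) \<and>
      x = ent (column T' 0) q \<and> (\<forall>r. ent (column T 0) r \<le> ent (column T' 0) r)"
      by (rule Cons.IH) (use Cons.prems Suc in auto)
    then obtain T y q where IH: "unins T' c' \<alpha> = (T, y)" "dtab T" "0 < y"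
      "ins y T = (T', (length (T' ! c') - 1, c'), \<alpha>)"
      "y = ent (column T' 0) q" "\<And>r. ent (column T 0) r \<le> ent (column T' 0) r" by blast
    let ?D = "column T 0"
    have "y < ent C q" using IH C by (simp add: adj_less)
    then have q: "q < pos C y" using pos_leD[OF C(2), of y q] by (meson not_le)
    have "ent ?D (pos C y - 1) \<le> ent (column T' 0) (pos C y - 1)" by (rule IH)
    also have "\<dots> \<le> y" using IH(5) C q by (simp add: ent_anti)
    finally have le: "ent ?D (pos C y - 1) \<le> y" .
    have adj: "adj C ?D"
      unfolding adj_def
    proof (intro allI impI)
      fix r assume "r < length ?D"
      then have "0 < ent ?D r" using IH by (simp add: ent_pos_iff)
      then show "ent ?D r < ent C r" using IH(6)[of r] C adj_less[of "column T' 0" C r] by simp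
    qed
    have "0 < pos C y" using q by simp
    note U = settle_unsettle[OF C(2) dtab_column[OF IH(2), of 0] adj IH(3) this le]
    let ?B = "unsettle C ?D y" and ?x = "unbump C y"
    have "dtab (?B # T)" using U IH by simp
    moreover have "ins ?x (?B # T) = (C # T', (length (T' ! c') - 1, Suc c'), \<alpha>)"
      using U IH by simp
    moreover have "?x = ent C (pos C y - 1)" by (simp add: unbump_def)
    ultimately show ?thesis using Suc IH U
      by (intro exI[of _ "?B # T"] exI[of _ ?x] exI[of _ "pos C y - 1"]) auto
  qed
qed simp

text \<open>A larger \<open>x'\<close> settles no lower than the row of \<open>x\<close> and passes
  on something that is at least \<open>x\<close>, hence more than \<open>y\<close>. A smaller
  \<open>x'\<close> settles strictly below \<open>x\<close>, and an equal one in the same row; all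
  that they can pass on is bounded by \<open>y\<close>.\<close>

lemma bump_mono:
  assumes C: "dcol C" "dcol D" "adj C D" "0 < x"
  defines "y \<equiv> bump C D x"
  defines "C' \<equiv> settle C x" and "D' \<equiv> (if y = 0 then D else settle D y)"
  shows "x < x' \<Longrightarrow> y < bump C' D' x'" "x' \<le> x \<Longrightarrow> bump C' D' x' \<le> y"
proof -
  let ?i = "pos C x" and ?i' = "pos C' x'"
  have C': "dcol C'" unfolding C'_def using C by (simp add: dcol_settle)
  have yx: "y < x" unfolding y_def by (rule bump_less) fact+
  have le: "ent C (Suc ?i) \<le> y" "ent D ?i \<le> y" unfolding y_def
    using settled_le_bump[OF C] by auto
  have entC': "ent C' r = (if r = ?i then x else ent C r)" for r
    by (simp add: C'_def ent_settle)
  show "y < bump C' D' x'" if "x < x'"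
  proof -
    have "?i' \<le> ?i" using that by (intro pos_le) (simp add: entC')
    then have "x \<le> ent C' ?i'" using ent_anti[OF C', of ?i' ?i] entC' by simp
    moreover have "x \<le> ent C' (Suc ?i')" if "ent C' ?i' = x'"
    proof -
      have "?i' \<noteq> ?i" using that \<open>x < x'\<close> entC' by auto
      then have "Suc ?i' \<le> ?i" using \<open>?i' \<le> ?i\<close> by simp
      then show ?thesis using ent_anti[OF C', of "Suc ?i'" ?i] entC' by simp
    qed
    ultimately show ?thesis using yx by (auto simp: bump_def)
  qed
  have D': "dcol D'" using C by (simp add: D'_def dcol_settle)
  \<comment> \<open>\<open>y\<close> settles in \<open>D\<close> at or above row \<open>?i\<close>,
    so the entry of \<open>D'\<close> in that row cannot exceed it.\<close>
  have leD: "ent D' ?i \<le> y"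
  proof (cases "y = 0")
    case True
    then show ?thesis using le D'_def by simp
  next
    case False
    have "pos D y \<le> ?i" using le by (intro pos_le)
    then have "ent D' ?i \<le> ent D' (pos D y)" using D' by (simp add: ent_anti)
    also have "\<dots> = y" using False by (simp add: D'_def ent_settle)
    finally show ?thesis .
  qed
  show "bump C' D' x' \<le> y" if "x' \<le> x"
  proof (cases "x' = x")
    case True
    have "?i' = ?i"
      by (rule pos_eqI) (use True entC' less_pos[of _ C x] in auto)
    then show ?thesis using True le leD by (simp add: bump_def entC')
  next
    case False
    then have "\<not> ent C' ?i \<le> x'" using that by (simp add: entC')
    then have i': "Suc ?i \<le> ?i'" using pos_leD[OF C', of x' ?i] by (meson not_less_eq_eq not_le)
    then have "ent C' ?i' \<le> y" "ent C' (Suc ?i') \<le> y" "ent D' ?i' \<le> y"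
      using le leD entC' ent_anti[OF C', of "Suc ?i" ?i'] ent_anti[OF C', of "Suc ?i" "Suc ?i'"]
        ent_anti[OF D', of ?i ?i'] by auto
    then show ?thesis by (simp add: bump_def)
  qed
qed

text \<open>By \<open>bump_mono\<close> the two passed values compare as the two letters do, with
  \<open>0\<close> standing for an insertion that has ended. The comparison thus persists from
  column to column until one of the insertions stops.\<close>

lemma ins_ins_column:
  "dtab T \<Longrightarrow> 0 < x \<Longrightarrow> 0 < x' \<Longrightarrow> ins x T = (T1, (r1, c1), \<alpha>1) \<Longrightarrow>
    ins x' T1 = (T2, (r2, c2), \<alpha>2) \<Longrightarrow> x < x' \<longleftrightarrow> c1 < c2"
proof (induction T arbitrary: x x' T1 r1 c1 \<alpha>1 T2 r2 c2 \<alpha>2)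
  case Nil
  have "dcol [x]" "dcol []" using Nil by (auto simp: dcol_def ent_def)
  have "pos [x] x' = (if x \<le> x' then 0 else 1)"
    by (rule pos_eqI) (auto simp: ent_def split: if_splits)
  then have "x < x' \<longleftrightarrow> bump [x] [] x' \<noteq> 0" using Nil by (auto simp: bump_def ent_def)
  then show ?case using Nil by (auto simp: Let_def split: if_splits)
next
  case (Cons C T)
  let ?D = "column T 0"
  let ?y = "bump C ?D x"
  have C: "C \<noteq> []" "dcol C" "adj C ?D" "dtab T" "dcol ?D" using Cons.prems by auto
  note mono = bump_mono[OF C(2) C(5) C(3) Cons.prems(2), of x']
  from Cons.prems(4) show ?case
  proof (cases rule: ins_Cons_cases)
    case stop
    have "x < x' \<longleftrightarrow> bump (settle C x) ?D x' \<noteq> 0" using mono stop by (cases "x < x'") auto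
    then show ?thesis using Cons.prems(5) stop by (auto simp: Let_def split: if_splits prod.splits)
  next
    case (bump T1' c1')
    have D1: "column T1' 0 = settle ?D ?y" using ins_column_0[OF bump(2)] .
    let ?y' = "bump (settle C x) (settle ?D ?y) x'"
    have m: "x < x' \<Longrightarrow> ?y < ?y'" "x' \<le> x \<Longrightarrow> ?y' \<le> ?y" using mono bump by auto
    from Cons.prems(5)[unfolded bump(3)] show ?thesis
    proof (cases rule: ins_Cons_cases)
      case s: stop
      then show ?thesis using m D1 bump by (cases "x < x'") auto
    next
      case b: (bump T2' c2')
      have "?y < ?y' \<longleftrightarrow> c1' < c2'"
        using Cons.IH[OF C(4) bump(1) b(1) bump(2) b(2)] D1 by simp
      then show ?thesis using m bump(4) b(4) by (cases "x < x'") auto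
    qed
  qed
qed

section \<open>Insertion seen from a later column on\<close>

lemma ins_drop:
  "ins x T = (T', (r, c), \<alpha>) \<Longrightarrow> dtab T \<Longrightarrow> 0 < x \<Longrightarrow> j \<le> c \<Longrightarrow>
    \<exists>z. 0 < z \<and> z \<le> x \<and> ins z (drop j T) = (drop j T', (r, c - j), \<alpha>)"
proof (induction T arbitrary: x T' c j)
  case (Cons C T)
  show ?case
  proof (cases j)
    case 0
    have "0 < x \<and> x \<le> x \<and> ins x (drop 0 (C # T)) = (drop 0 T', (r, c - 0), \<alpha>)"
      using Cons.prems(1,3) by (simp del: ins.simps)
    then show ?thesis using 0 by blast
  next
    case (Suc j')
    from Cons.prems(1) show ?thesis
    proof (cases rule: ins_Cons_cases)
      case (bump T'' c')
      have "bump C (column T 0) x < x" using Cons.prems by (intro bump_less) auto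
      moreover obtain z where "0 < z" "z \<le> bump C (column T 0) x"
        "ins z (drop j' T) = (drop j' T'', (r, c' - j'), \<alpha>)"
        using Cons.IH[OF bump(2) _ bump(1), of j'] Cons.prems Suc bump by auto
      ultimately show ?thesis using Suc bump by (intro exI[of _ z]) auto
    qed (use Cons.prems Suc in simp)
  qed
qed auto

lemma ins_drop_after: "ins x T = (T', (r, c), \<alpha>) \<Longrightarrow> c < j \<Longrightarrow> drop j T' = drop j T"
proof (induction T arbitrary: x T' c j)
  case (Cons C T)
  from Cons.prems(1) show ?case
  proof (cases rule: ins_Cons_cases)
    case stop
    then show ?thesis using Cons.prems by (cases j) auto
  next
    case (bump T'' c')
    then show ?thesis using Cons.IH[OF bump(2)] Cons.prems by (cases j) auto
  qed
qed auto

lemma ins_new_box: "ins x T = (T', (r, c), \<alpha>) \<Longrightarrow> \<alpha> = 1 \<Longrightarrow> dtab T \<Longrightarrow> 0 < x \<Longrightarrow>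
    \<exists>z. (c = 0 \<longrightarrow> z = x) \<and> column T' c = column T c @ [z]"
proof -
  assume ins: "ins x T = (T', (r, c), \<alpha>)" "\<alpha> = 1" "dtab T" "0 < x"
  obtain z where z: "c = 0 \<longrightarrow> z = x" "ins z (drop c T) = (drop c T', (r, 0), \<alpha>)"
  proof (cases "c = 0")
    case False
    then show ?thesis using ins_drop[OF ins(1,3,4), of c] that by auto
  qed (use ins(1) that in simp)
  have cT': "c < length T'" using ins_corner[OF ins(3,4,1)] by simp
  show ?thesis
  proof (cases "c < length T")
    case False
    then have "drop c T' = [[z]]" using z by simp
    then show ?thesis using z False cT'
      by (intro exI[of _ z]) (auto simp: column_def Cons_nth_drop_Suc[symmetric])
  next
    case True
    then have d: "drop c T = T ! c # drop (Suc c) T" by (simp add: Cons_nth_drop_Suc)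
    have dt: "dcol (T ! c)" using dtab_column[OF ins(3), of c] True by (simp add: column_def)
    from z(2)[unfolded d] show ?thesis
    proof (cases rule: ins_Cons_cases)
      case stop
      then have "ent (T ! c) (pos (T ! c) z) \<noteq> z" using ins(2) by auto
      then have "pos (T ! c) z = length (T ! c)"
        using stop dt pos_le_length[of "T ! c" z] by (simp add: bump_def ent_0_iff)
      moreover have "T' ! c = settle (T ! c) z"
        using stop cT' by (simp add: Cons_nth_drop_Suc[symmetric])
      ultimately show ?thesis using True cT' z
        by (intro exI[of _ z]) (simp add: column_def settle_def put_def)
    qed simp
  qed
qed

section \<open>Comparison with Hecke insertion\<close>

lemma partition_shape_iff:
  "partition_shape T \<longleftrightarrow> (\<forall>k < length T. T ! k \<noteq> []) \<and>
    (\<forall>k. Suc k < length T \<longrightarrow> length (T ! Suc k) \<le> length (T ! k))"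
  unfolding partition_shape_def shape_def
  by (subst sorted_wrt_iff_nth_Suc_transp)
    (auto simp: transp_def all_set_conv_all_nth)

lemma dtab_iff_nth:
  "dtab T \<longleftrightarrow> (\<forall>k < length T. T ! k \<noteq> [] \<and> dcol (T ! k) \<and> adj (T ! k) (column T (Suc k)))"
  by (induction T) (auto simp: nth_Cons less_Suc_eq_0_disj split: nat.splits)

lemma decreasing_tableau_iff_dtab: "decreasing_tableau T \<longleftrightarrow> dtab T"
proof
  assume T: "decreasing_tableau T"
  show "dtab T"
    unfolding dtab_iff_nth
  proof (intro allI impI conjI)
    fix k assume k: "k < length T"
    show "T ! k \<noteq> []"
      using T k by (simp add: decreasing_tableau_def partition_shape_iff)
    show "dcol (T ! k)"
      using T k by (auto simp: dcol_def decreasing_tableau_def boxes_def ent_def)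
    show "adj (T ! k) (column T (Suc k))"
    proof (cases "Suc k < length T")
      case True
      then have "length (T ! Suc k) \<le> length (T ! k)"
        using T by (simp add: decreasing_tableau_def partition_shape_iff)
      then show ?thesis using T True
        by (auto simp: adj_def decreasing_tableau_def boxes_def ent_def column_def)
    qed (simp add: column_def)
  qed
next
  assume "dtab T"
  then have T: "T ! k \<noteq> []" "dcol (T ! k)" "adj (T ! k) (column T (Suc k))" if "k < length T" for k
    using that by (simp_all add: dtab_iff_nth)
  have len: "length (T ! Suc k) \<le> length (T ! k)" if "Suc k < length T" for k
    using adj_length[OF T(3)[of k]] that by (simp add: column_def)
  show "decreasing_tableau T"
    unfolding decreasing_tableau_def
  proof (intro conjI allI impI)
    show "partition_shape T" using T len by (simp add: partition_shape_iff)
    show "\<forall>(r, c)\<in>boxes T. 0 < T ! c ! r"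
      using T(2) by (auto simp: boxes_def dest: mem_pos[OF _ nth_mem])
    fix r c
    show "T ! Suc c ! r < T ! c ! r" if rc: "(r, Suc c) \<in> boxes T"
    proof -
      have "c < length T" "r < length (T ! c)" "column T (Suc c) = T ! Suc c"
        using rc len[of c] by (auto simp: boxes_def column_def)
      then show ?thesis using T(3)[of c] rc by (auto simp: adj_def boxes_def ent_def)
    qed
    show "T ! c ! Suc r < T ! c ! r" if rc: "(Suc r, c) \<in> boxes T"
    proof -
      have "ent (T ! c) (Suc r) < ent (T ! c) r"
        using T(2)[of c] rc by (auto simp: boxes_def dcol_def)
      then show ?thesis using rc by (simp add: boxes_def ent_def)
    qed
  qed
qed

lemma dtab_append:
  "dtab (A @ U) \<longleftrightarrow> dtab A \<and> dtab U \<and> (A \<noteq> [] \<longrightarrow> adj (last A) (column U 0))"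
proof (induction A)
  case (Cons B A)
  have "column (A @ U) 0 = (if A = [] then column U 0 else column A 0)"
    by (cases A) auto
  then show ?case using Cons by auto
qed simp

lemma column_append [simp]: "column (A @ U) (length A) = column U 0"
  by (cases U) (auto simp: column_def)

lemma set_column_append [simp]: "set_column (A @ C # U) (length A) B = A @ B # U"
  by (simp add: set_column_def)

lemma Max_below:
  assumes "dcol C" "j < length C" "\<And>r. r < j \<Longrightarrow> x \<le> ent C r" "ent C j < x"
  shows "Max {z \<in> set C. z < x} = ent C j"
proof (rule Max_eqI)
  show "ent C j \<in> {z \<in> set C. z < x}" using assms by (simp add: ent_def)
  fix z assume "z \<in> {z \<in> set C. z < x}"
  then obtain r where "r < length C" "z = ent C r" "z < x"
    by (auto simp: in_set_conv_nth ent_def)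
  then have "\<not> r < j" using assms(3)[of r] by auto
  then show "z \<le> ent C j" using assms(1) \<open>z = ent C r\<close> by (simp add: ent_anti)
qed simp

lemma map_replace:
  assumes "dcol C" "j < length C"
  shows "map (\<lambda>z. if z = ent C j then x else z) C = put C j x"
proof (rule nth_equalityI)
  fix r assume r: "r < length (map (\<lambda>z. if z = ent C j then x else z) C)"
  have "ent C r = ent C j \<longleftrightarrow> r = j"
    using assms r ent_strict[of C r j] ent_strict[of C j r]
    by (metis ent_pos_iff length_map less_irrefl linorder_neqE_nat)
  then show "map (\<lambda>z. if z = ent C j then x else z) C ! r = put C j x ! r"
    using assms r by (auto simp: put_def ent_def nth_list_update)
qed (use assms in \<open>simp add: put_def\<close>)

text \<open>Here \<open>j\<close> counts the entries that are at least \<open>x\<close>. The list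
  \<open>put C j x\<close> covers both appending, for \<open>j = length C\<close>, and replacing the
  output \<open>ent C j\<close>, which merges the two cases of the insertion rule.\<close>

lemma hecke_from_step:
  assumes "dcol C" "j \<le> length C" "\<And>r. r < j \<Longrightarrow> x \<le> ent C r" "ent C j < x"
  shows "hecke_from (length A) x (A @ C # U) =
    (if j = length C
     then (if dtab (A @ put C j x # U) then (A @ put C j x # U, (j, length A), 1)
       else (A @ C # U, rightmost_box (A @ C # U) (j - 1), 0))
     else hecke_from (Suc (length A)) (ent C j)
       (if dtab (A @ put C j x # U) then A @ put C j x # U else A @ C # U))"
proof (cases "j = length C")
  case True
  then have "\<forall>z\<in>set C. x \<le> z" using assms(3) by (auto simp: in_set_conv_nth ent_def)
  then show ?thesis using True
    by (subst hecke_from.simps)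
      (simp add: append_entry_def decreasing_tableau_iff_dtab put_def)
next
  case False
  then have j: "j < length C" using assms(2) by simp
  then have notall: "\<not> (\<forall>z\<in>set C. x \<le> z)" using assms(4) by (auto simp: ent_def not_le)
  have "hecke_from (length A) x (A @ C # U) =
    (let T' = replace_entry (A @ C # U) (length A) (Max {z \<in> set C. z < x}) x in
     hecke_from (Suc (length A)) (Max {z \<in> set C. z < x})
       (if decreasing_tableau T' then T' else A @ C # U))"
    unfolding hecke_from.simps[of "length A" x "A @ C # U"] column_append column_simps Let_def
      if_not_P[OF notall] ..
  also have "Max {z \<in> set C. z < x} = ent C j"
    by (rule Max_below) (use assms j in auto)
  also have "replace_entry (A @ C # U) (length A) (ent C j) x = A @ put C j x # U"
    using map_replace[OF assms(1) j] by (simp add: replace_entry_def)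
  finally show ?thesis using False by (simp add: Let_def decreasing_tableau_iff_dtab)
qed

lemma no_boxes: "dtab T \<Longrightarrow> length (column T 0) \<le> i \<Longrightarrow> (i, c) \<notin> boxes T"
proof (induction T arbitrary: c)
  case (Cons C T)
  then have "length (column T 0) \<le> i" using adj_length[of C "column T 0"] by simp
  then have "(i, c') \<notin> boxes T" for c' using Cons by simp
  then show ?case using Cons by (cases c) (auto simp: boxes_def)
qed (simp add: boxes_def)

text \<open>With nothing below, the value passed on is the right neighbour. The insertion therefore
  runs along the row without changing it and ends in its rightmost box, where the rule for
  \<open>\<alpha> = 0\<close> puts it.\<close>

lemma ins_bottom:
  "dtab (C # T) \<Longrightarrow> length C = Suc i \<Longrightarrow>
    \<exists>c. ins (ent C i) (C # T) = (C # T, (i, c), 0) \<and> {c'. (i, c') \<in> boxes (C # T)} = {..c}"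
proof (induction T arbitrary: C)
  case Nil
  have pos: "pos C (ent C i) = i" using Nil by (intro pos_ent) auto
  then have "settle C (ent C i) = C" using Nil by (simp add: settle_member ent_pos_iff)
  moreover have "{c'. (i, c') \<in> boxes [C]} = {..0}" using Nil by (auto simp: boxes_def)
  ultimately show ?case using pos Nil by (simp add: bump_def ent_def)
next
  case (Cons D T)
  have pos: "pos C (ent C i) = i" using Cons.prems by (intro pos_ent) auto
  have settle: "settle C (ent C i) = C" using pos Cons.prems by (simp add: settle_member ent_pos_iff)
  have "ent C (Suc i) = 0" using Cons.prems by (simp add: ent_def)
  then have bump: "bump C D (ent C i) = ent D i" using pos by (simp add: bump_def)
  have boxes: "{c'. (i, c') \<in> boxes (C # D # T)} = insert 0 (Suc ` {c'. (i, c') \<in> boxes (D # T)})"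
  proof (intro set_eqI)
    fix c show "c \<in> {c'. (i, c') \<in> boxes (C # D # T)} \<longleftrightarrow>
      c \<in> insert 0 (Suc ` {c'. (i, c') \<in> boxes (D # T)})"
      using Cons.prems by (cases c) (auto simp: boxes_def)
  qed
  show ?case
  proof (cases "ent D i = 0")
    case True
    then have "(i, c') \<notin> boxes (D # T)" for c'
      using Cons.prems by (intro no_boxes) (auto simp: ent_0_iff)
    then have "{c'. (i, c') \<in> boxes (C # D # T)} = {..0}" using boxes by auto
    then show ?thesis using True bump settle pos by simp
  next
    case False
    then have len: "length D = Suc i"
      using Cons.prems adj_length[of C D] ent_pos_iff[of D i] by simp
    have "dtab (D # T)" using Cons.prems by simp
    from Cons.IH[OF this len] obtain c where c: "ins (ent D i) (D # T) = (D # T, (i, c), 0)"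
      "{c'. (i, c') \<in> boxes (D # T)} = {..c}" by blast
    then have "{c'. (i, c') \<in> boxes (C # D # T)} = {..Suc c}" using boxes
      by (simp add: atMost_Suc_eq_insert_0)
    moreover have "ins (ent C i) (C # D # T) = (C # D # T, (i, Suc c), 0)"
      unfolding ins.simps(2)[of "ent C i" C "D # T"]
      by (simp only: column_simps bump Let_def c(1) settle prod.case False if_False)
    ultimately show ?thesis by blast
  qed
qed

text \<open>Hecke insertion and \<^const>\<open>ins\<close> agree on the resulting tableau and box but not on the entries
  passed between columns: when \<open>x\<close> could not replace the entry below \<open>x'\<close> of the column because \<open>x\<close> is
  also the left neighbour of that entry, \<^const>\<open>ins\<close> carries \<open>x'\<close> instead.\<close>

definition carried :: "nat list list \<Rightarrow> nat list \<Rightarrow> nat \<Rightarrow> nat \<Rightarrow> bool" where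
  "carried A C x x' \<longleftrightarrow> 0 < x \<and>
     (x' = x \<and> (A = [] \<or> adm (last A) C x) \<or>
      A \<noteq> [] \<and> x < x' \<and> (\<exists>\<rho>. x = ent (last A) (Suc \<rho>) \<and> x' = ent C \<rho>))"

text \<open>If \<open>x'\<close> is not an entry of the column, then \<open>x' = x\<close> and both
  versions settle it and pass on the same value. If it is, Hecke insertion tries to put
  \<open>x\<close> just below \<open>x'\<close> and fails, because \<open>x\<close> equals either
  \<open>x'\<close> or the left neighbour of that place.\<close>

lemma hecke_from_eq_ins:
  "dtab (A @ U) \<Longrightarrow> carried A (column U 0) x x' \<Longrightarrow>
    hecke_from (length A) x (A @ U) =
      (case ins x' U of (U', (r, c), \<alpha>) \<Rightarrow> (A @ U', (r, length A + c), \<alpha>))"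
proof (induction U arbitrary: A x x')
  case Nil
  have pos: "pos [] x = 0" using pos_le_length[of "[]" x] by simp
  have x: "x' = x" "0 < x" "A = [] \<or> x < ent (last A) 0"
    using Nil(2) pos by (auto simp: carried_def adm_def ent_def)
  have "dtab (A @ [[x]])"
    using Nil(1) x by (auto simp: dtab_append adj_def dcol_def ent_def)
  then show ?case using x
    by (subst hecke_from.simps)
      (simp add: column_def append_entry_def set_column_def decreasing_tableau_iff_dtab)
next
  case (Cons C T)
  let ?D = "column T 0"
  let ?i = "pos C x'"
  have C: "dtab A" "C \<noteq> []" "dcol C" "adj C ?D" "dtab T" "dcol ?D" "dtab (C # T)"
    "A \<noteq> [] \<longrightarrow> adj (last A) C"
    using Cons.prems(1) by (auto simp: dtab_append)
  have x: "0 < x" "0 < x'" using Cons.prems(2) by (auto simp: carried_def)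
  have nth: "(A @ C # T) ! length A = C" by simp
  show ?case
  proof (cases "ent C ?i = x'")
    case True
    have i: "?i < length C" using True x C by (metis ent_pos_iff)
    have settle: "settle C x' = C" using True C x by (simp add: settle_member)
    have x_cases: "x = x' \<or> A \<noteq> [] \<and> x < x' \<and> x = ent (last A) (Suc ?i)"
    proof (cases "x = x'")
      case False
      then obtain \<rho> where \<rho>: "A \<noteq> []" "x < x'" "x = ent (last A) (Suc \<rho>)" "x' = ent C \<rho>"
        using Cons.prems(2) by (auto simp: carried_def)
      then have "\<rho> = ?i" using C x pos_ent[OF C(3), of \<rho>] by (simp add: ent_pos_iff)
      then show ?thesis using \<rho> by simp
    qed simp
    have le: "x \<le> x'" using x_cases by auto
    have below: "ent C (Suc ?i) < x"
      using x_cases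
    proof
      assume "x = x'"
      then show ?thesis using True i C(3) by (metis dcol_def)
    next
      assume "A \<noteq> [] \<and> x < x' \<and> x = ent (last A) (Suc ?i)"
      then show ?thesis using C(3,8) x adj_less[of C "last A" "Suc ?i"]
        by (cases "ent C (Suc ?i) = 0") auto
    qed
    have above: "x \<le> ent C r" if "r < Suc ?i" for r
      using that le True ent_anti[OF C(3), of r ?i] by simp
    have notdtab: "\<not> dtab (A @ put C (Suc ?i) x # T)"
      using x_cases
    proof
      assume "x = x'"
      then have "\<not> dcol (put C (Suc ?i) x)" using True i
        by (auto simp: dcol_def ent_put length_put intro!: exI[of _ ?i])
      then show ?thesis by (simp add: dtab_append)
    next
      assume "A \<noteq> [] \<and> x < x' \<and> x = ent (last A) (Suc ?i)"
      moreover from this i have "\<not> adj (last A) (put C (Suc ?i) x)"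
        by (auto simp: adj_def ent_put length_put intro!: exI[of _ "Suc ?i"])
      ultimately show ?thesis by (simp add: dtab_append)
    qed
    have step: "hecke_from (length A) x (A @ C # T) =
      (if Suc ?i = length C then (A @ C # T, rightmost_box (A @ C # T) ?i, 0)
       else hecke_from (Suc (length A)) (ent C (Suc ?i)) (A @ C # T))"
      using hecke_from_step[OF C(3) Suc_leI[OF i] above below, where A=A and U=T]
      unfolding if_not_P[OF notdtab] diff_Suc_1 .
    show ?thesis
    proof (cases "Suc ?i = length C")
      case bottom: True
      obtain c where c: "ins x' (C # T) = (C # T, (?i, c), 0)"
        "{c'. (?i, c') \<in> boxes (C # T)} = {..c}"
        using ins_bottom[OF C(7) bottom[symmetric]] True by auto
      have shift: "(?i, length A + c') \<in> boxes (A @ C # T) \<longleftrightarrow> c' \<le> c" for c'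
      proof -
        have "(?i, length A + c') \<in> boxes (A @ C # T) \<longleftrightarrow> (?i, c') \<in> boxes (C # T)"
          by (simp add: boxes_def)
        then show ?thesis using c(2) by auto
      qed
      have "Max {c'. (?i, c') \<in> boxes (A @ C # T)} = length A + c"
      proof (rule Max_eqI)
        show "finite {c'. (?i, c') \<in> boxes (A @ C # T)}"
          by (rule finite_subset[of _ "{..<length (A @ C # T)}"]) (auto simp: boxes_def)
        fix c' assume c': "c' \<in> {c'. (?i, c') \<in> boxes (A @ C # T)}"
        show "c' \<le> length A + c"
        proof (cases "c' < length A")
          case False
          then show ?thesis using shift[of "c' - length A"] c' by simp
        qed simp
      qed (use shift[of c] in simp)
      then show ?thesis using step bottom c(1) by (simp add: rightmost_box_def)
    next
      case False
      let ?y = "ent C (Suc ?i)"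
      let ?y' = "bump C ?D x'"
      have y: "0 < ?y" using False i C by (simp add: ent_pos_iff)
      have y': "?y' = max ?y (ent ?D ?i)" using True by (simp add: bump_def)
      then have pos: "0 < ?y'" using y by simp
      \<comment> \<open>Now \<open>C\<close> plays the part of the left column. If the right
        neighbour of \<open>x'\<close> wins the maximum, the second alternative of
        \<open>carried\<close> holds with the row \<open>?i\<close>.\<close>
      have "carried (A @ [C]) ?D ?y ?y'"
      proof (cases "ent ?D ?i \<le> ?y")
        case True
        then show ?thesis using y y' adm_bump[OF C(3,6,4) x(2) pos] settle
          by (simp add: carried_def)
      next
        case False
        then show ?thesis using y y' by (auto simp: carried_def)
      qed
      moreover have "dtab ((A @ [C]) @ T)" using Cons.prems(1) by simp
      ultimately have "hecke_from (Suc (length A)) ?y (A @ C # T) =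
        (case ins ?y' T of (U', (r, c), \<alpha>) \<Rightarrow> (A @ C # U', (r, Suc (length A) + c), \<alpha>))"
        using Cons.IH[of "A @ [C]" ?y ?y'] by simp
      then show ?thesis using step False pos settle by (simp split: prod.splits)
    qed
  next
    case False
    have x': "x' = x" "A = [] \<or> adm (last A) C x"
    proof -
      have "\<not> (\<exists>\<rho>. x' = ent C \<rho>)"
        using False x C by (metis ent_pos_iff pos_ent)
      then show "x' = x" "A = [] \<or> adm (last A) C x" using Cons.prems(2) by (auto simp: carried_def)
    qed
    let ?i = "pos C x"
    have settle: "settle C x = put C ?i x" by (simp add: settle_def)
    have y: "bump C ?D x = ent C ?i" using False x' by (simp add: bump_def)
    have d: "dtab (A @ settle C x # T)"
      using C x x' by (auto simp: dtab_append dcol_settle adj_settle adj_settle_left)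
    have lt: "ent C ?i < x" using False x' ent_pos[of C x] by simp
    have above: "x \<le> ent C r" if "r < ?i" for r
      using less_pos[OF that] by simp
    have step: "hecke_from (length A) x (A @ C # T) =
      (if ?i = length C then (A @ settle C x # T, (?i, length A), 1)
       else hecke_from (Suc (length A)) (ent C ?i) (A @ settle C x # T))"
      using hecke_from_step[OF C(3) pos_le_length above lt, where A=A and U=T] d
      unfolding settle by (simp only: if_True)
    show ?thesis
    proof (cases "?i = length C")
      case True
      then have "ent C ?i = 0" by (simp add: ent_def)
      then show ?thesis using step True y x' x by simp
    next
      case i: False
      then have pos: "0 < bump C ?D x"
        using y C pos_le_length[of C x] by (simp add: ent_pos_iff)
      then have "carried (A @ [settle C x]) ?D (ent C ?i) (bump C ?D x)"
        using adm_bump[OF C(3,6,4) x(1) pos] y by (simp add: carried_def)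
      moreover have "dtab ((A @ [settle C x]) @ T)" using d by simp
      ultimately have "hecke_from (Suc (length A)) (ent C ?i) (A @ settle C x # T) =
        (case ins (bump C ?D x) T of (U', (r, c), \<alpha>) \<Rightarrow>
          (A @ settle C x # U', (r, Suc (length A) + c), \<alpha>))"
        using Cons.IH[of "A @ [settle C x]"] by simp
      then show ?thesis using step i pos x' by (simp split: prod.splits)
    qed
  qed
qed

lemma hecke_insert_eq_ins: "dtab T \<Longrightarrow> 0 < x \<Longrightarrow> hecke_insert x T = ins x T"
  using hecke_from_eq_ins[of "[]" T x x]
  by (simp add: hecke_insert_def carried_def split: prod.splits)

section \<open>Right keys under insertion\<close>

lemma column_word_simps [simp]:
  "column_word [] = []" "column_word (C # T) = rev C @ column_word T"
  by (simp_all add: column_word_def)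

lemma dcol_sorted_rev: "dcol C \<Longrightarrow> sorted_wrt (<) (rev C)"
  using dcol_sorted by (simp add: sorted_wrt_rev)

text \<open>For the star action, inserting \<open>x\<close> is the same as writing it in front of
  the reading word. A replacement is \<open>star_word_bump\<close>. If \<open>x\<close> is already
  present it is absorbed, and the value passed on is harmless too: it is an entry of
  \<open>C\<close>, hence in the set already, or an entry of the next column, which absorbs
  it.\<close>

lemma star_word_ins:
  "dtab T \<Longrightarrow> 0 < x \<Longrightarrow> ins x T = (T', (r, c), \<alpha>) \<Longrightarrow>
    star_word S (column_word T') = star_word (star S x) (column_word T)"
proof (induction T arbitrary: x T' r c \<alpha> S)
  case (Cons C T)
  let ?D = "column T 0" and ?i = "pos C x"
  let ?y = "bump C ?D x"
  have C: "C \<noteq> []" "dcol C" "adj C ?D" "dtab T" "dcol ?D" "sorted_wrt (<) (rev C)"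
    using Cons.prems by (auto simp: dcol_sorted_rev)
  show ?case
  proof (cases "ent C ?i = x")
    case True
    have settle: "settle C x = C" using True C Cons.prems by (simp add: settle_member)
    have "x \<in> set (rev C)" using True Cons.prems(2) by (metis ent_mem set_rev)
    then have absorb: "star_word (star S x) (rev C) = star_word S (rev C)"
      using C by (intro star_word_absorb_member)
    from Cons.prems(3) show ?thesis
    proof (cases rule: ins_Cons_cases)
      case stop
      then show ?thesis using settle absorb by simp
    next
      case (bump T'' c')
      let ?S = "star_word S (rev C)"
      have y: "?y = ent C (Suc ?i) \<or> ?y = ent ?D ?i" using True by (auto simp: bump_def)
      have "star_word (star ?S ?y) (column_word T) = star_word ?S (column_word T)"
        using y
      proof
        assume "?y = ent C (Suc ?i)"
        then have "?y \<in> set (rev C)" using bump(1) by (metis ent_mem set_rev)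
        then have "?y \<in> ?S" using star_word_increasing_superset[OF C(6), of S] by blast
        then show ?thesis by (simp add: star_same)
      next
        assume "?y = ent ?D ?i"
        then have D: "?y \<in> set (rev ?D)" using bump(1) by (metis ent_mem set_rev)
        then obtain T0 where T: "T = ?D # T0" by (cases T) auto
        have "star_word (star ?S ?y) (rev ?D) = star_word ?S (rev ?D)"
          using D C by (intro star_word_absorb_member dcol_sorted_rev)
        then show ?thesis by (subst (1 2) T) simp
      qed
      then show ?thesis using bump settle absorb Cons.IH[OF C(4) bump(1,2), of ?S] by simp
    qed
  next
    case False
    show ?thesis
    proof (cases "?i = length C")
      case True
      then have "?y = 0" using False by (simp add: bump_def ent_def)
      then have "T' = (C @ [x]) # T"
        using Cons.prems(3) True by (simp add: settle_def put_def)
      then show ?thesis by simp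
    next
      case i: False
      then have i: "?i < length C" using pos_le_length[of C x] by simp
      let ?v = "rev (drop (Suc ?i) C)" and ?w = "rev (take ?i C)"
      have y: "?y = C ! ?i" using False i by (simp add: bump_def ent_def)
      have dec: "C = take ?i C @ ?y # drop (Suc ?i) C" using i y by (simp add: id_take_nth_drop)
      then have rC: "rev C = ?v @ ?y # ?w" by (metis append.assoc append_Cons append_Nil rev.simps(2) rev_append)
      have "settle C x = take ?i C @ x # drop (Suc ?i) C"
        using i by (simp add: settle_def put_def upd_conv_take_nth_drop)
      then have rS: "rev (settle C x) = ?v @ x # ?w" by simp
      have "\<forall>m\<in>set ?w. x < m"
        using less_pos[of _ C x] i by (auto simp: in_set_conv_nth ent_def)
      moreover have "?y < x" using False ent_pos[of C x] by (simp add: bump_def)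
      ultimately have bumped: "star_word (star S x) (rev C) = star (star_word S (rev (settle C x))) ?y"
        unfolding rC rS using C(6) rC by (intro star_word_bump) auto
      have pos: "0 < ?y" using i C y by (metis ent_def ent_pos_iff)
      from Cons.prems(3) show ?thesis
      proof (cases rule: ins_Cons_cases)
        case (bump T'' c')
        then show ?thesis using bumped Cons.IH[OF C(4) bump(1,2)] by simp
      qed (use pos in simp)
    qed
  qed
qed auto

section \<open>Columns of the right key\<close>

definition rkey :: "nat list list \<Rightarrow> nat \<Rightarrow> nat set" where
  "rkey P j = star_word {} (column_word (drop j P))"

lemma finite_rkey [simp]: "finite (rkey P j)"
  by (simp add: rkey_def)

lemma rkey_column:
  assumes "dtab P"
  shows "rkey P j = star_word (set (column P j)) (column_word (drop (Suc j) P))"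
proof (cases "j < length P")
  case True
  then have "drop j P = column P j # drop (Suc j) P"
    by (simp add: column_def Cons_nth_drop_Suc)
  moreover have "star_word {} (rev (column P j)) = set (column P j)"
    using star_word_increasing_above[of "rev (column P j)" "{}"] dcol_sorted_rev[OF dtab_column[OF assms, of j]]
    by simp
  ultimately show ?thesis by (simp add: rkey_def)
qed (simp add: rkey_def column_def)

text \<open>The same later columns act on the column \<open>j\<close> on one side and on the empty
  set on the other.\<close>

lemma rkey_Suc_subset:
  assumes "dtab P"
  shows "rkey P (Suc j) \<subseteq> rkey P j"
  unfolding rkey_column[OF assms, of j] by (simp add: rkey_def star_word_mono)

lemma dcol_distinct: "dcol C \<Longrightarrow> distinct C"
  using dcol_sorted_rev[of C] by (metis distinct_rev strict_sorted_iff)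

lemma adj_dominates: "adj B C \<Longrightarrow> dcol B \<Longrightarrow> dcol C \<Longrightarrow> dominates (set B) (set C)"
  by (rule dominates_nth)
    (use adj_length[of B C] in \<open>auto simp: dcol_distinct adj_def ent_def split: if_splits\<close>)

lemma dominates_empty [simp]: "dominates S {}"
  by (simp add: dominates_def)

text \<open>After a column has acted, it is contained in the set, and it dominates the column to its
  right; so the Hall condition is renewed column by column.\<close>

lemma card_star_word_column_word:
  "dtab T \<Longrightarrow> finite S \<Longrightarrow> dominates S (set (column T 0)) \<Longrightarrow>
    card (star_word S (column_word T)) = card S"
proof (induction T arbitrary: S)
  case (Cons C T)
  let ?S = "star_word S (rev C)"
  have C: "dcol C" "dtab T" "adj C (column T 0)" using Cons.prems by auto
  have "card ?S = card S"
    using Cons.prems C by (intro card_star_word_dominated) (auto simp: dcol_sorted_rev)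
  moreover have "set C \<subseteq> ?S"
    using star_word_increasing_superset[OF dcol_sorted_rev[OF C(1)], of S] by simp
  then have "dominates ?S (set (column T 0))"
    using dominates_mono[OF adj_dominates[OF C(3,1)], of "set (column T 0)" ?S] C Cons.prems(2) by auto
  then have "card (star_word ?S (column_word T)) = card ?S"
    using C Cons.prems(2) by (intro Cons.IH) auto
  ultimately show ?case by simp
qed simp

lemma dtab_drop: "dtab T \<Longrightarrow> dtab (drop j T)"
  using dtab_append[of "take j T" "drop j T"] by simp

lemma column_drop: "column (drop j T) k = column T (j + k)"
  by (auto simp: column_def)

lemma adj_column: "dtab T \<Longrightarrow> adj (column T j) (column T (Suc j))"
  by (cases "j < length T") (auto simp: dtab_iff_nth column_def)

lemma card_rkey: "dtab P \<Longrightarrow> card (rkey P j) = length (column P j)"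
  unfolding rkey_column
  by (subst card_star_word_column_word)
    (auto simp: dtab_drop column_drop adj_dominates adj_column dcol_distinct distinct_card)

text \<open>From column \<open>j\<close> on the insertion is that of some letter \<open>z\<close>,
  which acts before the rest of the word, and a larger starting set has a larger image.\<close>

lemma rkey_ins_subset:
  assumes "dtab T" "0 < x" "ins x T = (T', (r, c), \<alpha>)"
  shows "rkey T j \<subseteq> rkey T' j"
proof (cases "j \<le> c")
  case True
  then obtain z where z: "0 < z" "ins z (drop j T) = (drop j T', (r, c - j), \<alpha>)"
    using ins_drop[OF assms(3,1,2)] by blast
  then have "rkey T' j = star_word (star {} z) (column_word (drop j T))"
    unfolding rkey_def using assms by (intro star_word_ins dtab_drop)
  then show ?thesis by (simp add: rkey_def star_word_mono)
next
  case False
  then show ?thesis using ins_drop_after[OF assms(3)] by (simp add: rkey_def)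
qed

lemma length_column_shape: "length (column T j) = (if j < length T then shape T ! j else 0)"
  by (simp add: column_def shape_def)

lemma length_shape: "length (shape T) = length T"
  by (simp add: shape_def)

lemma length_column_ins:
  assumes "dtab T" "0 < x" "ins x T = (T', (r, c), \<alpha>)"
  shows "length (column T' j) = (if \<alpha> = 1 \<and> j = c then Suc (length (column T j)) else length (column T j))"
proof -
  note corner = ins_corner[OF assms]
  consider "\<alpha> = 0" "shape T' = shape T" | "\<alpha> = 1" "r = length (column T c)" "c < length T"
      "shape T' = (shape T)[c := Suc r]" | "\<alpha> = 1" "r = 0" "c = length T" "shape T' = shape T @ [1]"
    using corner by auto
  then show ?thesis
  proof cases
    case 1
    then show ?thesis by (simp add: length_column_shape) (metis length_shape)
  next
    case 2
    then have "length T' = length T" by (metis length_list_update length_shape)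
    then show ?thesis using 2 by (simp add: length_column_shape nth_list_update length_shape)
  next
    case 3
    then have "length T' = Suc (length T)" by (metis length_append_singleton length_shape)
    then show ?thesis using 3 by (auto simp: length_column_shape nth_append length_shape)
  qed
qed

lemma rkey_ins_unchanged:
  assumes "dtab T" "0 < x" "ins x T = (T', (r, c), \<alpha>)" "\<alpha> = 0 \<or> j \<noteq> c"
  shows "rkey T' j = rkey T j"
proof -
  have "card (rkey T' j) = card (rkey T j)"
    using length_column_ins[OF assms(1-3), of j] dtab_ins[OF assms(1-3)] assms
    by (auto simp: card_rkey)
  then show ?thesis using rkey_ins_subset[OF assms(1-3), of j] by (metis card_subset_eq finite_rkey)
qed

text \<open>The new bottom entry \<open>z\<close> is smaller than the rest of its column, so it is a
  surplus element in \<open>star_word_insert\<close> with \<open>S\<close> empty; the image of the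
  empty set is the next key column. Comparing sizes shows that the surplus does not vanish.\<close>

lemma rkey_ins_new_box:
  assumes "dtab T" "0 < x" "ins x T = (T', (r, c), 1)"
  obtains e where "e \<notin> rkey T c" "rkey T' c = insert e (rkey T c)"
    "\<forall>g\<in>rkey T c - rkey T (Suc c). e < g" "c = 0 \<Longrightarrow> x \<le> e"
proof -
  obtain z where z: "c = 0 \<longrightarrow> z = x" "column T' c = column T c @ [z]"
    using ins_new_box[OF assms(3) refl assms(1,2)] by blast
  have T': "dtab T'" using dtab_ins[OF assms] .
  let ?w = "column_word (drop (Suc c) T)"
  have "drop (Suc c) T' = drop (Suc c) T" using ins_drop_after[OF assms(3)] by simp
  then have N: "rkey T' c = star_word (insert z (set (column T c))) ?w"
    using z by (simp add: rkey_column[OF T'])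
  have M: "rkey T c = star_word (set (column T c)) ?w" by (rule rkey_column[OF assms(1)])
  have "\<forall>g\<in>set (column T c). z < g"
    using dcol_sorted[OF dtab_column[OF T', of c]] z by (auto simp: sorted_wrt_append)
  then have "z \<notin> set (column T c)" "\<forall>g\<in>set (column T c) - {}. z < g" by auto
  from star_word_insert[OF _ this, of ?w] have "rkey T' c = rkey T c \<or>
    (\<exists>e\<ge>z. e \<notin> rkey T c \<and> rkey T' c = insert e (rkey T c) \<and>
       (\<forall>g\<in>rkey T c - rkey T (Suc c). e < g))"
    unfolding N M by (simp add: rkey_def[of T "Suc c"])
  moreover have "card (rkey T' c) \<noteq> card (rkey T c)"
    using length_column_ins[OF assms, of c] T' assms(1) by (simp add: card_rkey)
  ultimately obtain e where "e \<ge> z" "e \<notin> rkey T c" "rkey T' c = insert e (rkey T c)"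
       "\<forall>g\<in>rkey T c - rkey T (Suc c). e < g" by force
  then show ?thesis using z that by blast
qed

lemma rkey_0_ins_below:
  assumes "dtab T" "0 < x" "ins x T = (T', (r, c), \<alpha>)"
  shows "\<exists>s\<in>rkey T' 0. s \<le> x"
proof -
  have "rkey T' 0 = star_word (star {} x) (column_word T)"
    unfolding rkey_def using star_word_ins[OF assms, of "{}"] by simp
  moreover have "\<exists>s\<in>star {} x. s \<le> x" by (intro bexI[of _ x]) simp_all
  ultimately show ?thesis using star_word_below by metis
qed

section \<open>Left keys under a new box\<close>

text \<open>The elements of \<open>C\<close> left over by the greedy matching of \<open>D\<close> do not depend on the order in which
  \<open>D\<close> is processed, as for parking functions.\<close>

definition park :: "nat \<Rightarrow> nat set \<Rightarrow> nat set" where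
  "park d F = F - {f. f \<in> F \<and> d \<le> f \<and> (\<forall>g\<in>F. d \<le> g \<longrightarrow> f \<le> g)}"

lemma park_least:
  assumes "f \<in> F" "d \<le> f" "\<And>g. g \<in> F \<Longrightarrow> d \<le> g \<Longrightarrow> f \<le> g"
  shows "park d F = F - {f}"
  unfolding park_def using assms by (auto intro: order_antisym)

lemma park_none: "\<forall>f\<in>F. f < d \<Longrightarrow> park d F = F"
  unfolding park_def by auto

lemma park_cases:
  obtains (none) "\<forall>f\<in>F. f < d" "park d F = F"
  | (some) f where "f \<in> F" "d \<le> f" "\<And>g. g \<in> F \<Longrightarrow> d \<le> g \<Longrightarrow> f \<le> g" "park d F = F - {f}"
proof (cases "\<exists>f\<in>F. d \<le> f")
  case True
  define f where "f = (LEAST f. f \<in> F \<and> d \<le> f)"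
  obtain g where "g \<in> F \<and> d \<le> g" using True by blast
  then have f: "f \<in> F \<and> d \<le> f" unfolding f_def by (rule LeastI)
  have le: "f \<le> u" if "u \<in> F" "d \<le> u" for u
    unfolding f_def using that by (simp add: Least_le)
  show ?thesis using f le by (intro some[of f] park_least) auto
next
  case False
  then have "\<forall>f\<in>F. f < d" by auto
  then show ?thesis using none park_none by blast
qed

lemma park_commute_le:
  assumes "a \<le> b"
  shows "park a (park b F) = park b (park a F)"
proof (cases rule: park_cases[where F=F and d=a])
  case none
  then have "park b F = F" using assms by (intro park_none) auto
  then show ?thesis using none by simp
next
  case a: (some f)
  show ?thesis
  proof (cases rule: park_cases[where F=F and d=b])
    case none
    moreover have "park b (F - {f}) = F - {f}" using none by (intro park_none) auto
    ultimately show ?thesis using a by simp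
  next
    case b: (some g)
    have "f \<le> g" using a(3)[of g] b assms by simp
    show ?thesis
    proof (cases "f = g")
      case True
      \<comment> \<open>Both letters want the same place, so \<open>F\<close> has no place from
        \<open>a\<close> up to \<open>b\<close>; with \<open>f\<close> gone they still see the same
        places.\<close>
      have "h \<in> F - {f} \<Longrightarrow> a \<le> h \<longleftrightarrow> b \<le> h" for h
        using a(3)[of h] b(2) True assms by auto
      then have "park a (F - {f}) = park b (F - {f})" unfolding park_def by blast
      then show ?thesis using a b True by simp
    next
      case False
      have "park a (F - {g}) = F - {g} - {f}"
        by (rule park_least) (use a False in auto)
      moreover have "park b (F - {f}) = F - {f} - {g}"
        by (rule park_least) (use b False in auto)
      ultimately show ?thesis using a b by auto
    qed
  qed
qed

interpretation park: comp_fun_commute park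
proof
  show "park b \<circ> park a = park a \<circ> park b" for a b
  proof (cases "a \<le> b")
    case True
    then show ?thesis by (intro ext) (simp add: park_commute_le[OF True])
  next
    case False
    then show ?thesis by (intro ext) (simp add: park_commute_le[of b a])
  qed
qed

definition parked :: "nat set \<Rightarrow> nat set \<Rightarrow> nat set" where
  "parked C D = Finite_Set.fold park C D"

lemma parked_empty [simp]: "parked C {} = C"
  by (simp add: parked_def)

lemma parked_insert: "finite D \<Longrightarrow> d \<notin> D \<Longrightarrow> parked C (insert d D) = park d (parked C D)"
  by (simp add: parked_def)

lemma parked_insert2: "finite D \<Longrightarrow> d \<notin> D \<Longrightarrow> parked C (insert d D) = parked (park d C) D"
  unfolding parked_def by (rule park.fold_insert2)

lemma parked_Un: "finite D \<Longrightarrow> finite E \<Longrightarrow> D \<inter> E = {} \<Longrightarrow> parked C (D \<union> E) = parked (parked C D) E"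
  unfolding parked_def by (rule park.fold_set_union_disj)

lemma parked_subset: "finite D \<Longrightarrow> parked C D \<subseteq> C"
  by (induction D rule: finite_induct) (auto simp: parked_insert park_def)

lemma parked_above: "finite D \<Longrightarrow> f \<in> C \<Longrightarrow> f \<notin> parked C D \<Longrightarrow> \<exists>d\<in>D. d \<le> f"
  by (induction D rule: finite_induct) (auto simp: parked_insert park_def)

lemma park_below: "\<forall>l\<in>L. l < d \<Longrightarrow> park d (F \<union> L) = park d F \<union> L"
  unfolding park_def by (auto; fastforce)

lemma parked_below:
  "finite D \<Longrightarrow> \<forall>l\<in>L. \<forall>d\<in>D. l < d \<Longrightarrow> parked (F \<union> L) D = parked F D \<union> L"
  by (induction D rule: finite_induct) (auto simp: parked_insert park_below)

text \<open>It suffices to count from the least element of \<open>D\<close> that is at least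
  \<open>t\<close>; from there on the elements of \<open>S\<close> lying below all of
  \<open>D\<close> are not counted.\<close>

lemma dominates_restrict:
  assumes "dominates S D" "finite S" "finite D" "\<forall>s\<in>S. s \<in> S' \<or> (\<forall>d\<in>D. s < d)" "finite S'"
  shows "dominates S' D"
  unfolding dominates_def
proof
  fix t
  show "card {d \<in> D. t \<le> d} \<le> card {s \<in> S'. t \<le> s}"
  proof (cases "{d \<in> D. t \<le> d} = {}")
    case False
    define m where "m = Min {d \<in> D. t \<le> d}"
    have "m \<in> {d \<in> D. t \<le> d}" unfolding m_def using False assms by (intro Min_in) auto
    then have m: "m \<in> D" "t \<le> m" by auto
    have "m \<le> d" if "d \<in> D" "t \<le> d" for d
      unfolding m_def using that assms by (intro Min_le) auto
    then have "{d \<in> D. t \<le> d} = {d \<in> D. m \<le> d}" using m by auto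
    then have "card {d \<in> D. t \<le> d} \<le> card {s \<in> S. m \<le> s}"
      using assms(1) by (simp add: dominates_def)
    also have "\<dots> \<le> card {s \<in> S'. t \<le> s}"
      by (rule card_mono) (use assms m in fastforce)+
    finally show ?thesis .
  qed (simp only: card.empty le0)
qed

text \<open>After each choice \<open>greedy_match\<close> discards the smaller elements of
  \<open>C\<close>, which \<open>parked\<close> keeps. They lie below \<open>d\<close>, hence below
  all later letters, and would never be taken.\<close>

lemma greedy_match_parked:
  "finite C \<Longrightarrow> sorted_wrt (<) ds \<Longrightarrow> dominates C (set ds) \<Longrightarrow>
    set (greedy_match C ds) = C - parked C (set ds) \<and> card (C - parked C (set ds)) = length ds"
proof (induction ds arbitrary: C)
  case (Cons d ds)
  let ?D = "set ds"
  obtain c where "c \<in> C" "d \<le> c"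
    using dominates_not_all_below[OF Cons.prems(3), of d] by auto
  then obtain b where b: "b \<in> C" "d \<le> b" "\<And>g. g \<in> C \<Longrightarrow> d \<le> g \<Longrightarrow> b \<le> g" "park d C = C - {b}"
    by (cases rule: park_cases[where F=C and d=d]) auto
  have least: "(LEAST b. b \<in> C \<and> d \<le> b) = b"
    by (rule Least_equality) (use b in auto)
  let ?C = "{c \<in> C. b < c}" and ?L = "{c \<in> C. c < b}"
  have L: "\<forall>l\<in>?L. \<forall>u\<in>?D. l < u"
  proof (intro ballI)
    fix l u assume "l \<in> ?L" "u \<in> ?D"
    then have "l < d" using b(3)[of l] by (cases "d \<le> l") auto
    then show "l < u" using \<open>u \<in> ?D\<close> Cons.prems(2) by auto
  qed
  have split: "C - {b} = ?C \<union> ?L" by auto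
  have "dominates (C - {b}) ?D"
    by (rule dominates_greedy[of _ d]) (use Cons.prems b in auto)
  then have "dominates ?C ?D"
    by (rule dominates_restrict) (use Cons.prems(1) L in auto)
  then have IH: "set (greedy_match ?C ds) = ?C - parked ?C ?D"
    "card (?C - parked ?C ?D) = length ds"
    using Cons.IH[of ?C] Cons.prems by auto
  have "d \<notin> ?D" using Cons.prems(2) by auto
  then have "parked C (insert d ?D) = parked (C - {b}) ?D"
    using b(4) by (simp add: parked_insert2)
  also have "\<dots> = parked ?C ?D \<union> ?L"
    unfolding split by (rule parked_below) (use L in auto)
  finally have P: "parked C (insert d ?D) = parked ?C ?D \<union> ?L" .
  have sub: "parked ?C ?D \<subseteq> ?C" by (rule parked_subset) simp
  have "C - parked C (insert d ?D) = insert b (?C - parked ?C ?D)"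
    unfolding P using sub b(1) by auto
  moreover have "b \<notin> ?C - parked ?C ?D" by auto
  moreover have "greedy_match C (d # ds) = b # greedy_match ?C ds"
    by (simp add: least Let_def)
  ultimately show ?case using IH Cons.prems(1) by simp
qed simp

lemma left_tri_parked:
  assumes "finite C" "finite D" "dominates C D"
  shows "left_tri C D = C - parked C D" "card (left_tri C D) = card D"
  using greedy_match_parked[of C "sorted_list_of_set D"] assms
  by (simp_all add: left_tri_def)

lemma left_tri_subset: "finite C \<Longrightarrow> finite D \<Longrightarrow> dominates C D \<Longrightarrow> left_tri C D \<subseteq> C"
  by (auto simp: left_tri_parked)

lemma parked_mono:
  assumes "finite D" "D' \<subseteq> D"
  shows "parked C D \<subseteq> parked C D'"
proof -
  have "parked C (D' \<union> (D - D')) = parked (parked C D') (D - D')"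
    using assms finite_subset by (intro parked_Un) auto
  moreover have "D' \<union> (D - D') = D" using assms by auto
  ultimately show ?thesis using parked_subset[of "D - D'" "parked C D'"] assms by simp
qed

lemma left_tri_mono:
  assumes "finite C" "finite D" "dominates C D" "D' \<subseteq> D"
  shows "left_tri C D' \<subseteq> left_tri C D"
proof -
  have "dominates C D'" "finite D'"
    using assms dominates_mono[of C D D' C] finite_subset by auto
  then show ?thesis using assms parked_mono[OF assms(2,4), of C] by (auto simp: left_tri_parked)
qed

lemma left_tri_insert_below:
  assumes "finite C" "finite D" "dominates C D" "\<forall>d\<in>D. y < d" "y \<notin> C"
  shows "left_tri (insert y C) D = left_tri C D"
proof -
  have "dominates (insert y C) D"
    using assms dominates_mono[of C D D "insert y C"] by auto
  moreover have "parked (C \<union> {y}) D = parked C D \<union> {y}"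
    by (rule parked_below) (use assms in auto)
  ultimately show ?thesis using assms by (auto simp: left_tri_parked)
qed

text \<open>As the order of parking is irrelevant, \<open>f\<close> may come last and takes the
  least free place that is at least \<open>f\<close>. The sizes of both sides show that there is
  one.\<close>

lemma left_tri_insert:
  assumes "finite C" "finite B" "dominates C (insert f B)" "f \<notin> B"
  obtains f' where "f' \<in> C - left_tri C B" "f \<le> f'" "left_tri C (insert f B) = insert f' (left_tri C B)"
    "\<And>g. g \<in> C - left_tri C B \<Longrightarrow> f \<le> g \<Longrightarrow> f' \<le> g"
proof -
  have dB: "dominates C B" using assms dominates_mono[of C "insert f B" B C] by auto
  note B = left_tri_parked[OF assms(1,2) dB]
  note fB = left_tri_parked[OF assms(1) _ assms(3)]
  have sub: "parked C B \<subseteq> C" using assms parked_subset by auto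
  have ins: "parked C (insert f B) = park f (parked C B)" using assms by (simp add: parked_insert)
  show ?thesis
  proof (cases rule: park_cases[where F="parked C B" and d=f])
    case none
    then have "left_tri C (insert f B) = left_tri C B" using ins B fB assms by simp
    then show ?thesis using B fB assms by simp
  next
    case (some f')
    have "C - (C - parked C B) = parked C B" using sub by auto
    then have C: "C - left_tri C B = parked C B" using B by simp
    have "left_tri C (insert f B) = insert f' (left_tri C B)"
      using ins some B fB assms sub by auto
    then show ?thesis using some C by (intro that[of f']) auto
  qed
qed

text \<open>\<open>B\<close> and \<open>B'\<close> will be consecutive left key columns,
  \<open>B\<close> being the later one: \<open>f\<close> is the least element that can be added to
  \<open>B\<close> inside \<open>B'\<close>.\<close>

definition adds_min :: "nat set \<Rightarrow> nat \<Rightarrow> nat set \<Rightarrow> bool" where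
  "adds_min B f B' \<longleftrightarrow> f \<notin> B \<and> insert f B \<subseteq> B' \<and> (\<forall>g\<in>B' - B. f \<le> g)"

text \<open>A place taken for \<open>B'\<close> but not for \<open>B\<close> is taken by the letters
  of \<open>B' - B\<close> parking after \<open>B\<close>. Some such letter lies at or below it, so
  the place is at least \<open>f\<close>, and \<open>f'\<close> is the least free place with this
  property.\<close>

lemma adds_min_left_tri:
  assumes "adds_min B f B'" "finite C" "finite B'" "dominates C B'"
  obtains f' where "adds_min (left_tri C B) f' (left_tri C B')"
    "left_tri C (insert f B) = insert f' (left_tri C B)"
proof -
  have f: "f \<notin> B" "insert f B \<subseteq> B'" "\<forall>g\<in>B' - B. f \<le> g" using assms(1) by (auto simp: adds_min_def)
  have fin: "finite B" using f assms finite_subset by auto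
  have "dominates C (insert f B)" using assms dominates_mono[of C B' "insert f B" C] f by auto
  from left_tri_insert[OF assms(2) fin this f(1)] obtain f' where
    f': "f' \<in> C - left_tri C B" "f \<le> f'" "left_tri C (insert f B) = insert f' (left_tri C B)"
      "\<And>g. g \<in> C - left_tri C B \<Longrightarrow> f \<le> g \<Longrightarrow> f' \<le> g" by blast
  have mono: "left_tri C (insert f B) \<subseteq> left_tri C B'"
    by (rule left_tri_mono) fact+
  have dB: "dominates C B" using assms dominates_mono[of C B' B C] f by auto
  have "f' \<le> g" if g: "g \<in> left_tri C B' - left_tri C B" for g
  proof -
    have gC: "g \<in> C - left_tri C B" using g left_tri_subset assms by blast
    have "g \<in> parked C B" "g \<notin> parked C B'"
      using g gC assms fin dB by (auto simp: left_tri_parked)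
    moreover have "parked C B' = parked (parked C B) (B' - B)"
      using parked_Un[of B "B' - B" C] fin assms f by (simp add: Un_absorb1)
    ultimately obtain g0 where "g0 \<in> B' - B" "g0 \<le> g"
      using parked_above[of "B' - B" g "parked C B"] assms by auto
    then have "f \<le> g" using f(3) order_trans by blast
    then show ?thesis using f' gC by blast
  qed
  then show ?thesis using f' mono that[of f'] by (auto simp: adds_min_def)
qed

section \<open>Iterated left products along a chain of columns\<close>

fun dom_chain :: "nat set list \<Rightarrow> bool" where
  "dom_chain [] = True"
| "dom_chain [C] = finite C"
| "dom_chain (C # D # Cs) = (finite C \<and> dominates C D \<and> dom_chain (D # Cs))"

lemma left_tri_list_Cons: "Cs \<noteq> [] \<Longrightarrow> left_tri_list (C # Cs) = left_tri C (left_tri_list Cs)"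
  by (cases Cs) auto

lemma dom_chain_Cons: "Cs \<noteq> [] \<Longrightarrow> dom_chain (C # Cs) \<longleftrightarrow> finite C \<and> dominates C (hd Cs) \<and> dom_chain Cs"
  by (cases Cs) auto

lemma dom_chain_left_tri_list:
  "dom_chain Cs \<Longrightarrow> Cs \<noteq> [] \<Longrightarrow> left_tri_list Cs \<subseteq> hd Cs \<and> finite (left_tri_list Cs) \<and>
    finite (hd Cs) \<and> card (left_tri_list Cs) = card (last Cs)"
proof (induction Cs rule: dom_chain.induct)
  case (3 C D Cs)
  then have IH: "left_tri_list (D # Cs) \<subseteq> D" "finite (left_tri_list (D # Cs))" "finite D"
    "card (left_tri_list (D # Cs)) = card (last (D # Cs))" by auto
  have "dominates C (left_tri_list (D # Cs))"
    using dominates_mono[of C D "left_tri_list (D # Cs)" C] IH 3 by auto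
  then show ?case using left_tri_parked[of C "left_tri_list (D # Cs)"] 3 IH
    by auto
qed auto

lemma dom_chain_dominates_left_tri_list:
  "dom_chain (C # Cs) \<Longrightarrow> Cs \<noteq> [] \<Longrightarrow> dominates C (left_tri_list Cs)"
  using dominates_mono[of C "hd Cs" "left_tri_list Cs" C] dom_chain_left_tri_list[of Cs]
  by (auto simp: dom_chain_Cons)

lemma dom_chain_butlast: "dom_chain (Cs @ [D]) \<Longrightarrow> dom_chain Cs"
  by (induction Cs rule: dom_chain.induct) auto

lemma left_tri_list_snoc_subset:
  "dom_chain (Cs @ [C, D]) \<Longrightarrow> left_tri_list (Cs @ [C, D]) \<subseteq> left_tri_list (Cs @ [C])"
proof (induction Cs)
  case Nil
  then show ?case by (auto dest: left_tri_subset)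
next
  case (Cons B Cs)
  have chain: "dom_chain (Cs @ [C, D])" "dom_chain (B # Cs @ [C])"
  proof -
    show "dom_chain (Cs @ [C, D])" using Cons.prems by (simp add: dom_chain_Cons)
    then have "dom_chain (Cs @ [C])" using dom_chain_butlast[of "Cs @ [C]" D] by simp
    then show "dom_chain (B # Cs @ [C])" using Cons.prems by (cases Cs) simp_all
  qed
  have "left_tri B (left_tri_list (Cs @ [C, D])) \<subseteq> left_tri B (left_tri_list (Cs @ [C]))"
  proof (rule left_tri_mono)
    have "dom_chain (Cs @ [C])" "finite B" using chain(2) by (simp_all add: dom_chain_Cons)
    then show "finite B" "finite (left_tri_list (Cs @ [C]))"
      using dom_chain_left_tri_list[of "Cs @ [C]"] by simp_all
    show "dominates B (left_tri_list (Cs @ [C]))"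
      by (rule dom_chain_dominates_left_tri_list[OF chain(2)]) simp
  qed (rule Cons.IH[OF chain(1)])
  then show ?case by (simp add: left_tri_list_Cons)
qed

text \<open>No element of the last column of \<open>Cs\<close> is below \<open>y\<close>, so
  \<open>y\<close> takes there the least free place without restriction. The columns further left
  preserve this by \<open>adds_min_left_tri\<close>.\<close>

lemma left_tri_list_snoc_insert:
  "dom_chain (Cs @ [insert y D]) \<Longrightarrow> dom_chain Cs \<Longrightarrow> Cs \<noteq> [] \<Longrightarrow> y \<notin> D \<Longrightarrow> \<forall>c\<in>last Cs. y \<le> c \<Longrightarrow>
    \<exists>f. adds_min (left_tri_list (Cs @ [D])) f (left_tri_list Cs) \<and>
      left_tri_list (Cs @ [insert y D]) = insert f (left_tri_list (Cs @ [D]))"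
proof (induction Cs)
  case (Cons C Cs)
  show ?case
  proof (cases "Cs = []")
    case True
    then have fin: "finite C" "finite D" "dominates C (insert y D)" using Cons.prems by auto
    obtain f' where
      f': "f' \<in> C - left_tri C D" "left_tri C (insert y D) = insert f' (left_tri C D)"
      "\<And>g. g \<in> C - left_tri C D \<Longrightarrow> y \<le> g \<Longrightarrow> f' \<le> g"
      by (rule left_tri_insert[OF fin Cons.prems(4)]) (rule that)
    have "left_tri C D \<subseteq> C"
      using fin dominates_mono[of C "insert y D" D C] by (intro left_tri_subset) auto
    moreover have "\<forall>g\<in>C - left_tri C D. f' \<le> g"
    proof
      fix g assume g: "g \<in> C - left_tri C D"
      have "y \<le> g" using Cons.prems(5) True g by simp
      then show "f' \<le> g" by (rule f'(3)[OF g])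
    qed
    ultimately have "adds_min (left_tri C D) f' C" using f'(1) by (simp add: adds_min_def)
    then show ?thesis using f'(2) True by auto
  next
    case False
    have chain: "dom_chain (Cs @ [insert y D])" "dom_chain Cs" "finite C"
      using Cons.prems(1,2) False by (simp_all add: dom_chain_Cons)
    have "\<forall>c\<in>last Cs. y \<le> c" using Cons.prems(5) False by simp
    from Cons.IH[OF chain(1,2) False Cons.prems(4) this] obtain f where
      f: "adds_min (left_tri_list (Cs @ [D])) f (left_tri_list Cs)"
      "left_tri_list (Cs @ [insert y D]) = insert f (left_tri_list (Cs @ [D]))" by blast
    have "finite (left_tri_list Cs)" using dom_chain_left_tri_list[OF chain(2) False] by blast
    from adds_min_left_tri[OF f(1) chain(3) this
        dom_chain_dominates_left_tri_list[OF Cons.prems(2) False]]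
    obtain f' where "adds_min (left_tri C (left_tri_list (Cs @ [D]))) f' (left_tri C (left_tri_list Cs))"
      "left_tri C (insert f (left_tri_list (Cs @ [D]))) = insert f' (left_tri C (left_tri_list (Cs @ [D])))"
      by blast
    then show ?thesis using False f(2) by (intro exI[of _ f']) (simp add: left_tri_list_Cons)
  qed
qed simp

text \<open>All letters arriving from the columns on the right exceed \<open>y\<close>, so
  \<open>y\<close> is never matched.\<close>

lemma left_tri_list_insert_below:
  assumes "dom_chain (D # Es)" "Es \<noteq> []" "\<forall>e\<in>hd Es. y < e" "y \<notin> D"
  shows "left_tri_list (Cs @ insert y D # Es) = left_tri_list (Cs @ D # Es)"
proof (induction Cs)
  case Nil
  have "left_tri_list Es \<subseteq> hd Es" "finite (left_tri_list Es)"
    using assms dom_chain_left_tri_list[of Es] by (auto simp: dom_chain_Cons)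
  moreover have "finite D" using assms by (simp add: dom_chain_Cons)
  ultimately have "left_tri (insert y D) (left_tri_list Es) = left_tri D (left_tri_list Es)"
    using assms dom_chain_dominates_left_tri_list[OF assms(1,2)]
    by (intro left_tri_insert_below) auto
  then show ?case using assms(2) by (simp add: left_tri_list_Cons)
qed (simp add: left_tri_list_Cons)

text \<open>Columns are indexed by all natural numbers, with empty sets beyond the tableau in the
  application. A newly opened column is then treated like one that has been lengthened.\<close>

definition lkey :: "(nat \<Rightarrow> nat set) \<Rightarrow> nat \<Rightarrow> nat set" where
  "lkey A k = left_tri_list (map A [0..<Suc k])"

lemma dom_chain_map:
  "(\<And>j. finite (A j)) \<Longrightarrow> (\<And>j. dominates (A j) (A (Suc j))) \<Longrightarrow> dom_chain (map A [i..<k])"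
proof (induction "k - i" arbitrary: i)
  case (Suc n)
  then have "i < k" by simp
  have "dom_chain (map A [Suc i..<k])" using Suc by simp
  then show ?case using Suc.prems \<open>i < k\<close>
    by (cases "Suc i < k") (auto simp: upt_rec[of i k] upt_rec[of "Suc i" k])
qed simp

locale dominance_chain =
  fixes A :: "nat \<Rightarrow> nat set"
  assumes finite_A: "finite (A j)" and dominates_A: "dominates (A j) (A (Suc j))"
begin

lemma chain: "dom_chain (map A [i..<k])"
  using finite_A dominates_A by (rule dom_chain_map)

lemma finite_lkey [simp]: "finite (lkey A k)"
  and card_lkey: "card (lkey A k) = card (A k)"
  and lkey_subset: "lkey A k \<subseteq> A 0"
  using dom_chain_left_tri_list[OF chain[of 0 "Suc k"]]
  by (auto simp: lkey_def hd_map simp del: upt_Suc) (auto simp: hd_append)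

lemma lkey_Suc_subset: "lkey A (Suc k) \<subseteq> lkey A k"
  using left_tri_list_snoc_subset[of "map A [0..<k]" "A k" "A (Suc k)"] chain[of 0 "Suc (Suc k)"]
  by (simp add: lkey_def)

end

lemma lkey_insert_unchanged:
  assumes "dominance_chain A" "y \<notin> A c" "\<forall>a\<in>A (Suc c). y < a" "j \<noteq> c"
  shows "lkey (A(c := insert y (A c))) j = lkey A j"
proof (cases "j < c")
  case True
  then have "map (A(c := insert y (A c))) [0..<Suc j] = map A [0..<Suc j]" by auto
  then show ?thesis unfolding lkey_def by metis
next
  case False
  then have "c < j" using assms(4) by simp
  then have split: "[0..<Suc j] = [0..<c] @ c # [Suc c..<Suc j]"
    by (metis less_Suc_eq_le nat_less_le upt_add_eq_append upt_conv_Cons le0 le_add_diff_inverse less_imp_le_nat)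
  have "left_tri_list (map A [0..<c] @ insert y (A c) # map A [Suc c..<Suc j]) =
    left_tri_list (map A [0..<c] @ A c # map A [Suc c..<Suc j])"
  proof (rule left_tri_list_insert_below)
    have "map A [c..<Suc j] = A c # map A [Suc c..<Suc j]"
      using \<open>c < j\<close> by (simp add: upt_conv_Cons del: upt_Suc)
    then show "dom_chain (A c # map A [Suc c..<Suc j])"
      using dominance_chain.chain[OF assms(1), of c "Suc j"] by simp
    show "\<forall>e\<in>hd (map A [Suc c..<Suc j]). y < e"
      using \<open>c < j\<close> assms(3) by (simp add: hd_map upt_conv_Cons del: upt_Suc)
  qed (use \<open>c < j\<close> assms in auto)
  moreover have "map (A(c := insert y (A c))) [0..<c] = map A [0..<c]"
    "map (A(c := insert y (A c))) [Suc c..<Suc j] = map A [Suc c..<Suc j]"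
    by (auto simp del: upt_Suc)
  ultimately show ?thesis unfolding lkey_def split by (simp del: upt_Suc)
qed

lemma lkey_insert:
  assumes "dominance_chain (A(c := insert y (A c)))" "dominance_chain A" "y \<notin> A c" "0 < c"
    "\<forall>a\<in>A (c - 1). y \<le> a"
  obtains f where "adds_min (lkey A c) f (lkey A (c - 1))"
    "lkey (A(c := insert y (A c))) c = insert f (lkey A c)"
proof -
  let ?A = "A(c := insert y (A c))"
  have map: "map ?A [0..<Suc c] = map A [0..<c] @ [insert y (A c)]"
    "map A [0..<Suc c] = map A [0..<c] @ [A c]" by auto
  have "[0..<c] = [0..<Suc (c - 1)]" using assms(4) by simp
  then have prev: "lkey A (c - 1) = left_tri_list (map A [0..<c])" by (simp add: lkey_def)
  have "dom_chain (map A [0..<c] @ [insert y (A c)])"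
    using dominance_chain.chain[OF assms(1), of 0 "Suc c"] map by simp
  moreover have "last (map A [0..<c]) = A (c - 1)" using assms(4) by (simp add: last_map)
  ultimately obtain f where "adds_min (left_tri_list (map A [0..<c] @ [A c])) f (left_tri_list (map A [0..<c]))"
      "left_tri_list (map A [0..<c] @ [insert y (A c)]) = insert f (left_tri_list (map A [0..<c] @ [A c]))"
    using left_tri_list_snoc_insert[of "map A [0..<c]" y "A c"]
      dominance_chain.chain[OF assms(2), of 0 c] assms(3-5) by auto
  moreover have "lkey ?A c = left_tri_list (map A [0..<c] @ [insert y (A c)])"
    "lkey A c = left_tri_list (map A [0..<c] @ [A c])" by (simp_all only: lkey_def map)
  ultimately show ?thesis using prev that by simp
qed

section \<open>Comparison of keys\<close>

text \<open>For sets of equal size this says that the \<open>r\<close>-th smallest element of \<open>A\<close> is at least that of \<open>B\<close>,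
  for every \<open>r\<close>.\<close>

definition exceeds :: "nat set \<Rightarrow> nat set \<Rightarrow> bool" where
  "exceeds A B \<longleftrightarrow> (\<forall>t. card {a \<in> A. a \<le> t} \<le> card {b \<in> B. b \<le> t})"

lemma exceeds_empty [simp]: "exceeds {} B"
  by (simp add: exceeds_def)

lemma exceeds_ge:
  assumes "exceeds A B" "a \<in> A" "finite A"
  obtains b where "b \<in> B" "b \<le> a"
proof -
  have "0 < card {u \<in> A. u \<le> a}" using assms by (auto simp: card_gt_0_iff)
  then have "0 < card {b \<in> B. b \<le> a}" using assms(1) unfolding exceeds_def by (meson less_le_trans)
  then have "{b \<in> B. b \<le> a} \<noteq> {}" by (metis card.empty less_irrefl)
  then show ?thesis using that by auto
qed

lemma card_insert_le_threshold:
  assumes "finite A" "e \<notin> A"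
  shows "card {a \<in> insert e A. a \<le> t} = (if e \<le> t then Suc (card {a \<in> A. a \<le> t}) else card {a \<in> A. a \<le> (t::nat)})"
proof (cases "e \<le> t")
  case True
  then have "{a \<in> insert e A. a \<le> t} = insert e {a \<in> A. a \<le> t}" by auto
  then show ?thesis using True assms by simp
next
  case False
  then have "{a \<in> insert e A. a \<le> t} = {a \<in> A. a \<le> t}" by auto
  then show ?thesis using False by simp
qed

text \<open>For \<open>t \<ge> f\<close> the right count grows too. For \<open>t < f\<close> the
  left count is bounded through \<open>A'\<close>, and up to \<open>t\<close> the set
  \<open>B'\<close> has nothing beyond \<open>B\<close>.\<close>

lemma exceeds_insert:
  assumes "exceeds A B" "exceeds A' B'" "insert e A \<subseteq> A'" "e \<notin> A" "adds_min B f B'"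
    "finite A'" "finite B'"
  shows "exceeds (insert e A) (insert f B)"
  unfolding exceeds_def
proof
  fix t
  have B: "f \<notin> B" "insert f B \<subseteq> B'" "\<forall>g\<in>B' - B. f \<le> g" using assms(5) by (auto simp: adds_min_def)
  have fin: "finite A" "finite B" using assms B finite_subset by auto
  show "card {a \<in> insert e A. a \<le> t} \<le> card {b \<in> insert f B. b \<le> t}"
  proof (cases "f \<le> t")
    case True
    then show ?thesis using assms(1)
      unfolding card_insert_le_threshold[OF fin(1) assms(4)] card_insert_le_threshold[OF fin(2) B(1)]
      by (simp add: exceeds_def le_SucI)
  next
    case False
    have "card {a \<in> insert e A. a \<le> t} \<le> card {a \<in> A'. a \<le> t}"
      by (rule card_mono) (use assms in auto)
    also have "\<dots> \<le> card {b \<in> B'. b \<le> t}" using assms(2) by (simp add: exceeds_def)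
    also have "{b \<in> B'. b \<le> t} = {b \<in> B. b \<le> t}"
    proof -
      have "b \<in> B" if "b \<in> B'" "b \<le> t" for b using B(3)[rule_format, of b] False that by auto
      then show ?thesis using B(2) by auto
    qed
    finally show ?thesis using False
      unfolding card_insert_le_threshold[OF fin(2) B(1)] by simp
  qed
qed

text \<open>The first column has no predecessor. There \<open>y \<le> e\<close> and the minimality
  of \<open>y\<close> suffice, since below \<open>y\<close> both counts vanish.\<close>

lemma exceeds_insert_least:
  assumes "exceeds A B" "finite A" "finite B" "e \<notin> A" "y \<notin> B" "y \<le> e" "\<forall>b\<in>B. y \<le> b"
  shows "exceeds (insert e A) (insert y B)"
  unfolding exceeds_def
proof
  fix t
  show "card {a \<in> insert e A. a \<le> t} \<le> card {b \<in> insert y B. b \<le> t}"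
  proof (cases "y \<le> t")
    case True
    then show ?thesis using assms(1)
      unfolding card_insert_le_threshold[OF assms(2,4)] card_insert_le_threshold[OF assms(3,5)]
      by (simp add: exceeds_def le_SucI)
  next
    case False
    have "card {a \<in> A. a \<le> t} \<le> card {b \<in> B. b \<le> t}" using assms(1) by (simp add: exceeds_def)
    also have "{b \<in> B. b \<le> t} = {}" using assms(7) False by force
    finally have "card {a \<in> A. a \<le> t} = 0" by (simp only: card.empty le_zero_eq)
    moreover have "\<not> e \<le> t" using False assms(6) by simp
    ultimately show ?thesis
      unfolding card_insert_le_threshold[OF assms(2,4)] by (simp only: if_False le0)
  qed
qed

text \<open>For \<open>t \<ge> e\<close> the left count drops by one and the right count by at most
  one. For \<open>t < e\<close> all elements of \<open>A\<close> up to \<open>t\<close> lie in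
  \<open>A''\<close>, and \<open>B''\<close> is part of \<open>B\<close>.\<close>

lemma exceeds_remove:
  assumes "exceeds (insert e A) (insert f B)" "exceeds A'' B''" "e \<notin> A" "f \<notin> B"
    "\<forall>g\<in>A - A''. e < g" "B'' \<subseteq> B" "finite A" "finite B" "finite A''"
  shows "exceeds A B"
  unfolding exceeds_def
proof
  fix t
  have le: "card {a \<in> insert e A. a \<le> t} \<le> card {b \<in> insert f B. b \<le> t}"
    using assms(1) by (simp add: exceeds_def)
  show "card {a \<in> A. a \<le> t} \<le> card {b \<in> B. b \<le> t}"
  proof (cases "e \<le> t")
    case True
    then show ?thesis using le
      unfolding card_insert_le_threshold[OF assms(7,3)] card_insert_le_threshold[OF assms(8,4)]
      by (simp split: if_splits)
  next
    case False
    have "card {a \<in> A. a \<le> t} \<le> card {a \<in> A''. a \<le> t}"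
    proof (rule card_mono)
      show "{a \<in> A. a \<le> t} \<subseteq> {a \<in> A''. a \<le> t}"
      proof
        fix a assume "a \<in> {a \<in> A. a \<le> t}"
        then show "a \<in> {a \<in> A''. a \<le> t}" using False assms(5)[rule_format, of a] by auto
      qed
    qed (use assms in simp)
    also have "\<dots> \<le> card {b \<in> B''. b \<le> t}" using assms(2) by (simp add: exceeds_def)
    also have "\<dots> \<le> card {b \<in> B. b \<le> t}"
      by (rule card_mono) (use assms in auto)
    finally show ?thesis .
  qed
qed

section \<open>From entrywise comparison to counting\<close>

lemma sorted_nth_le_iff_exceeds:
  assumes "finite A" "finite B" "card A = card B"
  shows "(\<forall>r < card A. sorted_list_of_set B ! r \<le> sorted_list_of_set A ! r) \<longleftrightarrow> exceeds A B"
proof -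
  let ?a = "sorted_list_of_set A" and ?b = "sorted_list_of_set B" and ?n = "card A"
  have count: "card {x \<in> X. x \<le> t} = card {r. r < card X \<and> sorted_list_of_set X ! r \<le> t}"
    if "finite X" for X :: "nat set" and t
  proof -
    let ?l = "sorted_list_of_set X"
    have "{x \<in> X. x \<le> t} = (!) ?l ` {r. r < card X \<and> ?l ! r \<le> t}"
    proof -
      have "x \<in> X \<longleftrightarrow> (\<exists>r < card X. ?l ! r = x)" for x
        using that in_set_conv_nth[of x ?l] by simp
      then show ?thesis by auto
    qed
    moreover have "inj_on ((!) ?l) {r. r < card X \<and> ?l ! r \<le> t}"
      by (auto simp: inj_on_def nth_eq_iff_index_eq)
    ultimately show ?thesis by (simp add: card_image)
  qed
  show ?thesis
  proof
    assume le: "\<forall>r < ?n. ?b ! r \<le> ?a ! r"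
    show "exceeds A B"
      unfolding exceeds_def count[OF assms(1)] count[OF assms(2)]
      by (intro allI card_mono) (use le assms in \<open>auto intro: order_trans\<close>)
  next
    assume ex: "exceeds A B"
    show "\<forall>r < ?n. ?b ! r \<le> ?a ! r"
    proof (intro allI impI, rule ccontr)
      fix r assume r: "r < ?n" "\<not> ?b ! r \<le> ?a ! r"
      let ?t = "?a ! r"
      \<comment> \<open>Up to the threshold \<open>?a ! r\<close> the set \<open>A\<close> has at
        least \<open>r + 1\<close> elements, but \<open>B\<close> has at most
        \<open>r\<close>.\<close>
      have "Suc r = card {..r}" by simp
      also have "\<dots> \<le> card {r'. r' < ?n \<and> ?a ! r' \<le> ?t}"
        by (rule card_mono) (use r in \<open>auto intro!: sorted_nth_mono\<close>)
      also have "\<dots> \<le> card {r'. r' < card B \<and> ?b ! r' \<le> ?t}"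
        using ex unfolding exceeds_def count[OF assms(1)] count[OF assms(2)] by blast
      also have "\<dots> \<le> card {..<r}"
      proof (rule card_mono)
        show "{r'. r' < card B \<and> ?b ! r' \<le> ?t} \<subseteq> {..<r}"
        proof
          fix r' assume r': "r' \<in> {r'. r' < card B \<and> ?b ! r' \<le> ?t}"
          show "r' \<in> {..<r}"
          proof (rule ccontr)
            assume "r' \<notin> {..<r}"
            then have "?b ! r \<le> ?b ! r'" using r' by (intro sorted_nth_mono) auto
            then show False using r r' by simp
          qed
        qed
      qed simp
      finally show False by simp
    qed
  qed
qed

lemma length_column_of_set [simp]: "length (column_of_set A) = card A"
  by (simp add: column_of_set_def)

lemma column_of_set_le_iff_exceeds:
  assumes "finite A" "finite B" "card A = card B"
  shows "(\<forall>r < card A. column_of_set B ! r \<le> column_of_set A ! r) \<longleftrightarrow> exceeds A B"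
proof -
  have *: "column_of_set X ! r = sorted_list_of_set X ! (card X - Suc r)" if "r < card X" for X r
    using that by (simp add: column_of_set_def rev_nth)
  have "(\<forall>r < card A. column_of_set B ! r \<le> column_of_set A ! r) \<longleftrightarrow>
    (\<forall>r < card A. sorted_list_of_set B ! r \<le> sorted_list_of_set A ! r)" (is "?l \<longleftrightarrow> ?r")
  proof
    assume ?l
    show ?r
    proof (intro allI impI)
      fix r assume "r < card A"
      then have "card A - Suc r < card A" "card A - Suc (card A - Suc r) = r" by auto
      then show "sorted_list_of_set B ! r \<le> sorted_list_of_set A ! r"
        using \<open>?l\<close> *[of "card A - Suc r" A] *[of "card A - Suc r" B] assms(3) by metis
    qed
  qed (use * assms(3) in simp)
  then show ?thesis using sorted_nth_le_iff_exceeds[OF assms] by simp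
qed

section \<open>Columns of maxima in a set-valued tableau\<close>

definition max_column :: "nat set list list \<Rightarrow> nat \<Rightarrow> nat set" where
  "max_column Q k = Max ` set (column Q k)"

lemma set_column_max_tableau: "set (column (max_tableau Q) k) = max_column Q k"
  by (cases "k < length Q") (simp_all add: max_column_def max_tableau_def column_def)

lemma boxes_shape: "(r, c) \<in> boxes T \<longleftrightarrow> c < length (shape T) \<and> r < shape T ! c"
  by (auto simp: boxes_def shape_def)

lemma boxes_cong: "shape S = shape T \<Longrightarrow> boxes S = boxes T"
  by (auto simp: boxes_shape)

lemma boxes_left: "partition_shape T \<Longrightarrow> (r, Suc c) \<in> boxes T \<Longrightarrow> (r, c) \<in> boxes T"
  unfolding partition_shape_iff boxes_def
  by (auto intro: less_le_trans)

lemma boxes_above: "(Suc r, c) \<in> boxes T \<Longrightarrow> (r, c) \<in> boxes T"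
  by (auto simp: boxes_def)

text \<open>Quantifying over entries instead of taking \<open>Max\<close> and \<open>Min\<close>
  makes the row and column conditions pass to smaller boxes, which is what the removal of a letter
  needs.\<close>

lemma rsvt_iff:
  "rsvt T \<longleftrightarrow> partition_shape T \<and>
     (\<forall>(r, c) \<in> boxes T. finite (T ! c ! r) \<and> T ! c ! r \<noteq> {} \<and> (\<forall>n \<in> T ! c ! r. 0 < n)) \<and>
     (\<forall>r c. (r, Suc c) \<in> boxes T \<longrightarrow> (\<forall>m \<in> T ! Suc c ! r. \<forall>n \<in> T ! c ! r. m \<le> n)) \<and>
     (\<forall>r c. (Suc r, c) \<in> boxes T \<longrightarrow> (\<forall>m \<in> T ! c ! Suc r. \<forall>n \<in> T ! c ! r. m < n))"
  (is "_ \<longleftrightarrow> ?p \<and> ?f \<and> ?row \<and> ?col")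
proof -
  have "(\<forall>r c. (r, Suc c) \<in> boxes T \<longrightarrow> Max (T ! Suc c ! r) \<le> Min (T ! c ! r)) \<longleftrightarrow> ?row"
    "(\<forall>r c. (Suc r, c) \<in> boxes T \<longrightarrow> Max (T ! c ! Suc r) < Min (T ! c ! r)) \<longleftrightarrow> ?col"
    if p: ?p and f: ?f
  proof -
    have fin: "finite (T ! c ! r)" "T ! c ! r \<noteq> {}" if "(r, c) \<in> boxes T" for r c
      using f that by auto
    have row: "Max (T ! Suc c ! r) \<le> Min (T ! c ! r) \<longleftrightarrow>
        (\<forall>m \<in> T ! Suc c ! r. \<forall>n \<in> T ! c ! r. m \<le> n)" if "(r, Suc c) \<in> boxes T" for r c
      using fin[OF that] fin[OF boxes_left[OF p that]] by auto
    have col: "Max (T ! c ! Suc r) < Min (T ! c ! r) \<longleftrightarrow>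
        (\<forall>m \<in> T ! c ! Suc r. \<forall>n \<in> T ! c ! r. m < n)" if "(Suc r, c) \<in> boxes T" for r c
      using fin[OF that] fin[OF boxes_above[OF that]] by auto
    show "(\<forall>r c. (r, Suc c) \<in> boxes T \<longrightarrow> Max (T ! Suc c ! r) \<le> Min (T ! c ! r)) \<longleftrightarrow> ?row"
      by (simp only: row cong: imp_cong)
    show "(\<forall>r c. (Suc r, c) \<in> boxes T \<longrightarrow> Max (T ! c ! Suc r) < Min (T ! c ! r)) \<longleftrightarrow> ?col"
      by (simp only: col cong: imp_cong)
  qed
  note eqs = this
  show ?thesis unfolding rsvt_def by (intro conj_cong refl eqs)
qed

lemma mem_max_column:
  assumes "rsvt Q" "a \<in> max_column Q k"
  obtains r where "(r, k) \<in> boxes Q" "a \<in> Q ! k ! r"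
proof -
  obtain r where r: "k < length Q" "r < length (Q ! k)" "a = Max (Q ! k ! r)"
    using assms(2) by (auto simp: max_column_def column_def in_set_conv_nth split: if_splits)
  then have box: "(r, k) \<in> boxes Q" by (simp add: boxes_def)
  then have "finite (Q ! k ! r) \<and> Q ! k ! r \<noteq> {}" using assms(1) by (auto simp: rsvt_def)
  then have "a \<in> Q ! k ! r" using r(3) by simp
  then show ?thesis using box that by blast
qed

lemma rsvt_max_column:
  assumes "rsvt Q"
  shows "dominance_chain (max_column Q)" "card (max_column Q k) = length (column Q k)"
proof -
  have fin: "finite (Q ! c ! r)" "Q ! c ! r \<noteq> {}" if "(r, c) \<in> boxes Q" for r c
    using assms that by (auto simp: rsvt_def)
  have distinct: "distinct (map Max (column Q k))" for k
  proof (cases "k < length Q")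
    case True
    have "sorted_wrt (>) (map Max (Q ! k))"
    proof (subst sorted_wrt_iff_nth_Suc_transp)
      show "\<forall>i. Suc i < length (map Max (Q ! k)) \<longrightarrow> map Max (Q ! k) ! Suc i < map Max (Q ! k) ! i"
      proof (intro allI impI)
        fix i assume i: "Suc i < length (map Max (Q ! k))"
        then have "(Suc i, k) \<in> boxes Q" using True by (simp add: boxes_def)
        then have "Max (Q ! k ! Suc i) \<in> Q ! k ! Suc i" "Max (Q ! k ! i) \<in> Q ! k ! i"
          "\<forall>m \<in> Q ! k ! Suc i. \<forall>n \<in> Q ! k ! i. m < n"
          using fin boxes_above[of i k Q] assms by (auto simp: rsvt_iff)
        then show "map Max (Q ! k) ! Suc i < map Max (Q ! k) ! i" using i by simp
      qed
    qed (auto simp: transp_def)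
    then show ?thesis using True by (auto simp: column_def distinct_conv_nth sorted_wrt_iff_nth_less)
      (metis less_irrefl linorder_neqE_nat)
  qed (simp add: column_def)
  show "card (max_column Q k) = length (column Q k)"
    using distinct_card[OF distinct[of k]] by (simp add: max_column_def)
  have mc: "max_column Q k = set (map Max (column Q k))" for k by (simp add: max_column_def)
  show "dominance_chain (max_column Q)"
  proof
    fix j
    show "finite (max_column Q j)" by (simp add: max_column_def)
    show "dominates (max_column Q j) (max_column Q (Suc j))"
      unfolding mc
    proof (rule dominates_nth)
      fix r assume "r < length (map Max (column Q (Suc j)))"
      then have box: "(r, Suc j) \<in> boxes Q" by (auto simp: boxes_def column_def split: if_splits)
      then have left: "(r, j) \<in> boxes Q" using assms boxes_left by (auto simp: rsvt_def)
      then have "Max (Q ! Suc j ! r) \<in> Q ! Suc j ! r" "Max (Q ! j ! r) \<in> Q ! j ! r"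
        "\<forall>m \<in> Q ! Suc j ! r. \<forall>n \<in> Q ! j ! r. m \<le> n"
        using fin box assms by (auto simp: rsvt_iff)
      then show "r < length (map Max (column Q j)) \<and>
        map Max (column Q (Suc j)) ! r \<le> map Max (column Q j) ! r"
        using left box by (auto simp: boxes_def column_def)
    qed (rule distinct)+
  qed
qed

definition key_cond :: "nat list list \<Rightarrow> nat set list list \<Rightarrow> bool" where
  "key_cond P Q \<longleftrightarrow> (\<forall>k. exceeds (rkey P k) (lkey (max_column Q) k))"

lemma key_ge_iff_key_cond:
  assumes "shape P = shape Q" "dtab P" "rsvt Q"
  shows "key_ge (right_key P) (left_key (max_tableau Q)) \<longleftrightarrow> key_cond P Q"
proof -
  interpret dominance_chain "max_column Q" using rsvt_max_column(1)[OF assms(3)] .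
  have len: "length P = length Q" using assms(1) by (metis length_shape)
  have col: "length (column P k) = length (column Q k)" for k
    using assms(1) len by (simp add: length_column_shape)
  have card: "card (rkey P k) = length (column P k)" "card (lkey (max_column Q) k) = length (column P k)" for k
    using assms card_lkey rsvt_max_column(2) col by (simp_all add: card_rkey)
  have right: "right_key P ! k = column_of_set (rkey P k)" if "k < length P" for k
    using that by (simp add: right_key_def rkey_def)
  have left: "left_key (max_tableau Q) ! k = column_of_set (lkey (max_column Q) k)" if "k < length P" for k
  proof -
    have "take (Suc k) (max_tableau Q) = map (column (max_tableau Q)) [0..<Suc k]"
      using that len by (intro nth_equalityI) (auto simp: max_tableau_def column_def nth_append less_Suc_eq)
    then have "map set (take (Suc k) (max_tableau Q)) = map (max_column Q) [0..<Suc k]"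
      by (simp add: set_column_max_tableau)
    then show ?thesis using that len
      by (simp add: left_key_def lkey_def max_tableau_def del: upt_Suc)
  qed
  have lens: "length (right_key P) = length P" "length (left_key (max_tableau Q)) = length P"
    by (simp_all add: right_key_def left_key_def max_tableau_def len)
  have "shape (right_key P) = shape (left_key (max_tableau Q))"
    by (rule nth_equalityI) (simp_all add: shape_def lens right left card)
  then have "key_ge (right_key P) (left_key (max_tableau Q)) \<longleftrightarrow>
    (\<forall>k < length P. \<forall>r < card (rkey P k).
      column_of_set (lkey (max_column Q) k) ! r \<le> column_of_set (rkey P k) ! r)"
    by (auto simp: key_ge_def boxes_def lens right left)
  also have "\<dots> \<longleftrightarrow> (\<forall>k < length P. exceeds (rkey P k) (lkey (max_column Q) k))"
  proof -
    have "(\<forall>r < card (rkey P k). column_of_set (lkey (max_column Q) k) ! r \<le> column_of_set (rkey P k) ! r)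
      \<longleftrightarrow> exceeds (rkey P k) (lkey (max_column Q) k)" for k
      by (rule column_of_set_le_iff_exceeds) (simp_all add: card)
    then show ?thesis by simp
  qed
  also have "\<dots> \<longleftrightarrow> key_cond P Q"
  proof -
    have "rkey P k = {}" if "\<not> k < length P" for k using that by (simp add: rkey_def)
    then show ?thesis unfolding key_cond_def by (metis exceeds_empty)
  qed
  finally show ?thesis .
qed

section \<open>Recording tableaux\<close>

definition place :: "nat set list list \<Rightarrow> nat \<Rightarrow> nat \<Rightarrow> nat \<Rightarrow> nat \<Rightarrow> nat set list list" where
  "place Q r c \<alpha> y = (if \<alpha> = 1 then append_entry Q c {y} else add_to_box Q (r, c) y)"

text \<open>If removing a corner empties a column, that column is the last one of a partition shape;
  hence \<open>butlast Q\<close>.\<close>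

definition take_off :: "nat set list list \<Rightarrow> nat \<Rightarrow> nat \<Rightarrow> nat \<Rightarrow> nat \<Rightarrow> nat set list list" where
  "take_off Q r c \<alpha> y =
    (if \<alpha> = 1 then if butlast (Q ! c) = [] then butlast Q else Q[c := butlast (Q ! c)]
     else Q[c := (Q ! c)[r := Q ! c ! r - {y}]])"

text \<open>This is what \<open>Q\<close> must satisfy for \<open>y\<close> to be recorded in column \<open>c\<close>.\<close>

definition low :: "nat \<Rightarrow> nat \<Rightarrow> nat set list list \<Rightarrow> bool" where
  "low y c Q \<longleftrightarrow> (\<forall>(r, k) \<in> boxes Q. \<forall>n \<in> Q ! k ! r. y \<le> n \<and> (n = y \<longrightarrow> k < c))"

lemma lowD:
  assumes "low y c Q" "(r, k) \<in> boxes Q" "n \<in> Q ! k ! r"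
  shows "y \<le> n" "n = y \<Longrightarrow> k < c"
  using assms by (auto simp: low_def)

definition tpair :: "nat list list \<Rightarrow> nat set list list \<Rightarrow> bool" where
  "tpair P Q \<longleftrightarrow> shape P = shape Q \<and> dtab P \<and> rsvt Q"

definition extension :: "nat list list \<Rightarrow> nat \<Rightarrow> nat list list \<Rightarrow> nat \<Rightarrow> nat \<Rightarrow> nat \<Rightarrow> bool" where
  "extension P' x P r c \<alpha> \<longleftrightarrow> dtab P' \<and> 0 < x \<and> ins x P' = (P, (r, c), \<alpha>)"

lemma insert_step_eq_place:
  "extension P' x P r c \<alpha> \<Longrightarrow> insert_step (P', Q') (x, y) = (P, place Q' r c \<alpha> y)"
  by (simp add: insert_step_def extension_def hecke_insert_eq_ins place_def)

lemma length_eq_of_shape: "shape P = shape Q \<Longrightarrow> length P = length Q"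
  by (metis length_shape)

lemma length_nth_of_shape: "shape P = shape Q \<Longrightarrow> k < length P \<Longrightarrow> length (P ! k) = length (Q ! k)"
  unfolding shape_def by (metis length_map nth_map)

text \<open>Enlarging a box, lengthening a column and opening a column are three different list
  operations; this gives them one description by boxes and entries.\<close>

lemma place_props:
  assumes "tpair P' Q'" "extension P' x P r c \<alpha>"
  shows "shape (place Q' r c \<alpha> y) = shape P"
    and "boxes (place Q' r c \<alpha> y) = insert (r, c) (boxes Q')"
    and "(r', k) \<in> boxes Q' \<Longrightarrow> (r', k) \<noteq> (r, c) \<Longrightarrow> place Q' r c \<alpha> y ! k ! r' = Q' ! k ! r'"
    and "\<alpha> = 0 \<and> (r, c) \<in> boxes Q' \<and> place Q' r c \<alpha> y ! c ! r = insert y (Q' ! c ! r) \<or>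
      \<alpha> = 1 \<and> (r, c) \<notin> boxes Q' \<and> place Q' r c \<alpha> y ! c ! r = {y}"
proof -
  have len: "length P' = length Q'" "k < length P' \<Longrightarrow> length (P' ! k) = length (Q' ! k)" for k
    using assms(1) length_eq_of_shape length_nth_of_shape by (auto simp: tpair_def)
  have sh: "shape P' = shape Q'" using assms(1) by (simp add: tpair_def)
  have "dtab P'" "0 < x" "ins x P' = (P, (r, c), \<alpha>)" using assms(2) by (auto simp: extension_def)
  note corner = ins_corner[OF this]
  consider (zero) "\<alpha> = 0" "shape P = shape P'" "c < length P'" "Suc r = length (P' ! c)"
    | (old) "\<alpha> = 1" "c < length P'" "r = length (P' ! c)" "shape P = (shape P')[c := Suc r]"
    | (new) "\<alpha> = 1" "c = length P'" "r = 0" "shape P = shape P' @ [1]"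
  proof -
    have "shape P = shape P' \<Longrightarrow> c < length P' \<and> length (P ! c) = length (P' ! c)"
      using corner length_eq_of_shape length_nth_of_shape by metis
    then show ?thesis using corner that by (auto simp: column_def)
  qed
  then have all: "shape (place Q' r c \<alpha> y) = shape P \<and>
    boxes (place Q' r c \<alpha> y) = insert (r, c) (boxes Q') \<and>
    (\<forall>r' k. (r', k) \<in> boxes Q' \<longrightarrow> (r', k) \<noteq> (r, c) \<longrightarrow> place Q' r c \<alpha> y ! k ! r' = Q' ! k ! r') \<and>
    (\<alpha> = 0 \<and> (r, c) \<in> boxes Q' \<and> place Q' r c \<alpha> y ! c ! r = insert y (Q' ! c ! r) \<or>
      \<alpha> = 1 \<and> (r, c) \<notin> boxes Q' \<and> place Q' r c \<alpha> y ! c ! r = {y})"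
  proof cases
    case zero
    have place: "place Q' r c \<alpha> y = Q'[c := (Q' ! c)[r := insert y (Q' ! c ! r)]]"
      using zero by (simp add: place_def add_to_box_def)
    have c: "c < length Q'" "r < length (Q' ! c)" using zero len by auto
    have shape: "shape (place Q' r c \<alpha> y) = shape Q'"
      unfolding place shape_def by (simp add: map_update list_update_same_conv c)
    then have "boxes (place Q' r c \<alpha> y) = insert (r, c) (boxes Q')"
      using c by (subst boxes_cong) (auto simp: boxes_def)
    then show ?thesis using zero c sh shape unfolding place
      by (auto simp: boxes_def nth_list_update)
  next
    case old
    have place: "place Q' r c \<alpha> y = Q'[c := Q' ! c @ [{y}]]"
      using old len by (simp add: place_def append_entry_def set_column_def column_def)
    have c: "c < length Q'" "r = length (Q' ! c)" using old len by auto
    have "shape (place Q' r c \<alpha> y) = shape P"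
      unfolding place using old(4) sh c by (simp add: shape_def map_update)
    moreover have "boxes (place Q' r c \<alpha> y) = insert (r, c) (boxes Q')"
      unfolding place boxes_def using c by (auto simp: nth_list_update split: if_splits)
    ultimately show ?thesis unfolding place using old(1) c
      by (auto simp: boxes_def nth_list_update nth_append)
  next
    case new
    have place: "place Q' r c \<alpha> y = Q' @ [[{y}]]"
      using new len by (simp add: place_def append_entry_def set_column_def column_def)
    have c: "c = length Q'" using new len by auto
    have "shape (place Q' r c \<alpha> y) = shape P"
      unfolding place using new(4) sh c by (simp add: shape_def)
    moreover have "boxes (place Q' r c \<alpha> y) = insert (r, c) (boxes Q')"
      unfolding place boxes_def using c new(3) by (auto simp: nth_append less_Suc_eq split: if_splits)
    ultimately show ?thesis unfolding place using new(1,3) c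
      by (auto simp: boxes_def nth_append)
  qed
  then show "shape (place Q' r c \<alpha> y) = shape P"
    "boxes (place Q' r c \<alpha> y) = insert (r, c) (boxes Q')"
    "(r', k) \<in> boxes Q' \<Longrightarrow> (r', k) \<noteq> (r, c) \<Longrightarrow> place Q' r c \<alpha> y ! k ! r' = Q' ! k ! r'"
    "\<alpha> = 0 \<and> (r, c) \<in> boxes Q' \<and> place Q' r c \<alpha> y ! c ! r = insert y (Q' ! c ! r) \<or>
      \<alpha> = 1 \<and> (r, c) \<notin> boxes Q' \<and> place Q' r c \<alpha> y ! c ! r = {y}"
    by blast+
qed

lemma extension_corner:
  assumes "extension P' x P r c \<alpha>"
  shows "(r, c) \<in> boxes P" "(r, Suc c) \<notin> boxes P" "(Suc r, c) \<notin> boxes P" "r = length (P ! c) - 1"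
proof -
  have "dtab P'" "0 < x" "ins x P' = (P, (r, c), \<alpha>)" using assms by (auto simp: extension_def)
  note corner = ins_corner[OF this]
  then show "(r, c) \<in> boxes P" "(r, Suc c) \<notin> boxes P" "(Suc r, c) \<notin> boxes P" "r = length (P ! c) - 1"
    by (auto simp: boxes_def column_def)
qed

lemma place_entries:
  assumes "tpair P' Q'" "extension P' x P r c \<alpha>" "(r', k) \<in> boxes (place Q' r c \<alpha> y)"
    "n \<in> place Q' r c \<alpha> y ! k ! r'"
  shows "n = y \<and> (r', k) = (r, c) \<or> (r', k) \<in> boxes Q' \<and> n \<in> Q' ! k ! r'"
  using place_props(2-4)[OF assms(1,2), where y=y] assms(3,4)
  by (cases "(r', k) = (r, c)") auto

lemma place_entry_old:
  assumes "tpair P' Q'" "extension P' x P r c \<alpha>" "(r', k) \<in> boxes Q'" "n \<in> Q' ! k ! r'"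
  shows "(r', k) \<in> boxes (place Q' r c \<alpha> y) \<and> n \<in> place Q' r c \<alpha> y ! k ! r'"
  using place_props(2-4)[OF assms(1,2), where y=y] assms(3,4)
  by (cases "(r', k) = (r, c)") auto

lemma place_entry_new:
  assumes "tpair P' Q'" "extension P' x P r c \<alpha>"
  shows "(r, c) \<in> boxes (place Q' r c \<alpha> y) \<and> y \<in> place Q' r c \<alpha> y ! c ! r"
  using place_props(2,4)[OF assms, where y=y] by auto

text \<open>The box is a corner, so \<open>y\<close> has to be compared only with the boxes to its
  left and above it. There \<open>low\<close> gives \<open>y \<le> n\<close> and excludes equality
  within the same column.\<close>

lemma tpair_place:
  assumes "tpair P' Q'" "extension P' x P r c \<alpha>" "low y c Q'" "0 < y"
  shows "tpair P (place Q' r c \<alpha> y)"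
proof -
  let ?Q = "place Q' r c \<alpha> y"
  note props = place_props[OF assms(1,2), where y=y]
  note entries = place_entries[OF assms(1,2)]
  have Q': "rsvt Q'" using assms(1) by (simp add: tpair_def)
  have P: "dtab P" using assms(2) dtab_ins by (auto simp: extension_def)
  have boxesP: "boxes P = boxes ?Q" using boxes_cong[OF props(1)] by simp
  note corner = extension_corner[OF assms(2), unfolded boxesP]
  note lowD = lowD[OF assms(3)]
  have part: "partition_shape ?Q"
    using P props(1) by (simp add: partition_shape_def flip: decreasing_tableau_iff_dtab)
      (simp add: decreasing_tableau_def partition_shape_def)
  have "rsvt ?Q"
    unfolding rsvt_iff
  proof (intro conjI)
    show "partition_shape ?Q" by (rule part)
    show "\<forall>(r', k)\<in>boxes ?Q. finite (?Q ! k ! r') \<and> ?Q ! k ! r' \<noteq> {} \<and> (\<forall>n\<in>?Q ! k ! r'. 0 < n)"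
    proof (intro ballI, clarify)
      fix r' k assume box: "(r', k) \<in> boxes ?Q"
      have old: "finite (Q' ! k ! r')" "Q' ! k ! r' \<noteq> {}" "\<forall>n\<in>Q' ! k ! r'. 0 < n"
        if "(r', k) \<in> boxes Q'" using Q' that by (auto simp: rsvt_iff)
      show "finite (?Q ! k ! r') \<and> ?Q ! k ! r' \<noteq> {} \<and> (\<forall>n\<in>?Q ! k ! r'. 0 < n)"
      proof (cases "(r', k) = (r, c)")
        case True
        then show ?thesis using props(4) old assms(4) by auto
      next
        case False
        then have "(r', k) \<in> boxes Q'" using box props(2) by auto
        then show ?thesis using old props(3)[OF _ False] by simp
      qed
    qed
    show "\<forall>r' k. (r', Suc k) \<in> boxes ?Q \<longrightarrow> (\<forall>m\<in>?Q ! Suc k ! r'. \<forall>n\<in>?Q ! k ! r'. m \<le> n)"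
    proof (intro allI impI ballI)
      fix r' k m n
      assume box: "(r', Suc k) \<in> boxes ?Q" and m: "m \<in> ?Q ! Suc k ! r'" and n: "n \<in> ?Q ! k ! r'"
      have left: "(r', k) \<in> boxes ?Q" using boxes_left[OF part box] .
      have "(r', k) \<noteq> (r, c)" using box corner(2) by auto
      then have n': "(r', k) \<in> boxes Q'" "n \<in> Q' ! k ! r'" using entries[OF left n] by auto
      from entries[OF box m] show "m \<le> n"
      proof
        assume "m = y \<and> (r', Suc k) = (r, c)"
        then show ?thesis using lowD(1)[OF n'] by simp
      next
        assume "(r', Suc k) \<in> boxes Q' \<and> m \<in> Q' ! Suc k ! r'"
        then show ?thesis using Q' n' by (auto simp: rsvt_iff)
      qed
    qed
    show "\<forall>r' k. (Suc r', k) \<in> boxes ?Q \<longrightarrow> (\<forall>m\<in>?Q ! k ! Suc r'. \<forall>n\<in>?Q ! k ! r'. m < n)"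
    proof (intro allI impI ballI)
      fix r' k m n
      assume box: "(Suc r', k) \<in> boxes ?Q" and m: "m \<in> ?Q ! k ! Suc r'" and n: "n \<in> ?Q ! k ! r'"
      have above: "(r', k) \<in> boxes ?Q" using boxes_above[OF box] .
      have "(r', k) \<noteq> (r, c)" using box corner(3) by auto
      then have n': "(r', k) \<in> boxes Q'" "n \<in> Q' ! k ! r'" using entries[OF above n] by auto
      from entries[OF box m] show "m < n"
      proof
        assume "m = y \<and> (Suc r', k) = (r, c)"
        then show ?thesis using lowD[OF n'] by (cases "n = y") auto
      next
        assume "(Suc r', k) \<in> boxes Q' \<and> m \<in> Q' ! k ! Suc r'"
        then show ?thesis using Q' n' by (auto simp: rsvt_iff)
      qed
    qed
  qed
  then show ?thesis using P props(1) by (simp add: tpair_def)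
qed

lemma low_place:
  assumes "tpair P' Q'" "extension P' x P r c \<alpha>" "low y c Q'"
  shows "low y (Suc c) (place Q' r c \<alpha> y)"
  unfolding low_def
proof (clarify)
  fix r' k n
  assume "(r', k) \<in> boxes (place Q' r c \<alpha> y)" "n \<in> place Q' r c \<alpha> y ! k ! r'"
  from place_entries[OF assms(1,2) this] show "y \<le> n \<and> (n = y \<longrightarrow> k < Suc c)"
    using lowD[OF assms(3), of r' k n] by fastforce
qed

lemma tpair_column_nonempty: "tpair P' Q' \<Longrightarrow> k < length Q' \<Longrightarrow> Q' ! k \<noteq> []"
  by (auto simp: tpair_def rsvt_iff partition_shape_iff)

lemma take_off_place:
  assumes "tpair P' Q'" "extension P' x P r c \<alpha>" "low y c Q'"
  shows "take_off (place Q' r c \<alpha> y) r c \<alpha> y = Q'"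
  using place_props(4)[OF assms(1,2), where y=y]
proof
  assume zero: "\<alpha> = 0 \<and> (r, c) \<in> boxes Q' \<and> place Q' r c \<alpha> y ! c ! r = insert y (Q' ! c ! r)"
  then have "y \<notin> Q' ! c ! r" using assms(3) by (auto simp: low_def)
  then show ?thesis using zero
    by (auto simp: take_off_def place_def add_to_box_def boxes_def)
next
  assume one: "\<alpha> = 1 \<and> (r, c) \<notin> boxes Q' \<and> place Q' r c \<alpha> y ! c ! r = {y}"
  have c: "c \<le> length Q'"
  proof -
    have "(r, c) \<in> boxes P" using extension_corner[OF assms(2)] by simp
    moreover have "length (shape P) \<le> Suc (length (shape P'))"
      using ins_corner[of P' x P r c \<alpha>] assms(2) one by (auto simp: extension_def)
    then have "length P \<le> Suc (length P')" by (simp add: length_shape)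
    ultimately show ?thesis using assms(1) length_eq_of_shape[of P' Q']
      by (simp add: tpair_def boxes_def)
  qed
  show ?thesis
  proof (cases "c < length Q'")
    case True
    then show ?thesis using one tpair_column_nonempty[OF assms(1) True]
      by (simp add: take_off_def place_def append_entry_def set_column_def column_def)
  next
    case False
    then show ?thesis using one c
      by (simp add: take_off_def place_def append_entry_def set_column_def column_def)
  qed
qed

text \<open>All data of the last step can be read off: \<open>y\<close> is the least entry,
  \<open>c\<close> its rightmost column, \<open>r\<close> the bottom row of that column, and
  \<open>\<alpha> = 1\<close> iff \<open>y\<close> is alone in its box.\<close>

lemma place_determines:
  assumes "tpair P1 Q1" "extension P1 x1 P r1 c1 \<alpha>1" "low y1 c1 Q1"
    and "tpair P2 Q2" "extension P2 x2 P r2 c2 \<alpha>2" "low y2 c2 Q2"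
    and eq: "place Q1 r1 c1 \<alpha>1 y1 = place Q2 r2 c2 \<alpha>2 y2"
  shows "P1 = P2 \<and> Q1 = Q2 \<and> x1 = x2 \<and> y1 = y2"
proof -
  let ?Q = "place Q1 r1 c1 \<alpha>1 y1"
  have low: "low y1 (Suc c1) ?Q" "low y2 (Suc c2) ?Q"
    using low_place[OF assms(1-3)] low_place[OF assms(4-6)] eq by simp_all
  have new: "(r1, c1) \<in> boxes ?Q" "y1 \<in> ?Q ! c1 ! r1" "(r2, c2) \<in> boxes ?Q" "y2 \<in> ?Q ! c2 ! r2"
    using place_entry_new[OF assms(1,2), of y1] place_entry_new[OF assms(4,5), of y2] eq by simp_all
  have y: "y1 = y2" using lowD(1)[OF low(1) new(3,4)] lowD(1)[OF low(2) new(1,2)] by simp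
  have c: "c1 = c2" using lowD(2)[OF low(1) new(3,4)] lowD(2)[OF low(2) new(1,2)] y by simp
  have r: "r1 = r2" using extension_corner(4)[OF assms(2)] extension_corner(4)[OF assms(5)] c by simp
  have single: "\<alpha> = (if place Q r c \<alpha> y ! c ! r = {y} then 1 else 0)"
    if "tpair P' Q" "extension P' x P r c \<alpha>" "low y c Q" for P' x P Q r c \<alpha> y
  proof -
    have "Q ! c ! r \<noteq> {}" "y \<notin> Q ! c ! r" if "(r, c) \<in> boxes Q"
      using that \<open>tpair P' Q\<close> \<open>low y c Q\<close> by (auto simp: tpair_def rsvt_iff low_def)
    then show ?thesis using place_props(4)[OF that(1,2), of y] by auto
  qed
  have \<alpha>: "\<alpha>1 = \<alpha>2" using single[OF assms(1-3)] single[OF assms(4-6)] eq y c r by simp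
  have "take_off ?Q r1 c1 \<alpha>1 y1 = Q2"
    unfolding eq unfolding y c r \<alpha> by (rule take_off_place[OF assms(4-6)])
  then have "Q1 = Q2" using take_off_place[OF assms(1-3)] by metis
  moreover have "unins P c1 \<alpha>1 = (P1, x1)" "unins P c2 \<alpha>2 = (P2, x2)"
    using assms(2,5) unins_ins unfolding extension_def by blast+
  then have "(P1, x1) = (P2, x2)" unfolding c \<alpha> by metis
  ultimately show ?thesis using y by simp
qed

section \<open>Removing the last recorded letter\<close>

lemma partition_shape_cong: "shape S = shape T \<Longrightarrow> partition_shape S \<longleftrightarrow> partition_shape T"
  by (simp add: partition_shape_def)

lemma dtab_partition_shape: "dtab P \<Longrightarrow> partition_shape P"
  by (simp add: decreasing_tableau_def flip: decreasing_tableau_iff_dtab)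

lemma place_take_off:
  assumes "(r, c) \<in> boxes Q" "r = length (Q ! c) - 1" "y \<in> Q ! c ! r"
    "\<alpha> = (if Q ! c ! r = {y} then 1 else 0)" "r = 0 \<Longrightarrow> c = length Q - 1"
  shows "place (take_off Q r c \<alpha> y) r c \<alpha> y = Q"
proof (cases "\<alpha> = 1")
  case True
  then have y: "Q ! c ! r = {y}" using assms(4) by (metis zero_neq_one)
  have c: "c < length Q" "Q ! c \<noteq> []" using assms(1) by (auto simp: boxes_def)
  then have "last (Q ! c) = {y}" using y assms(2) by (simp add: last_conv_nth)
  then have last: "butlast (Q ! c) @ [{y}] = Q ! c" using append_butlast_last_id[OF c(2)] by simp
  show ?thesis
  proof (cases "butlast (Q ! c) = []")
    case B: True
    then have "length (butlast (Q ! c)) = 0" by simp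
    then have "r = 0" using assms(2) by simp
    then have "c = length Q - 1" by (rule assms(5))
    have "Q \<noteq> []" using c by auto
    then have "last Q = Q ! c" unfolding \<open>c = length Q - 1\<close> by (rule last_conv_nth)
    also have "\<dots> = [{y}]" using last unfolding B by simp
    finally have "last Q = [{y}]" .
    then have "butlast Q @ [[{y}]] = Q" using append_butlast_last_id[OF \<open>Q \<noteq> []\<close>] by simp
    then show ?thesis using True B \<open>c = length Q - 1\<close>
      by (simp add: place_def take_off_def append_entry_def set_column_def column_def)
  next
    case False
    then show ?thesis using True c last
      by (simp add: place_def take_off_def append_entry_def set_column_def column_def)
  qed
next
  case False
  moreover have "insert y (Q ! c ! r - {y}) = Q ! c ! r" using assms(3) by (rule insert_Diff)
  moreover have "c < length Q" "r < length (Q ! c)" using assms(1) by (auto simp: boxes_def)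
  ultimately show ?thesis by (simp add: place_def take_off_def add_to_box_def)
qed

text \<open>The rightmost occurrence of the least entry \<open>y\<close> sits in a corner: a box
  below would have smaller entries, and a box to the right could contain only \<open>y\<close>
  again. The insertion can therefore be reversed from this column.\<close>

lemma tpair_uninsert:
  assumes "tpair P Q" "P \<noteq> []"
  obtains P' Q' x r c \<alpha> y where "tpair P' Q'" "extension P' x P r c \<alpha>" "low y c Q'" "0 < y"
    "Q = place Q' r c \<alpha> y"
proof -
  have P: "dtab P" "shape P = shape Q" and Q: "rsvt Q" using assms(1) by (auto simp: tpair_def)
  have len: "length P = length Q" using length_eq_of_shape[OF P(2)] .
  have entry: "finite (Q ! k ! r)" "Q ! k ! r \<noteq> {}" "\<forall>n\<in>Q ! k ! r. 0 < n" if "(r, k) \<in> boxes Q" for r k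
    using Q that by (auto simp: rsvt_iff)
  have row: "m \<le> n" if "(r, Suc k) \<in> boxes Q" "m \<in> Q ! Suc k ! r" "n \<in> Q ! k ! r" for r k m n
    using Q that by (auto simp: rsvt_iff)
  have col: "m < n" if "(Suc r, k) \<in> boxes Q" "m \<in> Q ! k ! Suc r" "n \<in> Q ! k ! r" for r k m n
    using Q that by (auto simp: rsvt_iff)
  have part: "partition_shape Q" using Q by (simp add: rsvt_iff)
  define y where "y = (LEAST n. \<exists>r k. (r, k) \<in> boxes Q \<and> n \<in> Q ! k ! r)"
  have "Q \<noteq> []" using assms(2) len by auto
  then have "(0, 0) \<in> boxes Q" using part by (auto simp: partition_shape_iff boxes_def)
  then have "\<exists>n r k. (r, k) \<in> boxes Q \<and> n \<in> Q ! k ! r" using entry(2) by blast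
  then have y_ex: "\<exists>r k. (r, k) \<in> boxes Q \<and> y \<in> Q ! k ! r" unfolding y_def by (rule LeastI_ex)
  have y_le: "y \<le> n" if "(r, k) \<in> boxes Q" "n \<in> Q ! k ! r" for r k n
    unfolding y_def by (rule Least_le) (use that in blast)
  define K where "K = {k. \<exists>r. (r, k) \<in> boxes Q \<and> y \<in> Q ! k ! r}"
  have K: "finite K" "K \<noteq> {}"
    using y_ex by (auto simp: K_def boxes_def intro: finite_subset[of _ "{..<length Q}"])
  define c where "c = Max K"
  have "c \<in> K" unfolding c_def using K by (rule Max_in)
  then obtain r where r: "(r, c) \<in> boxes Q" "y \<in> Q ! c ! r" by (auto simp: K_def)
  have c_max: "k \<le> c" if "(r', k) \<in> boxes Q" "y \<in> Q ! k ! r'" for r' k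
    unfolding c_def using K(1) that by (intro Max_ge) (auto simp: K_def)
  have below: "(Suc r', k) \<notin> boxes Q" if "(r', k) \<in> boxes Q" "y \<in> Q ! k ! r'" for r' k
  proof
    assume box: "(Suc r', k) \<in> boxes Q"
    then obtain m where "m \<in> Q ! k ! Suc r'" using entry(2) by blast
    then show False using col[OF box _ that(2)] y_le[OF box] by (meson leD)
  qed
  have r_len: "length (Q ! c) = Suc r" using below[OF r] r(1) by (auto simp: boxes_def)
  have right: "(r, Suc c) \<notin> boxes Q"
  proof
    assume box: "(r, Suc c) \<in> boxes Q"
    then obtain m where m: "m \<in> Q ! Suc c ! r" using entry(2) by blast
    then have "m = y" using row[OF box m r(2)] y_le[OF box m] by simp
    then show False using c_max[OF box] m by simp
  qed
  have cP: "c < length P" "length (P ! c) = Suc r"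
    using r(1) r_len len length_nth_of_shape[OF P(2), of c] by (auto simp: boxes_def)
  have right_len: "length (column P (Suc c)) < length (P ! c)"
    using right cP len length_nth_of_shape[OF P(2), of "Suc c"] by (auto simp: boxes_def column_def)
  define \<alpha> :: nat where "\<alpha> = (if Q ! c ! r = {y} then 1 else 0)"
  have "\<alpha> = 0 \<or> \<alpha> = 1" by (simp add: \<alpha>_def)
  from ins_unins[OF P(1) cP(1) right_len this] obtain P' x where
    "dtab P'" "0 < x" "ins x P' = (P, (length (P ! c) - 1, c), \<alpha>)" by blast
  then have ins: "dtab P'" "0 < x" "ins x P' = (P, (r, c), \<alpha>)" using cP(2) by simp_all
  then have ext: "extension P' x P r c \<alpha>" by (simp add: extension_def)
  define Q' where "Q' = take_off Q r c \<alpha> y"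
  \<comment> \<open>A corner in the top row can only be in the last column.\<close>
  have c_last: "c = length Q - 1" if "r = 0"
  proof -
    have "length (column Q (Suc c)) = 0" using right that by (auto simp: boxes_def column_def)
    then have "\<not> Suc c < length Q" using part by (auto simp: column_def partition_shape_iff)
    then show ?thesis using r(1) by (auto simp: boxes_def)
  qed
  have place: "place Q' r c \<alpha> y = Q"
    unfolding Q'_def by (rule place_take_off) (use r r_len \<alpha>_def c_last in auto)
  note corner = ins_corner[OF ins]
  consider (zero) "\<alpha> = 0" "shape P = shape P'"
    | (old) "\<alpha> = 1" "c < length P'" "r = length (P' ! c)" "shape P = (shape P')[c := Suc r]"
    | (new) "\<alpha> = 1" "c = length P'" "r = 0" "shape P = shape P' @ [1]"
    using corner by (auto simp: column_def)
  then have Q'_props: "shape Q' = shape P' \<and> (\<forall>r' k. (r', k) \<in> boxes Q' \<longrightarrow> (r', k) \<in> boxes Q \<and>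
    ((r', k) = (r, c) \<and> \<alpha> = 0 \<and> Q' ! k ! r' = Q ! c ! r - {y} \<or> (r', k) \<noteq> (r, c) \<and> Q' ! k ! r' = Q ! k ! r'))"
  proof cases
    case zero
    then have Q': "Q' = Q[c := (Q ! c)[r := Q ! c ! r - {y}]]" by (simp add: Q'_def take_off_def)
    have "shape Q' = shape Q"
      unfolding Q' shape_def using r(1) by (simp add: map_update list_update_same_conv boxes_def)
    then have "boxes Q' = boxes Q" by (rule boxes_cong)
    moreover have "(r', k) \<in> boxes Q \<Longrightarrow>
      (r', k) = (r, c) \<and> Q' ! k ! r' = Q ! c ! r - {y} \<or> (r', k) \<noteq> (r, c) \<and> Q' ! k ! r' = Q ! k ! r'" for r' k
      unfolding Q' by (cases "k = c"; cases "r' = r") (auto simp: boxes_def)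
    ultimately show ?thesis using \<open>shape Q' = shape Q\<close> zero P(2) by auto
  next
    case old
    have "P' ! c \<noteq> []" using ins(1) old by (simp add: dtab_iff_nth)
    then have "butlast (Q ! c) \<noteq> []" using old r_len by (auto simp flip: length_greater_0_conv)
    then have Q': "Q' = Q[c := butlast (Q ! c)]" using old by (simp add: Q'_def take_off_def)
    have "shape Q' = (shape Q)[c := r]" unfolding Q' shape_def using r_len by (simp add: map_update)
    also have "\<dots> = (shape P')[c := r]" using old P(2) by (metis list_update_overwrite)
    also have "\<dots> = shape P'" using old by (simp add: shape_def list_update_same_conv)
    finally have "shape Q' = shape P'" .
    moreover have "(r', k) \<in> boxes Q' \<Longrightarrow> (r', k) \<in> boxes Q \<and> (r', k) \<noteq> (r, c) \<and> Q' ! k ! r' = Q ! k ! r'" for r' k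
      unfolding Q' using r_len by (cases "k = c") (auto simp: boxes_def nth_butlast)
    ultimately show ?thesis by blast
  next
    case new
    then have "butlast (Q ! c) = []" using r_len by (auto simp: length_Suc_conv)
    then have Q': "Q' = butlast Q" using new by (simp add: Q'_def take_off_def)
    have "shape Q' = butlast (shape Q)" unfolding Q' shape_def by (simp add: map_butlast)
    then have "shape Q' = shape P'" using new P(2) by (metis butlast_snoc)
    moreover have "(r', k) \<in> boxes Q' \<Longrightarrow> (r', k) \<in> boxes Q \<and> (r', k) \<noteq> (r, c) \<and> Q' ! k ! r' = Q ! k ! r'" for r' k
      unfolding Q' using c_last[OF new(3)] by (auto simp: boxes_def nth_butlast)
    ultimately show ?thesis by blast
  qed
  have Q'_box: "(r', k) \<in> boxes Q" "Q' ! k ! r' \<subseteq> Q ! k ! r'" "Q' ! k ! r' \<noteq> {}"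
    "y \<in> Q' ! k ! r' \<Longrightarrow> k < c" if box: "(r', k) \<in> boxes Q'" for r' k
  proof -
    show Qbox: "(r', k) \<in> boxes Q" using Q'_props box by blast
    consider (new) "(r', k) = (r, c)" "\<alpha> = 0" "Q' ! k ! r' = Q ! c ! r - {y}"
      | (old) "(r', k) \<noteq> (r, c)" "Q' ! k ! r' = Q ! k ! r'"
      using Q'_props box by blast
    then have "Q' ! k ! r' \<subseteq> Q ! k ! r' \<and> Q' ! k ! r' \<noteq> {} \<and> (y \<in> Q' ! k ! r' \<longrightarrow> k < c)"
    proof cases
      case new
      have "Q ! c ! r \<noteq> {y}" using new by (auto simp: \<alpha>_def)
      then have "Q ! c ! r - {y} \<noteq> {}" using r(2) by blast
      then show ?thesis using new by auto
    next
      case old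
      have "k < c" if "y \<in> Q' ! k ! r'"
      proof -
        have y: "y \<in> Q ! k ! r'" using old that by simp
        have "k \<noteq> c"
        proof
          assume "k = c"
          then have "length (Q ! c) = Suc r'" using below[OF Qbox y] Qbox by (auto simp: boxes_def)
          then show False using old \<open>k = c\<close> r_len by simp
        qed
        then show ?thesis using c_max[OF Qbox y] by simp
      qed
      then show ?thesis using old entry[OF Qbox] by auto
    qed
    then show "Q' ! k ! r' \<subseteq> Q ! k ! r'" "Q' ! k ! r' \<noteq> {}" "y \<in> Q' ! k ! r' \<Longrightarrow> k < c" by auto
  qed
  have "partition_shape Q'" using Q'_props dtab_partition_shape[OF ins(1)] partition_shape_cong by metis
  then have "rsvt Q'"
    unfolding rsvt_iff
  proof (intro conjI)
    assume part': "partition_shape Q'"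
    then show "partition_shape Q'" .
    show "\<forall>(r', k)\<in>boxes Q'. finite (Q' ! k ! r') \<and> Q' ! k ! r' \<noteq> {} \<and> (\<forall>n\<in>Q' ! k ! r'. 0 < n)"
    proof (clarify, intro conjI)
      fix r' k assume box: "(r', k) \<in> boxes Q'"
      show "finite (Q' ! k ! r')" using entry(1)[OF Q'_box(1)[OF box]] Q'_box(2)[OF box] finite_subset by blast
      show "Q' ! k ! r' \<noteq> {}" using Q'_box(3)[OF box] .
      show "\<forall>n\<in>Q' ! k ! r'. 0 < n" using entry(3)[OF Q'_box(1)[OF box]] Q'_box(2)[OF box] by blast
    qed
    show "\<forall>r' k. (r', Suc k) \<in> boxes Q' \<longrightarrow> (\<forall>m\<in>Q' ! Suc k ! r'. \<forall>n\<in>Q' ! k ! r'. m \<le> n)"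
    proof (intro allI impI ballI)
      fix r' k m n
      assume box: "(r', Suc k) \<in> boxes Q'" and "m \<in> Q' ! Suc k ! r'" "n \<in> Q' ! k ! r'"
      then show "m \<le> n"
        using row[OF Q'_box(1)[OF box], of m n] Q'_box(2)[OF box] Q'_box(2)[OF boxes_left[OF part' box]]
        by blast
    qed
    show "\<forall>r' k. (Suc r', k) \<in> boxes Q' \<longrightarrow> (\<forall>m\<in>Q' ! k ! Suc r'. \<forall>n\<in>Q' ! k ! r'. m < n)"
    proof (intro allI impI ballI)
      fix r' k m n
      assume box: "(Suc r', k) \<in> boxes Q'" and "m \<in> Q' ! k ! Suc r'" "n \<in> Q' ! k ! r'"
      then show "m < n"
        using col[OF Q'_box(1)[OF box], of m n] Q'_box(2)[OF box] Q'_box(2)[OF boxes_above[OF box]]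
        by blast
    qed
  qed
  moreover have "low y c Q'"
    unfolding low_def
  proof (clarify, intro conjI impI)
    fix r' k n assume box: "(r', k) \<in> boxes Q'" and n: "n \<in> Q' ! k ! r'"
    show "y \<le> n" using y_le[OF Q'_box(1)[OF box]] Q'_box(2)[OF box] n by blast
    show "k < c" if "n = y" using Q'_box(4)[OF box] n that by simp
  qed
  moreover have "0 < y" using r entry(3) by auto
  ultimately show ?thesis using that[of P' Q' x r c \<alpha> y] ins(1) Q'_props ext place
    by (simp add: tpair_def)
qed

section \<open>Keys before and after a recorded letter\<close>

lemma max_column_boxes: "max_column Q k = (\<lambda>r. Max (Q ! k ! r)) ` {r. (r, k) \<in> boxes Q}"
proof (cases "k < length Q")
  case True
  then have "set (Q ! k) = (!) (Q ! k) ` {r. (r, k) \<in> boxes Q}"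
    by (auto simp: boxes_def set_conv_nth)
  then show ?thesis using True by (simp add: max_column_def column_def image_image)
qed (simp add: max_column_def column_def boxes_def)

text \<open>No entry is below \<open>y\<close>, so adding it to an occupied box does not change the
  maximum there; only a new box matters.\<close>

lemma max_column_place:
  assumes "tpair P' Q'" "extension P' x P r c \<alpha>" "low y c Q'"
  shows "max_column (place Q' r c \<alpha> y) =
    (if \<alpha> = 1 then (max_column Q')(c := insert y (max_column Q' c)) else max_column Q')"
proof
  fix k
  let ?Q = "place Q' r c \<alpha> y"
  note props = place_props[OF assms(1,2), where y=y]
  have other: "Max (?Q ! k ! r') = Max (Q' ! k ! r')" if "(r', k) \<in> boxes Q'" "(r', k) \<noteq> (r, c)" for r'
    using props(3)[OF that] by simp
  show "max_column ?Q k =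
    (if \<alpha> = 1 then (max_column Q')(c := insert y (max_column Q' c)) else max_column Q') k"
    using props(4)
  proof
    assume one: "\<alpha> = 1 \<and> (r, c) \<notin> boxes Q' \<and> ?Q ! c ! r = {y}"
    have "max_column ?Q k = (if k = c then insert y (max_column Q' c) else max_column Q' k)"
    proof (cases "k = c")
      case True
      have "{r'. (r', c) \<in> boxes ?Q} = insert r {r'. (r', c) \<in> boxes Q'}" using props(2) by auto
      moreover have "(\<lambda>r'. Max (?Q ! c ! r')) ` {r'. (r', c) \<in> boxes Q'} =
        (\<lambda>r'. Max (Q' ! c ! r')) ` {r'. (r', c) \<in> boxes Q'}"
        by (rule image_cong) (use other one True in auto)
      moreover have "?Q ! c ! r = {y}" using one by blast
      then have "Max (?Q ! c ! r) = y" by simp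
      ultimately show ?thesis using True unfolding max_column_boxes by simp
    next
      case False
      then have "{r'. (r', k) \<in> boxes ?Q} = {r'. (r', k) \<in> boxes Q'}" using props(2) by auto
      then show ?thesis unfolding max_column_boxes using False other by auto
    qed
    then show ?thesis using one by simp
  next
    assume zero: "\<alpha> = 0 \<and> (r, c) \<in> boxes Q' \<and> ?Q ! c ! r = insert y (Q' ! c ! r)"
    then have fin: "finite (Q' ! c ! r)" "Q' ! c ! r \<noteq> {}"
      using assms(1) by (auto simp: tpair_def rsvt_iff)
    have "y \<le> Max (Q' ! c ! r)" using lowD(1)[OF assms(3)] zero Max_in[OF fin] by blast
    moreover have "?Q ! c ! r = insert y (Q' ! c ! r)" using zero by blast
    ultimately have "Max (?Q ! c ! r) = Max (Q' ! c ! r)" using fin by (simp add: max_absorb2)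
    then have "Max (?Q ! k ! r') = Max (Q' ! k ! r')" if "(r', k) \<in> boxes Q'" for r'
      using other[OF that] by (cases "(r', k) = (r, c)") auto
    moreover have "boxes ?Q = boxes Q'" using props(2) zero by auto
    ultimately have "max_column ?Q k = max_column Q' k" unfolding max_column_boxes by auto
    then show ?thesis using zero by simp
  qed
qed

lemma key_cond_place:
  assumes "tpair P' Q'" "extension P' x P r c \<alpha>" "low y c Q'" "0 < y"
  shows "key_cond P (place Q' r c \<alpha> y) \<longleftrightarrow> key_cond P' Q' \<and> y \<le> x"
proof -
  let ?Q = "place Q' r c \<alpha> y"
  let ?A = "max_column Q'"
  have ins: "dtab P'" "0 < x" "ins x P' = (P, (r, c), \<alpha>)" using assms(2) by (auto simp: extension_def)
  have Q': "rsvt Q'" using assms(1) by (simp add: tpair_def)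
  have tpair: "tpair P ?Q" by (rule tpair_place) fact+
  then have Q: "rsvt ?Q" "dtab P" by (auto simp: tpair_def)
  interpret A: dominance_chain ?A using rsvt_max_column(1)[OF Q'] .
  interpret B: dominance_chain "max_column ?Q" using rsvt_max_column(1)[OF Q(1)] .
  have lowA: "y \<le> a" "a = y \<Longrightarrow> k < c" if a: "a \<in> ?A k" for a k
  proof -
    obtain r' where "(r', k) \<in> boxes Q'" "a \<in> Q' ! k ! r'" by (rule mem_max_column[OF Q' a])
    from lowD[OF assms(3) this] show "y \<le> a" "a = y \<Longrightarrow> k < c" .
  qed
  \<comment> \<open>Inserting \<open>x\<close> leaves an element that is at most \<open>x\<close> in
    the first right key column. By the key inequality the first left key column has one that is no
    larger, and every entry of \<open>?Q\<close> is at least \<open>y\<close>.\<close>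
  have y_le_x: "y \<le> x" if cond: "key_cond P ?Q"
  proof -
    obtain s where s: "s \<in> rkey P 0" "s \<le> x" using rkey_0_ins_below[OF ins] by blast
    obtain b where b: "b \<in> lkey (max_column ?Q) 0" "b \<le> s"
      using exceeds_ge[of "rkey P 0" "lkey (max_column ?Q) 0" s] cond s by (auto simp: key_cond_def)
    then have "b \<in> max_column ?Q 0" using B.lkey_subset by blast
    then obtain r' where "(r', 0) \<in> boxes ?Q" "b \<in> ?Q ! 0 ! r'" by (rule mem_max_column[OF Q(1)])
    then have "y \<le> b" by (rule lowD(1)[OF low_place[OF assms(1-3)]])
    then show ?thesis using b s by simp
  qed
  show ?thesis
  proof (cases "\<alpha> = 1")
    case False
    then have "\<alpha> = 0" using ins_corner[OF ins] by auto
    then have "rkey P k = rkey P' k" for k using rkey_ins_unchanged[OF ins] by simp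
    moreover have "max_column ?Q = ?A" using max_column_place[OF assms(1-3)] False by simp
    ultimately have "key_cond P ?Q \<longleftrightarrow> key_cond P' Q'" by (simp add: key_cond_def)
    \<comment> \<open>Without a new box both keys are unchanged, so the old inequality already
      forces \<open>y \<le> x\<close>.\<close>
    then show ?thesis using y_le_x by blast
  next
    case True
    let ?B = "?A(c := insert y (?A c))"
    have B: "max_column ?Q = ?B" using max_column_place[OF assms(1-3)] True by simp
    have y_new: "y \<notin> ?A c" "\<forall>a\<in>?A (Suc c). y < a"
      using lowA[of y c] lowA[of _ "Suc c"] by (auto simp: le_less)
    have rkey_eq: "rkey P k = rkey P' k" if "k \<noteq> c" for k using rkey_ins_unchanged[OF ins] that by simp
    have lkey_eq: "lkey ?B k = lkey ?A k" if "k \<noteq> c" for k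
      by (rule lkey_insert_unchanged) (use A.dominance_chain_axioms y_new that in auto)
    obtain e where e: "e \<notin> rkey P' c" "rkey P c = insert e (rkey P' c)"
      "\<forall>g\<in>rkey P' c - rkey P' (Suc c). e < g" "c = 0 \<Longrightarrow> x \<le> e"
      using rkey_ins_new_box[OF ins(1,2)] ins(3) True by metis
    obtain f where f: "f \<notin> lkey ?A c" "lkey ?B c = insert f (lkey ?A c)"
      "c = 0 \<Longrightarrow> f = y" "0 < c \<Longrightarrow> adds_min (lkey ?A c) f (lkey ?A (c - 1))"
    proof (cases "c = 0")
      case True
      have "lkey A 0 = A 0" for A by (simp add: lkey_def)
      then show ?thesis using that[of y] True y_new by simp
    next
      case False
      then obtain f where "adds_min (lkey ?A c) f (lkey ?A (c - 1))" "lkey ?B c = insert f (lkey ?A c)"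
        using lkey_insert[of ?A c y] A.dominance_chain_axioms B.dominance_chain_axioms[unfolded B]
          y_new lowA(1) by (metis neq0_conv)
      then show ?thesis using that[of f] False by (auto simp: adds_min_def)
    qed
    have split: "key_cond P ?Q \<longleftrightarrow> (\<forall>k. k \<noteq> c \<longrightarrow> exceeds (rkey P' k) (lkey ?A k)) \<and>
      exceeds (insert e (rkey P' c)) (insert f (lkey ?A c))"
      unfolding key_cond_def B using rkey_eq lkey_eq e(2) f(2) by metis
    show ?thesis
    proof (intro iffI conjI)
      assume cond: "key_cond P ?Q"
      then show "y \<le> x" by (rule y_le_x)
      have "exceeds (rkey P' c) (lkey ?A c)"
      \<comment> \<open>The neighbour \<open>Suc c\<close> serves as comparison here; the step has
        not changed it in either key.\<close>
      proof (rule exceeds_remove)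
        show "exceeds (insert e (rkey P' c)) (insert f (lkey ?A c))"
          "exceeds (rkey P' (Suc c)) (lkey ?A (Suc c))" using cond split by auto
      qed (use e f A.lkey_Suc_subset in auto)
      then show "key_cond P' Q'" using cond split unfolding key_cond_def by metis
    next
      assume cond: "key_cond P' Q' \<and> y \<le> x"
      have "exceeds (insert e (rkey P' c)) (insert f (lkey ?A c))"
      proof (cases "c = 0")
        case True
        show ?thesis
        proof (rule exceeds_insert_least)
          show "exceeds (rkey P' c) (lkey ?A c)" using cond by (simp add: key_cond_def)
          show "f \<le> e" using True e(4) f(3) cond by simp
          show "\<forall>b\<in>lkey ?A c. f \<le> b"
            using A.lkey_subset lowA(1) f(3)[OF True] by blast
        qed (use e f in auto)
      next
        case False
        show ?thesis
        proof (rule exceeds_insert)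
          show "exceeds (rkey P' c) (lkey ?A c)" "exceeds (rkey P' (c - 1)) (lkey ?A (c - 1))"
            using cond by (simp_all add: key_cond_def)
          \<comment> \<open>The columns of the right key of \<open>P\<close> are nested, and column
            \<open>c - 1\<close> is the same for \<open>P\<close> and \<open>P'\<close>.\<close>
          show "insert e (rkey P' c) \<subseteq> rkey P' (c - 1)"
            using rkey_Suc_subset[OF Q(2), of "c - 1"] rkey_eq[of "c - 1"] e(2) False by simp
          show "adds_min (lkey ?A c) f (lkey ?A (c - 1))" using f(4) False by simp
        qed (use e in auto)
      qed
      then show "key_cond P ?Q" using cond split by (simp add: key_cond_def)
    qed
  qed
qed

section \<open>The bijection\<close>

lemma compatible_pair_snoc:
  assumes "length a = length i"
  shows "compatible_pair (a @ [x], i @ [y]) \<longleftrightarrow>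
    compatible_pair (a, i) \<and> 0 < x \<and> 0 < y \<and>
    (a \<noteq> [] \<longrightarrow> y \<le> last i \<and> (y = last i \<longrightarrow> last a < x))"
proof (cases "a = []")
  case True
  then show ?thesis using assms by (auto simp: compatible_pair_def)
next
  case False
  define n where "n = length a - 1"
  have "0 < length a" using False by simp
  then have n: "length a = Suc n" "length i = Suc n" using assms by (simp_all add: n_def)
  have last: "last a = a ! n" "last i = i ! n"
    using n by (auto simp: last_conv_nth simp flip: length_greater_0_conv)
  have "(\<forall>z\<in>set i. y \<le> z) \<longleftrightarrow> y \<le> last i" if "sorted_wrt (\<ge>) i"
  proof
    have "i \<noteq> []" using n by auto
    then show "y \<le> last i" if "\<forall>z\<in>set i. y \<le> z" using that by simp
    have "last i \<le> z" if "z \<in> set i" for z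
      using \<open>sorted_wrt (\<ge>) i\<close> that n unfolding last
      by (auto simp: sorted_wrt_iff_nth_less in_set_conv_nth less_Suc_eq)
    then show "\<forall>z\<in>set i. y \<le> z" if "y \<le> last i" using that order_trans by blast
  qed
  moreover have "(\<forall>j. Suc j < length (i @ [y]) \<longrightarrow> (i @ [y]) ! j = (i @ [y]) ! Suc j \<longrightarrow>
      (a @ [x]) ! j < (a @ [x]) ! Suc j) \<longleftrightarrow>
    (\<forall>j. Suc j < length i \<longrightarrow> i ! j = i ! Suc j \<longrightarrow> a ! j < a ! Suc j) \<and> (y = last i \<longrightarrow> last a < x)"
    unfolding last using n by (auto simp: nth_append less_Suc_eq)
  ultimately show ?thesis using False assms
    unfolding compatible_pair_def by (auto simp: sorted_wrt_append)
qed

lemma bounded_pair_snoc: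
  "length a = length i \<Longrightarrow> bounded_pair (a @ [x], i @ [y]) \<longleftrightarrow> bounded_pair (a, i) \<and> y \<le> x"
  by (auto simp: bounded_pair_def nth_append less_Suc_eq)

lemma compatible_pair_length: "compatible_pair (a, i) \<Longrightarrow> length a = length i"
  by (simp add: compatible_pair_def)

lemma compatible_pair_cases:
  assumes "compatible_pair (a, i)"
  obtains (Nil) "a = []" "i = []"
  | (snoc) a' x i' y where "a = a' @ [x]" "i = i' @ [y]" "length a' = length i'"
proof (cases a rule: rev_cases)
  case Nil
  then show ?thesis using that assms compatible_pair_length by fastforce
next
  case (snoc a' x)
  then obtain i' y where "i = i' @ [y]"
    using compatible_pair_length[OF assms] by (cases i rule: rev_cases) auto
  then show ?thesis using that(2) snoc compatible_pair_length[OF assms] by auto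
qed

lemma tpair_Nil: "tpair [] []"
  by (simp add: tpair_def rsvt_def partition_shape_def shape_def boxes_def)

lemma low_Nil: "low y c []"
  by (simp add: low_def boxes_def)

text \<open>The last clause says that insertions into \<open>P\<close> end to the right of the box recorded last exactly
  for the letters larger than the last one; it decides whether the letter \<open>last i\<close> may be repeated.\<close>

definition recorded :: "nat list \<times> nat list \<Rightarrow> nat list list \<Rightarrow> nat set list list \<Rightarrow> nat \<Rightarrow> bool" where
  "recorded = (\<lambda>(a, i) P Q c. low (last i) (Suc c) Q \<and> (\<exists>r. (r, c) \<in> boxes Q \<and> last i \<in> Q ! c ! r) \<and>
    (\<forall>x P' r' c' \<alpha>. extension P x P' r' c' \<alpha> \<longrightarrow> (last a < x \<longleftrightarrow> c < c')))"

lemma recorded_place: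
  assumes "tpair P' Q'" "extension P' x P r c \<alpha>" "low y c Q'"
  shows "recorded (a @ [x], i @ [y]) P (place Q' r c \<alpha> y) c"
proof -
  have "x < z \<longleftrightarrow> c < c'" if "extension P z P'' r' c' \<alpha>'" for z P'' r' c' \<alpha>'
    using ins_ins_column[of P' x z P r c \<alpha> P'' r' c' \<alpha>'] assms(2) that by (simp add: extension_def)
  then show ?thesis
    unfolding recorded_def prod.case last_snoc
    using low_place[OF assms] place_entry_new[OF assms(1,2), of y] by blast
qed

text \<open>\<open>last i\<close> is the least entry of \<open>Q'\<close> and \<open>c0\<close> its
  rightmost column. A smaller \<open>y\<close> is always allowed, and an equal one exactly if the
  insertion ends to the right of \<open>c0\<close>, that is, if \<open>last a < x\<close>.\<close>

lemma low_iff_compatible: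
  assumes "tpair P' Q'" "extension P' x P r c \<alpha>" "recorded (a, i) P' Q' c0"
  shows "low y c Q' \<longleftrightarrow> y \<le> last i \<and> (y = last i \<longrightarrow> last a < x)"
proof -
  have low: "low (last i) (Suc c0) Q'" and column: "last a < x \<longleftrightarrow> c0 < c"
    using assms(2,3) unfolding recorded_def prod.case by blast+
  obtain r0 where r0: "(r0, c0) \<in> boxes Q'" "last i \<in> Q' ! c0 ! r0"
    using assms(3) unfolding recorded_def by auto
  show ?thesis
  proof
    assume y: "low y c Q'"
    show "y \<le> last i \<and> (y = last i \<longrightarrow> last a < x)"
      using lowD[OF y r0] column by auto
  next
    assume y: "y \<le> last i \<and> (y = last i \<longrightarrow> last a < x)"
    show "low y c Q'"
      unfolding low_def
    proof (clarify)
      fix r' k n assume "(r', k) \<in> boxes Q'" "n \<in> Q' ! k ! r'"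
      from lowD[OF low this] show "y \<le> n \<and> (n = y \<longrightarrow> k < c)" using y column by auto
    qed
  qed
qed

lemma extension_exists:
  assumes "dtab P'" "0 < x"
  obtains P r c \<alpha> where "extension P' x P r c \<alpha>"
  using assms by (cases "ins x P'") (auto simp: extension_def)

lemma Insert_snoc_extension:
  assumes "compatible_pair (a @ [x], i @ [y])" "length a = length i" "Insert (a, i) = (P', Q')"
    "tpair P' Q'" "a \<noteq> [] \<longrightarrow> (\<exists>c. recorded (a, i) P' Q' c)"
  obtains P r c \<alpha> where "extension P' x P r c \<alpha>" "low y c Q'"
    "Insert (a @ [x], i @ [y]) = (P, place Q' r c \<alpha> y)"
proof -
  have compat: "0 < x" "a \<noteq> [] \<longrightarrow> y \<le> last i \<and> (y = last i \<longrightarrow> last a < x)"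
    using assms by (auto simp: compatible_pair_snoc)
  have "dtab P'" using assms(4) by (simp add: tpair_def)
  then obtain P r c \<alpha> where ext: "extension P' x P r c \<alpha>" using compat(1) by (rule extension_exists)
  have "low y c Q'"
  proof (cases "a = []")
    case True
    then have "Q' = []" using assms(2,3) by (simp add: Insert_Nil)
    then show ?thesis by (simp add: low_Nil)
  next
    case False
    then obtain c0 where "recorded (a, i) P' Q' c0" using assms(5) by blast
    then show ?thesis using low_iff_compatible[OF assms(4) ext] compat(2) False by blast
  qed
  moreover have "Insert (a @ [x], i @ [y]) = (P, place Q' r c \<alpha> y)"
    unfolding Insert_snoc[OF assms(2)] assms(3) by (rule insert_step_eq_place[OF ext])
  ultimately show ?thesis using that ext by blast
qed

text \<open>The claims need one common induction: \<open>recorded\<close> turns compatibility into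
  \<open>low\<close> for the next letter, and \<open>low\<close> is what keeps the pair a valid one
  and makes the bound equivalent to the key inequality. The empty word is exempt because it has no
  last letter.\<close>

lemma Insert_tpair:
  "compatible_pair (a, i) \<Longrightarrow> Insert (a, i) = (P, Q) \<Longrightarrow>
    tpair P Q \<and> (a \<noteq> [] \<longrightarrow> (\<exists>c. recorded (a, i) P Q c)) \<and> (bounded_pair (a, i) \<longleftrightarrow> key_cond P Q)"
proof (induction a arbitrary: i P Q rule: rev_induct)
  case Nil
  then show ?case using compatible_pair_length[OF Nil(1)]
    by (simp add: Insert_Nil tpair_Nil bounded_pair_def key_cond_def rkey_def)
next
  case (snoc x a)
  from snoc.prems(1) obtain i' y where i: "i = i' @ [y]" and len: "length a = length i'"
    by (cases rule: compatible_pair_cases) auto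
  have compat: "compatible_pair (a, i')" "0 < y"
    using snoc.prems(1) by (auto simp: i compatible_pair_snoc[OF len])
  obtain P' Q' where PQ': "Insert (a, i') = (P', Q')" by (cases "Insert (a, i')")
  note IH = snoc.IH[OF compat(1) PQ']
  then have tpair: "tpair P' Q'" by blast
  have recorded: "a \<noteq> [] \<longrightarrow> (\<exists>c. recorded (a, i') P' Q' c)" using IH by blast
  obtain P1 r c \<alpha> where ext: "extension P' x P1 r c \<alpha>" and low: "low y c Q'"
    and "Insert (a @ [x], i' @ [y]) = (P1, place Q' r c \<alpha> y)"
    by (rule Insert_snoc_extension[OF snoc.prems(1)[unfolded i] len PQ' tpair recorded])
  then have PQ: "P = P1" "Q = place Q' r c \<alpha> y" using snoc.prems(2) i by simp_all
  have "tpair P Q" unfolding PQ by (rule tpair_place[OF tpair ext low compat(2)])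
  moreover have "recorded (a @ [x], i) P Q c" unfolding PQ i by (rule recorded_place[OF tpair ext low])
  moreover have "bounded_pair (a @ [x], i) \<longleftrightarrow> key_cond P Q"
    unfolding PQ i bounded_pair_snoc[OF len] key_cond_place[OF tpair ext low compat(2)] using IH by blast
  ultimately show ?case by blast
qed

lemma Insert_snocE:
  assumes "compatible_pair (a @ [x], i @ [y])" "length a = length i"
  obtains P' Q' P r c \<alpha> where "compatible_pair (a, i)" "Insert (a, i) = (P', Q')" "tpair P' Q'"
    "extension P' x P r c \<alpha>" "low y c Q'" "Insert (a @ [x], i @ [y]) = (P, place Q' r c \<alpha> y)"
proof -
  have compat: "compatible_pair (a, i)" using assms by (simp add: compatible_pair_snoc)
  obtain P' Q' where PQ': "Insert (a, i) = (P', Q')" by (cases "Insert (a, i)")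
  note T = Insert_tpair[OF compat PQ']
  then have tpair: "tpair P' Q'" and recorded: "a \<noteq> [] \<longrightarrow> (\<exists>c. recorded (a, i) P' Q' c)" by blast+
  obtain P r c \<alpha> where step: "extension P' x P r c \<alpha>" "low y c Q'"
    "Insert (a @ [x], i @ [y]) = (P, place Q' r c \<alpha> y)"
    by (rule Insert_snoc_extension[OF assms PQ' tpair recorded])
  show ?thesis by (rule that[OF compat PQ' tpair step])
qed

lemma extension_nonempty: "extension P' x P r c \<alpha> \<Longrightarrow> P \<noteq> []"
  using extension_corner(1) by (fastforce simp: boxes_def)

text \<open>The last steps agree by \<open>place_determines\<close>, and the empty pair is told
  apart because an insertion leaves a nonempty tableau.\<close>

lemma Insert_inj:
  "compatible_pair (a, i) \<Longrightarrow> compatible_pair (b, j) \<Longrightarrow> Insert (a, i) = Insert (b, j) \<Longrightarrow> (a, i) = (b, j)"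
proof (induction a arbitrary: i b j rule: rev_induct)
  case Nil
  have i: "i = []" using compatible_pair_length[OF Nil(1)] by simp
  from Nil(2) show ?case
  proof (cases rule: compatible_pair_cases)
    case (snoc b' x j' y)
    obtain P' Q' P r c \<alpha> where "extension P' x P r c \<alpha>" "Insert (b, j) = (P, place Q' r c \<alpha> y)"
      using Insert_snocE[of b' x j' y] Nil(2) snoc by metis
    moreover from this(1) have "P \<noteq> []" by (rule extension_nonempty)
    ultimately show ?thesis using Nil(3) i by (simp add: Insert_Nil)
  qed (use i in simp)
next
  case (snoc x a)
  from snoc.prems(1) obtain i' y where i: "i = i' @ [y]" and len: "length a = length i'"
    by (cases rule: compatible_pair_cases) auto
  obtain P' Q' P r c \<alpha> where A: "compatible_pair (a, i')" "Insert (a, i') = (P', Q')" "tpair P' Q'"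
    "extension P' x P r c \<alpha>" "low y c Q'" "Insert (a @ [x], i) = (P, place Q' r c \<alpha> y)"
    unfolding i by (rule Insert_snocE[OF snoc.prems(1)[unfolded i] len])
  from snoc.prems(2) show ?case
  proof (cases rule: compatible_pair_cases)
    case Nil
    then show ?thesis using snoc.prems(3) A(6) extension_nonempty[OF A(4)] by (simp add: Insert_Nil)
  next
    case b: (snoc b' x' j' y')
    obtain P2' Q2' P2 r2 c2 \<alpha>2 where B: "compatible_pair (b', j')" "Insert (b', j') = (P2', Q2')"
      "tpair P2' Q2'" "extension P2' x' P2 r2 c2 \<alpha>2" "low y' c2 Q2'"
      "Insert (b, j) = (P2, place Q2' r2 c2 \<alpha>2 y')"
      unfolding b by (rule Insert_snocE[OF snoc.prems(2)[unfolded b(1,2)] b(3)])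
    have "P2 = P" "place Q' r c \<alpha> y = place Q2' r2 c2 \<alpha>2 y'"
      using snoc.prems(3) A(6) B(6) by simp_all
    then have "P' = P2' \<and> Q' = Q2' \<and> x = x' \<and> y = y'"
      using place_determines[OF A(3,4,5) B(3)] B(4,5) by simp
    moreover from this have "(a, i') = (b', j')"
      using snoc.IH[OF A(1) B(1)] A(2) B(2) by simp
    ultimately show ?thesis using b i by simp
  qed
qed

text \<open>The induction is on the total number of entries of \<open>Q\<close>, since a step with
  \<open>\<alpha> = 0\<close> adds an entry but no box.\<close>

lemma Insert_surj:
  "tpair P Q \<Longrightarrow> \<exists>a i. compatible_pair (a, i) \<and> Insert (a, i) = (P, Q)"
proof (induction "card {(b, n). b \<in> boxes Q \<and> n \<in> Q ! snd b ! fst b}" arbitrary: P Q rule: less_induct)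
  case less
  let ?E = "\<lambda>Q. {(b, n). b \<in> boxes Q \<and> n \<in> Q ! snd b ! fst b}"
  show ?case
  proof (cases "P = []")
    case True
    then have "Q = []" using less.prems length_eq_of_shape[of P Q] by (simp add: tpair_def)
    moreover have "compatible_pair ([], [])" by (simp add: compatible_pair_def)
    ultimately show ?thesis using True Insert_Nil by blast
  next
    case False
    from less.prems False obtain P' Q' x r c \<alpha> y where
      step: "tpair P' Q'" "extension P' x P r c \<alpha>" "low y c Q'" "0 < y" "Q = place Q' r c \<alpha> y"
      by (rule tpair_uninsert)
    have "finite (boxes Q)"
      by (rule finite_subset[of _ "\<Union>c<length Q. {..<length (Q ! c)} \<times> {c}"]) (auto simp: boxes_def)
    moreover have "finite (Q ! snd b ! fst b)" if "b \<in> boxes Q" for b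
      using less.prems that by (cases b) (auto simp: tpair_def rsvt_iff)
    moreover have "?E Q = Sigma (boxes Q) (\<lambda>b. Q ! snd b ! fst b)" by auto
    ultimately have fin: "finite (?E Q)" by simp
    have "?E Q' \<subseteq> ?E Q" unfolding step(5) using place_entry_old[OF step(1,2)] by auto
    moreover have "((r, c), y) \<in> ?E Q" unfolding step(5) using place_entry_new[OF step(1,2)] by simp
    moreover have "((r, c), y) \<notin> ?E Q'" using lowD(2)[OF step(3)] by auto
    ultimately have "?E Q' \<subset> ?E Q" by blast
    then have "card (?E Q') < card (?E Q)" by (rule psubset_card_mono[OF fin])
    from less.hyps[OF this step(1)] obtain a i where
      ai: "compatible_pair (a, i)" "Insert (a, i) = (P', Q')" by blast
    have len: "length a = length i" using compatible_pair_length[OF ai(1)] .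
    have "y \<le> last i \<and> (y = last i \<longrightarrow> last a < x)" if ne: "a \<noteq> []"
    proof -
      obtain c0 where "recorded (a, i) P' Q' c0" using Insert_tpair[OF ai] ne by blast
      then show ?thesis using low_iff_compatible[OF step(1,2)] step(3) by blast
    qed
    moreover have "0 < x" using step(2) by (simp add: extension_def)
    ultimately have "compatible_pair (a @ [x], i @ [y])"
      using ai(1) step(4) by (simp add: compatible_pair_snoc[OF len])
    moreover have "Insert (a @ [x], i @ [y]) = (P, Q)"
      unfolding Insert_snoc[OF len] ai(2) step(5) by (rule insert_step_eq_place[OF step(2)])
    ultimately show ?thesis by blast
  qed
qed

theorem theorem1p8:
  shows "bij_betw Insert bounded_compatible_pairs bounded_tableau_pairs"
  unfolding bij_betw_def
proof
  have "p = q" if "compatible_pair p" "compatible_pair q" "Insert p = Insert q" for p q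
    using Insert_inj[of "fst p" "snd p" "fst q" "snd q"] that by simp
  then show "inj_on Insert bounded_compatible_pairs"
    by (auto simp: inj_on_def bounded_compatible_pairs_def simp del: split_paired_All)
  have iff: "(P, Q) \<in> bounded_tableau_pairs \<longleftrightarrow> tpair P Q \<and> key_cond P Q" for P Q
    unfolding bounded_tableau_pairs_def tpair_def
    using key_ge_iff_key_cond[of P Q] by (auto simp: decreasing_tableau_iff_dtab)
  show "Insert ` bounded_compatible_pairs = bounded_tableau_pairs"
  proof (intro set_eqI iffI)
    fix t assume "t \<in> Insert ` bounded_compatible_pairs"
    then obtain a i where ai: "compatible_pair (a, i)" "bounded_pair (a, i)" "t = Insert (a, i)"
      by (auto simp: bounded_compatible_pairs_def)
    obtain P Q where t: "t = (P, Q)" by (cases t)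
    then have "tpair P Q \<and> key_cond P Q" using Insert_tpair[OF ai(1)] ai(2,3) by simp
    then show "t \<in> bounded_tableau_pairs" using iff t by simp
  next
    fix t assume t: "t \<in> bounded_tableau_pairs"
    obtain P Q where PQ: "t = (P, Q)" by (cases t)
    then have cond: "tpair P Q" "key_cond P Q" using t iff by auto
    obtain a i where ai: "compatible_pair (a, i)" "Insert (a, i) = (P, Q)"
      using Insert_surj[OF cond(1)] by blast
    then have "bounded_pair (a, i)" using Insert_tpair[OF ai] cond(2) by blast
    then show "t \<in> Insert ` bounded_compatible_pairs"
      using ai PQ by (auto simp: bounded_compatible_pairs_def intro!: image_eqI[of _ _ "(a, i)"])
  qed
qed

end
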